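(* Let $J,J'\ge 0$ be fixed constants (not depending on $n$) and let $\beta>0$ satisfy $\beta<\tfrac12$ and $\beta J<\tfrac12$. For each $n$, let $A=(A_{i,j})_{i,j=1}^n$ be a symmetric random matrix whose entries $A_{i,j}$, $1\le i\le j\le n$, are i.i.d. standard Gaussian; let $H_n(\sigma)=\langle\sigma,M\sigma\rangle$ for $\sigma\in\{-1,+1\}^n$, where $M_{i,j}=\frac{1}{\sqrt n}A_{i,j}+\frac{J}{n}$ for $i\ne j$ and $M_{i,i}=\frac{1}{\sqrt n}A_{i,i}+\frac{J'}{n}$; and let $$Z_n(\beta)=\frac{1}{2^n}\sum_{\sigma\in\{-1,+1\}^n}\exp\{\beta H_n(\sigma)\},\qquad F_n(\beta)=\frac1n\log Z_n(\beta).$$ (1) (Asymptotic normality) As $n\to\infty$, $$n\left(F_n(\beta)-F(\beta)\right)\xrightarrow{d}N(f_1,\alpha_1),$$ where $F(\beta)=\beta^2$, the mean is $$f_1=-\tfrac12\log(1-2\beta J)+\beta(J'-J)+\tfrac14\log(1-4\beta^2),$$ and the variance is $$\alpha_1=-\beta^2-\tfrac12\log(1-4\beta^2).$$ (2) (Approximation by signed cycle counts) For any sequence of positive integers $m_n\to\infty$ with $m_n=o(\sqrt{\log n})$, $$\log Z_n(\beta)+\tfrac12\log(1-2\beta J)-(n-1)\beta^2+\beta(J-J')-\beta C_{n,1}-\sum_{k=2}^{m_n}\frac{2(2\beta)^k\left(C_{n,k}-(n-1)\mathbb{I}_{k=2}\right)-(2\beta)^{2k}}{4k}\xrightarrow{p}0,$$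 where $C_{n,k}$ are the signed cycle statistics of the matrix $A$.
   Context: Signed cycles: for an $n\times n$ symmetric matrix $A$ and $k\ge 2$, $$C_{n,k}:=\left(\frac{1}{\sqrt n}\right)^k\sum_{i_0,i_1,\ldots,i_{k-1}}A_{i_0,i_1}A_{i_1,i_2}\cdots A_{i_{k-1},i_0},$$ where the sum is over all ordered tuples $(i_0,\ldots,i_{k-1})\in\{1,\ldots,n\}^k$ with all entries distinct; for $k=1$, $C_{n,1}:=\frac{1}{\sqrt n}\sum_{i=1}^nA_{i,i}$. $\mathbb{I}_{k=2}$ equals $1$ if $k=2$ and $0$ otherwise. $N(a,b)$ is the normal distribution with mean $a$ and variance $b$; $\xrightarrow{d}$ and $\xrightarrow{p}$ are convergence in distribution and in probability as $n\to\infty$. *)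

theory Defs
  imports "HOL-Probability.Probability" "HOL-Library.Landau_Symbols"
begin

text \<open>Matrices and spin vectors of size \<open>n\<close> are functions whose indices range over
  \<open>{1..n}\<close>. A random \<open>n \<times> n\<close> matrix on \<open>\<Omega>\<close> is a function
  \<open>A :: 'a \<Rightarrow> nat \<Rightarrow> nat \<Rightarrow> real\<close>, the \<open>(i, j)\<close> entry at
  the outcome \<open>\<omega>\<close> being \<open>A \<omega> i j\<close>.\<close>

definition gaussian_symmetric_matrix ::
    "'a measure \<Rightarrow> nat \<Rightarrow> ('a \<Rightarrow> nat \<Rightarrow> nat \<Rightarrow> real) \<Rightarrow> bool" where
  "gaussian_symmetric_matrix \<Omega> n A \<longleftrightarrow>
     prob_space \<Omega> \<and>
     (\<forall>\<omega>\<in>space \<Omega>. \<forall>i\<in>{1..n}. \<forall>j\<in>{1..n}. A \<omega> i j = A \<omega> j i) \<and>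
     (\<forall>i j. 1 \<le> i \<and> i \<le> j \<and> j \<le> n \<longrightarrow>
        distributed \<Omega> lborel (\<lambda>\<omega>. A \<omega> i j) std_normal_density) \<and>
     prob_space.indep_vars \<Omega> (\<lambda>_. borel) (\<lambda>(i, j) \<omega>. A \<omega> i j)
       {(i, j). 1 \<le> i \<and> i \<le> j \<and> j \<le> n}"

definition interaction ::
    "real \<Rightarrow> real \<Rightarrow> nat \<Rightarrow> (nat \<Rightarrow> nat \<Rightarrow> real) \<Rightarrow> nat \<Rightarrow> nat \<Rightarrow> real" where
  "interaction J J' n A i j = A i j / sqrt (real n) + (if i = j then J' else J) / real n"

definition hamiltonian ::
    "real \<Rightarrow> real \<Rightarrow> nat \<Rightarrow> (nat \<Rightarrow> nat \<Rightarrow> real) \<Rightarrow> (nat \<Rightarrow> real) \<Rightarrow> real" where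
  "hamiltonian J J' n A \<sigma> =
     (\<Sum>i\<in>{1..n}. \<sigma> i * (\<Sum>j\<in>{1..n}. interaction J J' n A i j * \<sigma> j))"

definition partition_function ::
    "real \<Rightarrow> real \<Rightarrow> real \<Rightarrow> nat \<Rightarrow> (nat \<Rightarrow> nat \<Rightarrow> real) \<Rightarrow> real" where
  "partition_function J J' \<beta> n A =
     1 / 2 ^ n * (\<Sum>\<sigma>\<in>{1..n} \<rightarrow>\<^sub>E {-1, 1}. exp (\<beta> * hamiltonian J J' n A \<sigma>))"

definition free_energy ::
    "real \<Rightarrow> real \<Rightarrow> real \<Rightarrow> nat \<Rightarrow> (nat \<Rightarrow> nat \<Rightarrow> real) \<Rightarrow> real" where
  "free_energy J J' \<beta> n A = 1 / real n * ln (partition_function J J' \<beta> n A)"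

text \<open>For \<open>k \<ge> 2\<close> the list \<open>is\<close> is the tuple
  \<open>(i\<^sub>0, \<dots>, i\<^bsub>k-1\<^esub>)\<close>, and \<open>(l + 1) mod k\<close> closes the cycle.
  The value at \<open>k = 0\<close> is irrelevant.\<close>

definition signed_cycle :: "nat \<Rightarrow> nat \<Rightarrow> (nat \<Rightarrow> nat \<Rightarrow> real) \<Rightarrow> real" where
  "signed_cycle n k A =
     (if k = 1 then 1 / sqrt (real n) * (\<Sum>i\<in>{1..n}. A i i)
      else (1 / sqrt (real n)) ^ k *
        (\<Sum>is\<in>{is. length is = k \<and> distinct is \<and> set is \<subseteq> {1..n}}.
           \<Prod>l<k. A (is ! l) (is ! ((l + 1) mod k))))"

text \<open>\<open>normal_density\<close> takes the standard deviation, whereas the parameter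
  \<open>b\<close> of \<open>N(a, b)\<close> is the variance.\<close>

definition normal_law :: "real \<Rightarrow> real \<Rightarrow> real measure" where
  "normal_law a b = density lborel (normal_density a (sqrt b))"

text \<open>In both modes of convergence the \<open>n\<close>-th variable lives on its own probability
  space \<open>\<Omega> n\<close>.\<close>

definition converges_in_distribution ::
    "(nat \<Rightarrow> 'a measure) \<Rightarrow> (nat \<Rightarrow> 'a \<Rightarrow> real) \<Rightarrow> real measure \<Rightarrow> bool" where
  "converges_in_distribution \<Omega> X \<mu> \<longleftrightarrow>
     (\<forall>n\<ge>1. X n \<in> borel_measurable (\<Omega> n)) \<and>
     weak_conv_m (\<lambda>n. distr (\<Omega> n) borel (X n)) \<mu>"

definition converges_in_probability ::
    "(nat \<Rightarrow> 'a measure) \<Rightarrow> (nat \<Rightarrow> 'a \<Rightarrow> real) \<Rightarrow> real \<Rightarrow> bool" where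
  "converges_in_probability \<Omega> X c \<longleftrightarrow>
     (\<forall>n\<ge>1. X n \<in> borel_measurable (\<Omega> n)) \<and>
     (\<forall>\<epsilon>>0. (\<lambda>n. measure (\<Omega> n) {\<omega> \<in> space (\<Omega> n). \<bar>X n \<omega> - c\<bar> > \<epsilon>}) \<longlonglongrightarrow> 0)"

end

theory Submission
  imports Defs "HOL-Real_Asymp.Real_Asymp"
begin

text \<open>Write \<open>lam = 2\<beta>\<close>, \<open>b = 2\<beta>J\<close>, let \<open>Z\<close> be the partition function of the
  off-diagonal Gaussian part divided by its mean, and \<open>L\<^sub>M\<close> the sum of
  \<open>lam\<^sup>k/(2k)\<close> times the centred signed \<open>k\<close>-cycle over \<open>2 \<le> k \<le> M\<close>, with
  limiting variance \<open>v\<^sub>M\<close>. The diagonal contributes exactly \<open>\<beta> C\<^bsub>n,1\<^esub>\<close>. The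
  Curie--Weiss term is a Gaussian mixture of external fields of order \<open>1/sqrt n\<close>, and a field
  of that order changes \<open>Z\<close> only by a constant factor, up to an error vanishing in \<open>L\<^sup>2\<close>; so
  \<open>J\<close> only enters through \<open>(1 - b)\<^bsup>-1/2\<^esup>\<close>.

  Linear combinations of signed cycles are asymptotically normal by Gaussian integration by
  parts: their characteristic functions solve \<open>\<phi>' = -t v \<phi>\<close> up to an error controlled by the
  fluctuations of a sum over pairs of paths, which are of order \<open>1/n\<close>. Under the tilt by
  \<open>Z\<close>, which is an average of Cameron--Martin shifts, \<open>L\<^sub>M\<close> moves by \<open>v\<^sub>M\<close>. Hence
  \<open>E(Z - exp(L\<^sub>M - v\<^sub>M/2))\<^sup>2\<close>, with the exponential truncated, tends to
  \<open>lim E Z\<^sup>2 - exp(v\<^sub>M)\<close>, which vanishes as \<open>M \<rightarrow> \<infinity>\<close> because the overlap has a Gaussian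
  limit. This gives both \<open>ln Z \<approx> L\<^sub>M - v\<^sub>M/2\<close> and its limit law.\<close>

section \<open>Paths, cycles and counting\<close>

text \<open>The L^2 comparison closes because two series agree. Two copies of \<open>Z\<close> give
  E Z^2 = exp(-lam^2/2) E exp(lam^2 R^2/(2n)), \<open>R\<close> being the overlap sum. The limit
  exp(-lam^2/2)/sqrt(1 - lam^2) is the exponential of the sum of lam^(2k)/(2k) over k >= 2: leaving
  out the diagonal cancels exactly the term k = 1. The coefficient lam^k/(2k) makes both the
  variance and the drift of the k-cycle term equal to lam^(2k)/(2k), so the cycle variance is a
  partial sum of the same series and no residual variance is left. An external field factors out
  because the magnetisations of the two copies and their overlap become independent Gaussians: E Z_s
  Z_t tends to C exp(s^2/2) exp(t^2/2), a kernel of rank one. Logarithms need a lower bound on the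
  exponential. The mean absolute values of the cycle terms are bounded by a geometric series
  uniformly in \<open>n\<close>; hence the cycle sum is bounded with high probability, and there
  absolute errors are relative errors. The same geometric tail replaces a fixed cutoff by a growing
  one.\<close>

definition edge :: "nat \<Rightarrow> nat \<Rightarrow> nat \<times> nat" where
  "edge i j = (min i j, max i j)"

fun path_edges :: "nat list \<Rightarrow> (nat \<times> nat) list" where
  "path_edges (a # b # r) = edge a b # path_edges (b # r)"
| "path_edges _ = []"

definition closing_edge :: "nat list \<Rightarrow> nat \<times> nat" where
  "closing_edge is = edge (last is) (hd is)"

text \<open>For a two-vertex list the closing edge repeats the only path edge, and for a one-vertex
  list it is a loop. So length 2 yields squares of entries and length 1 diagonal entries, without
  separate cases.\<close>

definition cycle_edges :: "nat list \<Rightarrow> (nat \<times> nat) list" where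
  "cycle_edges is = path_edges is @ [closing_edge is]"

definition tuples :: "nat \<Rightarrow> nat \<Rightarrow> nat list set" where
  "tuples n k = {is. length is = k \<and> distinct is \<and> set is \<subseteq> {1..n}}"

lemma edge_commute: "edge i j = edge j i"
  by (simp add: edge_def min.commute max.commute)

lemma edge_eq_iff: "edge a b = edge c d \<longleftrightarrow> (a = c \<and> b = d) \<or> (a = d \<and> b = c)"
  by (auto simp: edge_def min_def max_def)

lemma finite_tuples [simp]: "finite (tuples n k)"
  by (rule finite_subset[OF _ finite_lists_length_eq[of "{1..n}" k]]) (auto simp: tuples_def)

lemma length_path_edges [simp]: "length (path_edges w) = length w - 1"
  by (induction w rule: path_edges.induct) auto

lemma path_edges_snoc: "w \<noteq> [] \<Longrightarrow> path_edges (w @ [v]) = path_edges w @ [edge (last w) v]"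
  by (induction w rule: path_edges.induct) auto

lemma path_edges_append:
  "path_edges (a @ z # b) = path_edges (a @ [z]) @ path_edges (z # b)"
  by (induction a rule: path_edges.induct) auto

lemma path_edges_rev: "path_edges (rev w) = rev (path_edges w)"
proof (induction w rule: path_edges.induct)
  case (1 a b r)
  have "path_edges (rev (a # b # r)) = path_edges (rev (b # r) @ [a])" by simp
  also have "\<dots> = path_edges (rev (b # r)) @ [edge (last (rev (b # r))) a]"
    by (rule path_edges_snoc) simp
  finally show ?case using 1 by (simp add: edge_commute)
qed auto

lemma path_edges_endpoints: "edge a b \<in> set (path_edges w) \<Longrightarrow> a \<in> set w \<and> b \<in> set w"
  by (induction w rule: path_edges.induct) (auto simp: edge_eq_iff)

lemma path_edges_form: "e \<in> set (path_edges w) \<Longrightarrow> \<exists>a b. e = edge a b \<and> a \<in> set w \<and> b \<in> set w"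
  by (induction w rule: path_edges.induct) auto

lemma distinct_path_edges: "distinct w \<Longrightarrow> distinct (path_edges w)"
proof (induction w rule: path_edges.induct)
  case (1 a b r)
  then show ?case using path_edges_endpoints[of a b "b # r"] by auto
qed auto

text \<open>The start \<open>a\<close> lies on the first edge only, so the edge set determines the
  neighbour of \<open>a\<close>; removing that edge leaves the same situation with a shorter
  path.\<close>

lemma path_edges_determine:
  "distinct (a # u) \<Longrightarrow> distinct (a # w) \<Longrightarrow>
   set (path_edges (a # u)) = set (path_edges (a # w)) \<Longrightarrow> u = w"
proof (induction u arbitrary: a w)
  case Nil
  then show ?case by (cases w) auto
next
  case (Cons b u)
  then obtain c w' where w: "w = c # w'" by (cases w) auto
  have ne: "edge a x \<notin> set (path_edges (y # v))" if "a \<notin> set (y # v)" for x y v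
    using path_edges_endpoints[of a x "y # v"] that by auto
  have "edge a b \<in> insert (edge a c) (set (path_edges (c # w')))"
    using Cons.prems(3) w by auto
  then have bc: "b = c"
    using ne[of c w' b] Cons.prems w by (auto simp: edge_eq_iff)
  have "set (path_edges (b # u)) = set (path_edges (a # b # u)) - {edge a b}"
    using ne[of b u b] Cons.prems by auto
  moreover have "set (path_edges (b # w')) = set (path_edges (a # b # w')) - {edge a b}"
    using ne[of b w' b] Cons.prems w bc by auto
  ultimately have "set (path_edges (b # u)) = set (path_edges (b # w'))"
    using Cons.prems(3) unfolding w bc by (metis (no_types))
  then have "u = w'"
    using Cons.IH[of b w'] Cons.prems w bc by simp
  then show ?case using w bc by simp
qed

text \<open>The closing edge fixes the endpoints up to order. If both lists start at the same end,
  \<open>path_edges_determine\<close> makes them equal; otherwise it applies to the reversed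
  list.\<close>

lemma path_determine_up_to_rev:
  assumes d: "distinct u" "distinct w" "u \<noteq> []" "w \<noteq> []"
    and p: "set (path_edges u) = set (path_edges w)"
    and c: "closing_edge u = closing_edge w"
  shows "w = u \<or> w = rev u"
proof -
  consider "hd u = hd w" | "last w = hd u"
    using c by (auto simp: closing_edge_def edge_eq_iff)
  then show ?thesis
  proof cases
    case 1
    then show ?thesis
      using path_edges_determine[of "hd u" "tl u" "tl w"] d p
      by (metis list.collapse)
  next
    case 2
    have h: "hd (rev w) = hd u" using 2 d by (simp add: hd_rev)
    have "tl u = tl (rev w)"
      using path_edges_determine[of "hd u" "tl u" "tl (rev w)"] d p h
      by (metis list.collapse path_edges_rev set_rev distinct_rev rev_is_Nil_conv)
    then have "u = rev w" using h d by (metis list.collapse rev_is_Nil_conv)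
    then show ?thesis by simp
  qed
qed

section \<open>Connected edge sets and counting of vertices\<close>

inductive conn :: "(nat \<times> nat) set \<Rightarrow> nat set \<Rightarrow> bool" where
  conn_start: "conn {} {v}"
| conn_step: "conn E V \<Longrightarrow> u \<in> V \<Longrightarrow> conn (insert (edge u v) E) (insert v V)"

text \<open>The induction also carries that both endpoints of every edge lie in \<open>V\<close>:
  then a step to a new vertex necessarily adds a new edge, and every other step leaves
  \<open>V\<close> unchanged.\<close>

lemma conn_card:
  assumes "conn E V"
  shows "finite E \<and> finite V \<and> card V \<le> card E + 1"
proof -
  have "finite E \<and> finite V \<and> (\<forall>a b. edge a b \<in> E \<longrightarrow> a \<in> V \<and> b \<in> V) \<and> card V \<le> card E + 1"
    using assms
  proof induction
    case (conn_step E V u v)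
    show ?case
    proof (cases "v \<in> V")
      case True
      then show ?thesis
        using conn_step card_insert_le[of E "edge u v"]
        by (auto simp: insert_absorb edge_eq_iff)
    next
      case False
      then have "edge u v \<notin> E" using conn_step by blast
      then show ?thesis using conn_step False by (auto simp: edge_eq_iff)
    qed
  qed auto
  then show ?thesis by blast
qed

lemma conn_path_hd:
  "conn E V \<Longrightarrow> a \<in> V \<Longrightarrow> conn (E \<union> set (path_edges (a # w))) (V \<union> set (a # w))"
proof (induction w arbitrary: E V a)
  case Nil
  then show ?case by (simp add: insert_absorb)
next
  case (Cons b w)
  have "conn (insert (edge a b) E \<union> set (path_edges (b # w))) (insert b V \<union> set (b # w))"
    by (rule Cons.IH) (use Cons.prems in \<open>auto intro: conn_step\<close>)
  then show ?case using Cons.prems by (simp add: insert_absorb)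
qed

text \<open>The path is entered at a vertex \<open>z\<close> that is already reached; the piece
  after \<open>z\<close> is attached forwards and the piece before it backwards.\<close>

lemma conn_path:
  assumes "conn E V" "set w \<inter> V \<noteq> {}"
  shows "conn (E \<union> set (path_edges w)) (V \<union> set w)"
proof -
  obtain z where z: "z \<in> set w" "z \<in> V" using assms by auto
  then obtain a b where w: "w = a @ z # b" by (metis split_list)
  have "conn (E \<union> set (path_edges (z # rev a))) (V \<union> set (z # rev a))"
    by (rule conn_path_hd) (use assms z in auto)
  then have "conn (E \<union> set (path_edges (z # rev a)) \<union> set (path_edges (z # b)))
      (V \<union> set (z # rev a) \<union> set (z # b))"
    by (rule conn_path_hd) (use z in auto)
  moreover have "set (path_edges (z # rev a)) = set (path_edges (a @ [z]))"
    using path_edges_rev[of "a @ [z]"] by simp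
  moreover have "set (path_edges w) = set (path_edges (a @ [z])) \<union> set (path_edges (z # b))"
    unfolding w by (subst path_edges_append) simp
  moreover have "V \<union> set (z # rev a) \<union> set (z # b) = V \<union> set w"
    using w by auto
  ultimately show ?thesis by (simp add: Un_assoc)
qed

text \<open>At least one of the two paths meets \<open>V\<close> and is attached first; the other
  then hangs on their common vertex.\<close>

lemma conn_pair:
  assumes "conn E V" "(set u \<union> set w) \<inter> V \<noteq> {}" "set u \<inter> set w \<noteq> {}"
  shows "conn (E \<union> set (path_edges u) \<union> set (path_edges w)) (V \<union> set u \<union> set w)"
proof (cases "set u \<inter> V = {}")
  case False
  then show ?thesis
    using conn_path[OF conn_path[OF assms(1), of u], of w] assms(3) by blast
next
  case True
  then have "set w \<inter> V \<noteq> {}" using assms(2) by blast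
  then have "conn (E \<union> set (path_edges w) \<union> set (path_edges u)) (V \<union> set w \<union> set u)"
    using conn_path[OF conn_path[OF assms(1), of w], of u] assms(3) by blast
  then show ?thesis by (simp add: Un_ac)
qed

lemma closing_edge_share:
  assumes "closing_edge u = closing_edge w" "u \<noteq> []" "w \<noteq> []"
  shows "set u \<inter> set w \<noteq> {}"
  using assms by (auto simp: closing_edge_def edge_eq_iff) (metis hd_in_set last_in_set IntI emptyE)+

text \<open>Equal closing edges give the two paths of a pair a common endpoint, and the edge common
  to both pairs joins the pairs. So the four paths form a connected graph even though the closing
  edges themselves are not counted.\<close>

lemma four_paths_card:
  assumes ne: "u \<noteq> []" "w \<noteq> []" "u' \<noteq> []" "w' \<noteq> []"
    and c: "closing_edge u = closing_edge w" "closing_edge u' = closing_edge w'"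
    and m: "set (path_edges u @ path_edges w) \<inter> set (path_edges u' @ path_edges w') \<noteq> {}"
  shows "card (set (u @ w @ u' @ w'))
    \<le> card (set (path_edges u @ path_edges w @ path_edges u' @ path_edges w')) + 1"
proof -
  have "conn {} {hd u}" by (rule conn_start)
  then have 1: "conn ({} \<union> set (path_edges u) \<union> set (path_edges w)) ({hd u} \<union> set u \<union> set w)"
    by (rule conn_pair) (use ne closing_edge_share[OF c(1)] in auto)
  obtain e where e: "e \<in> set (path_edges u @ path_edges w)" "e \<in> set (path_edges u' @ path_edges w')"
    using m by auto
  obtain a b where ab: "e = edge a b" using e(1) path_edges_form[of e u] path_edges_form[of e w] by auto
  have "a \<in> set u \<union> set w" "a \<in> set u' \<union> set w'"
    using e ab path_edges_endpoints by auto
  then have "conn ({} \<union> set (path_edges u) \<union> set (path_edges w) \<union> set (path_edges u') \<union> set (path_edges w'))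
     ({hd u} \<union> set u \<union> set w \<union> set u' \<union> set w')"
    by (intro conn_pair 1) (use ne closing_edge_share[OF c(2)] in auto)
  from conn_card[OF this] show ?thesis
    using ne by (simp add: Un_ac insert_absorb)
qed

lemma even_counts_card:
  assumes "\<And>e. even (count_list es e)"
  shows "2 * card (set es) \<le> length es"
proof -
  have "2 * card (set es) = (\<Sum>e\<in>set es. 2)" by simp
  also have "\<dots> \<le> (\<Sum>e\<in>set es. count_list es e)"
  proof (rule sum_mono)
    fix e assume "e \<in> set es"
    then have "count_list es e \<noteq> 0" by (simp add: count_list_0_iff)
    then show "2 \<le> count_list es e" using assms[of e] by (auto elim!: evenE)
  qed
  also have "\<dots> = length es" by (rule sum_count_set) auto
  finally show ?thesis .
qed

lemma even_counts_distinct_eq: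
  assumes "\<And>e. even (count_list (es @ fs) e)" "distinct es" "distinct fs"
  shows "set es = set fs"
proof -
  have "count_list xs e = (if e \<in> set xs then 1 else 0)" if "distinct xs" for xs :: "'a list" and e
    using that by (induction xs) auto
  then show ?thesis using assms
    by (metis (no_types, lifting) count_list_append even_add odd_one even_zero set_eqI)
qed

text \<open>Such a list is a table of \<open>p\<close> values together with a word of
  \<open>N\<close> positions in the table. Only the power of \<open>n\<close> matters later.\<close>

lemma card_lists_few_values:
  assumes "n \<ge> 1" "p \<ge> 1"
  shows "finite {xs. length xs = N \<and> set xs \<subseteq> {1..n} \<and> card (set xs) \<le> p} \<and>
    card {xs. length xs = N \<and> set xs \<subseteq> {1..n} \<and> card (set xs) \<le> p} \<le> p ^ N * n ^ p"
proof -
  let ?A = "{xs. length xs = N \<and> set xs \<subseteq> {1..n} \<and> card (set xs) \<le> p}"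
  let ?Y = "{ys. set ys \<subseteq> {1..n} \<and> length ys = p}"
  let ?F = "{fs. set fs \<subseteq> {..<p} \<and> length fs = N}"
  let ?h = "\<lambda>(ys, fs). map (\<lambda>i. ys ! i) fs"
  have sub: "?A \<subseteq> ?h ` (?Y \<times> ?F)"
  proof
    fix xs assume xs: "xs \<in> ?A"
    obtain zs where zs: "set zs = set xs" "distinct zs"
      using finite_distinct_list[of "set xs"] by auto
    have lz: "length zs \<le> p" using zs xs distinct_card[OF zs(2)] by simp
    \<comment> \<open>The table is padded to length \<open>p\<close> with the value 1, which belongs
      to the range because \<open>n \<ge> 1\<close>.\<close>
    define ys where "ys = zs @ replicate (p - length zs) 1"
    have ys: "ys \<in> ?Y" using zs xs lz assms by (auto simp: ys_def)
    have "\<forall>x\<in>set xs. \<exists>i<p. ys ! i = x"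
    proof
      fix x assume "x \<in> set xs"
      then obtain i where "i < length zs" "zs ! i = x" using zs by (metis in_set_conv_nth)
      then show "\<exists>i<p. ys ! i = x" using lz by (auto simp: ys_def nth_append intro!: exI[of _ i])
    qed
    then obtain g where g: "\<And>x. x \<in> set xs \<Longrightarrow> g x < p \<and> ys ! g x = x" by metis
    have "map g xs \<in> ?F" using g xs by auto
    moreover have "?h (ys, map g xs) = xs" using g by (auto intro: map_idI)
    ultimately show "xs \<in> ?h ` (?Y \<times> ?F)" using ys by (metis (no_types, lifting) SigmaI image_eqI)
  qed
  have fin: "finite (?Y \<times> ?F)" by (intro finite_cartesian_product finite_lists_length_eq) auto
  have "card ?A \<le> card (?Y \<times> ?F)"
    using card_mono[OF finite_imageI[OF fin] sub] card_image_le[OF fin, of ?h] by linarith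
  also have "\<dots> = p ^ N * n ^ p"
    by (simp add: card_cartesian_product card_lists_length_eq)
  finally show ?thesis using finite_subset[OF sub finite_imageI[OF fin]] by simp
qed

section \<open>Cyclic rotations and edges at selected positions\<close>

lemma cyclic_successor_card:
  fixes k :: nat
  assumes "S \<noteq> {}" "S \<subset> {..<k}"
  shows "card (S \<union> (\<lambda>l. (l + 1) mod k) ` S) \<ge> card S + 1"
proof (rule ccontr)
  have fin: "finite S" by (rule finite_subset[of S "{..<k}"]) (use assms in auto)
  assume "\<not> ?thesis"
  then have "card (S \<union> (\<lambda>l. (l + 1) mod k) ` S) \<le> card S" by simp
  then have "S = S \<union> (\<lambda>l. (l + 1) mod k) ` S"
    using card_seteq[of "S \<union> (\<lambda>l. (l + 1) mod k) ` S" S] fin by auto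
  \<comment> \<open>Were the union no larger than \<open>S\<close>, then \<open>S\<close> would be
    closed under the cyclic successor, and iterating from one element would reach every
    position.\<close>
  then have step: "(l + 1) mod k \<in> S" if "l \<in> S" for l using that by blast
  obtain s where s: "s \<in> S" using assms by auto
  have sk: "s < k" using s assms by auto
  have "(s + j) mod k \<in> S" for j
  proof (induction j)
    case 0
    then show ?case using s sk by simp
  next
    case (Suc j)
    have "((s + j) mod k + 1) mod k = (s + Suc j) mod k" by (simp add: mod_Suc_eq)
    then show ?case using step[OF Suc] by metis
  qed
  moreover have "(s + (k - s + t)) mod k = t" if "t < k" for t using that sk by simp
  ultimately have "{..<k} \<subseteq> S" by (metis lessThan_iff subsetI)
  then show False using assms by auto
qed

lemma path_edges_nth: "l + 1 < length w \<Longrightarrow> path_edges w ! l = edge (w ! l) (w ! (l + 1))"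
proof (induction w arbitrary: l rule: path_edges.induct)
  case (1 a b r)
  then show ?case by (cases l) auto
qed auto

lemma length_cycle_edges [simp]: "w \<noteq> [] \<Longrightarrow> length (cycle_edges w) = length w"
  by (cases w) (auto simp: cycle_edges_def)

lemma cycle_edges_nth:
  assumes "l < length w"
  shows "cycle_edges w ! l = edge (w ! l) (w ! ((l + 1) mod length w))"
proof (cases "l + 1 = length w")
  case True
  then have "w \<noteq> []" by auto
  moreover have "l = length w - 1" using True by simp
  ultimately show ?thesis using True
    by (simp add: cycle_edges_def nth_append closing_edge_def last_conv_nth hd_conv_nth)
next
  case False
  then have "l < length w - 1" using assms by simp
  then show ?thesis
    by (simp add: cycle_edges_def nth_append path_edges_nth)
qed

lemma cycle_edges_rotate:
  assumes "w \<noteq> []"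
  shows "cycle_edges (rotate p w) = rotate p (cycle_edges w)"
proof (rule nth_equalityI)
  show "length (cycle_edges (rotate p w)) = length (rotate p (cycle_edges w))"
    using assms by simp
  fix l assume l: "l < length (cycle_edges (rotate p w))"
  let ?k = "length w"
  have lk: "l < ?k" using l assms by simp
  have m: "(p + l) mod ?k < ?k" "(l + 1) mod ?k < ?k" using assms by auto
  have "((p + l) mod ?k + 1) mod ?k = (p + (l + 1) mod ?k) mod ?k"
    by (simp add: mod_Suc_eq mod_add_right_eq)
  then show "cycle_edges (rotate p w) ! l = rotate p (cycle_edges w) ! l"
    using lk m assms by (simp add: cycle_edges_nth nth_rotate)
qed

lemma bij_betw_rotate_tuples: "bij_betw (rotate p) (tuples n k) (tuples n k)"
proof -
  have inj: "inj_on (rotate p) (tuples n k)"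
  proof (rule inj_onI)
    fix u w assume "u \<in> tuples n k" "w \<in> tuples n k" "rotate p u = rotate p w"
    moreover have "rotate (k - p mod k) (rotate p x) = x" if "length x = k" for x :: "nat list"
    proof (cases "k = 0")
      case False
      have "(k - p mod k + p) mod k = (k - p mod k + p mod k) mod k" by (simp add: mod_add_right_eq)
      also have "\<dots> = 0" using False by simp
      finally show ?thesis using that by (simp add: rotate_rotate rotate_id)
    qed (use that in auto)
    ultimately show "u = w" by (metis (mono_tags, lifting) tuples_def mem_Collect_eq)
  qed
  moreover have "rotate p ` tuples n k \<subseteq> tuples n k" by (auto simp: tuples_def)
  ultimately show ?thesis using endo_inj_surj[OF finite_tuples] by (auto simp: bij_betw_def)
qed

text \<open>Equal edges at two different positions would make each position the cyclic successor of
  the other, so the length would divide 2. For length 2 this does happen.\<close>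

lemma cycle_edges_inj:
  assumes "distinct w" "length w \<ge> 3" "l < length w" "l' < length w"
    "cycle_edges w ! l = cycle_edges w ! l'"
  shows "l = l'"
proof (rule ccontr)
  assume ne: "l \<noteq> l'"
  let ?k = "length w"
  have "0 < ?k" using assms by linarith
  then have s: "(l + 1) mod ?k < ?k" "(l' + 1) mod ?k < ?k" by simp_all
  have "l = (l' + 1) mod ?k \<and> (l + 1) mod ?k = l'"
  proof -
    have "w ! l = w ! l' \<or> w ! l = w ! ((l' + 1) mod ?k) \<and> w ! ((l + 1) mod ?k) = w ! l'"
      using assms(3-5) by (simp only: cycle_edges_nth edge_eq_iff) blast
    then show ?thesis using nth_eq_iff_index_eq[OF assms(1)] assms(3,4) s ne by metis
  qed
  then have "((l' + 1) mod ?k + 1) mod ?k = l'" by metis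
  then have "(l' + 2) mod ?k = l'" by (simp add: mod_Suc_eq)
  then have "(l' + 2) mod ?k = l' mod ?k" using assms by simp
  then have "?k dvd 2" by (metis mod_eq_dvd_iff_nat diff_add_inverse le_add1)
  then show False using assms(2) by (auto dest: dvd_imp_le)
qed

text \<open>A list in increasing order of position rather than a set, so that it can serve directly
  as a monomial.\<close>

definition selected_edges :: "nat set \<Rightarrow> nat list \<Rightarrow> (nat \<times> nat) list" where
  "selected_edges S w = map (\<lambda>l. cycle_edges w ! l) (sorted_list_of_set S)"

lemma selected_edges:
  assumes "distinct w" "length w = k" "S \<subset> {..<k}"
  shows "distinct (selected_edges S w)" "length (selected_edges S w) = card S"
proof -
  have fin: "finite S" by (rule finite_subset[of S "{..<k}"]) (use assms in auto)
  have "inj_on ((!) (cycle_edges w)) S"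
  proof (rule inj_onI, rule ccontr)
    fix l l' assume l: "l \<in> S" "l' \<in> S" "cycle_edges w ! l = cycle_edges w ! l'" "l \<noteq> l'"
    \<comment> \<open>A proper subset with two positions forces \<open>k \<ge> 3\<close>, which
      rules out the repeated edge of a 2-cycle.\<close>
    have "card {l, l'} \<le> card S" using l fin by (intro card_mono) auto
    moreover have "card S < k" using psubset_card_mono[OF _ assms(3)] by simp
    ultimately have "k \<ge> 3" using l by simp
    moreover have "l < k" "l' < k" using l assms(3) by auto
    ultimately show False using cycle_edges_inj[of w l l'] assms l by auto
  qed
  then show "distinct (selected_edges S w)"
    using fin by (simp add: selected_edges_def distinct_map)
  show "length (selected_edges S w) = card S" using fin by (simp add: selected_edges_def)
qed

text \<open>The endpoints of the selected edges can be read off the edge set alone, so the two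
  tuples share them. By \<open>cyclic_successor_card\<close> there are at least card S + 1 of them,
  and inclusion-exclusion finishes the count.\<close>

lemma selected_edges_vertices:
  assumes "distinct w" "length w = k" "distinct w'" "length w' = k"
    and S: "S \<noteq> {}" "S \<subset> {..<k}"
    and eq: "set (selected_edges S w) = set (selected_edges S w')"
  shows "card (set (w @ w')) + card S + 1 \<le> 2 * k"
proof -
  have fin: "finite S" by (rule finite_subset[of S "{..<k}"]) (use S in auto)
  let ?T = "S \<union> (\<lambda>l. (l + 1) mod k) ` S"
  have T: "?T \<subseteq> {..<k}" using S by auto
  have v: "(\<Union>(a, b)\<in>set (selected_edges S x). {a, b}) = (!) x ` ?T" if "length x = k" for x
  proof -
    have "(\<Union>(a, b)\<in>set (selected_edges S x). {a, b})
        = (\<Union>l\<in>S. case cycle_edges x ! l of (a, b) \<Rightarrow> {a, b})"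
      using fin by (simp add: selected_edges_def)
    also have "\<dots> = (\<Union>l\<in>S. {x ! l, x ! ((l + 1) mod k)})"
    proof (rule SUP_cong)
      fix l assume "l \<in> S"
      then have "l < length x" using S that by auto
      then show "(case cycle_edges x ! l of (a, b) \<Rightarrow> {a, b}) = {x ! l, x ! ((l + 1) mod k)}"
        using that by (auto simp: cycle_edges_nth edge_def min_def max_def)
    qed simp
    finally show ?thesis by auto
  qed
  have "inj_on ((!) w) ?T"
    by (rule inj_on_nth) (use assms T in auto)
  then have c: "card ((!) w ` ?T) = card ?T" by (rule card_image)
  have "(!) w ` ?T = (!) w' ` ?T" using v[of w] v[of w'] assms by metis
  moreover have "(!) x ` ?T \<subseteq> set x" if "length x = k" for x :: "nat list"
    using T that by auto
  ultimately have "(!) w ` ?T \<subseteq> set w \<inter> set w'" using assms by (metis le_inf_iff)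
  then have "card ?T \<le> card (set w \<inter> set w')" using c by (metis List.finite_set card_mono finite_Int)
  then have "card S + 1 \<le> card (set w \<inter> set w')"
    using cyclic_successor_card[OF S] by linarith
  moreover have "card (set w \<union> set w') + card (set w \<inter> set w') = 2 * k"
    using card_Un_Int[of "set w" "set w'"] assms by (simp add: distinct_card)
  ultimately show ?thesis by simp
qed

section \<open>Gaussian product spaces\<close>

definition gauss_space :: "'i set \<Rightarrow> ('i \<Rightarrow> real) measure" where
  "gauss_space I = PiM I (\<lambda>_. std_normal_distribution)"

text \<open>Monomials are lists with repetition: products are concatenations, and the exponent of a
  variable is its \<open>count_list\<close>.\<close>

definition mon :: "'i list \<Rightarrow> ('i \<Rightarrow> real) \<Rightarrow> real" where
  "mon es x = prod_list (map x es)"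

definition normal_moment :: "nat \<Rightarrow> real" where
  "normal_moment m = (\<integral>x. x ^ m \<partial>std_normal_distribution)"

definition mon_expectation :: "'i list \<Rightarrow> real" where
  "mon_expectation es = (\<Prod>e\<in>set es. normal_moment (count_list es e))"

lemma mon_simps [simp]: "mon [] x = 1" "mon (e # es) x = x e * mon es x"
  "mon (es @ fs) x = mon es x * mon fs x"
  by (auto simp: mon_def)

lemma prob_space_std_normal: "prob_space std_normal_distribution"
  by (rule prob_space_normal_density) simp

lemma prob_space_gauss_space: "prob_space (gauss_space I)"
  unfolding gauss_space_def by (rule prob_space_PiM) (rule prob_space_std_normal)

lemma product_prob_space_std_normal: "product_prob_space (\<lambda>_::'i. std_normal_distribution)"
  by (rule product_prob_spaceI) (rule prob_space_std_normal)

lemma sets_gauss_space: "sets (gauss_space I) = sets (PiM I (\<lambda>_. borel))"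
  unfolding gauss_space_def by (rule sets_PiM_cong) auto

lemma measurable_gauss_space_cong: "measurable (gauss_space I) M = measurable (PiM I (\<lambda>_. borel)) M"
  by (rule measurable_cong_sets) (auto simp: sets_gauss_space)

lemma space_gauss_space: "space (gauss_space I) = extensional I"
  by (auto simp: gauss_space_def space_PiM PiE_def)

lemma measurable_coordinate: "e \<in> I \<Longrightarrow> (\<lambda>x. x e) \<in> borel_measurable (gauss_space I)"
  unfolding measurable_gauss_space_cong by measurable

lemma mon_measurable: "set es \<subseteq> I \<Longrightarrow> mon es \<in> borel_measurable (gauss_space I)"
proof (induction es)
  case (Cons e es)
  have "(\<lambda>x. x e * mon es x) \<in> borel_measurable (gauss_space I)"
    by (rule borel_measurable_times[OF measurable_coordinate]) (use Cons in auto)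
  moreover have "mon (e # es) = (\<lambda>x. x e * mon es x)" by auto
  ultimately show ?case by simp
qed (simp add: mon_def[abs_def])

lemma mon_eq_prod: "finite I \<Longrightarrow> set es \<subseteq> I \<Longrightarrow> mon es x = (\<Prod>e\<in>I. x e ^ count_list es e)"
proof (induction es)
  case (Cons e es)
  have "(\<Prod>f\<in>I. x f ^ count_list (e # es) f) = (\<Prod>f\<in>I. (if f = e then x f else 1) * x f ^ count_list es f)"
    by (rule prod.cong) auto
  also have "\<dots> = x e * (\<Prod>f\<in>I. x f ^ count_list es f)"
    using Cons.prems by (simp add: prod.distrib prod.delta)
  finally show ?case using Cons by simp
qed simp

lemma
  assumes "finite I" "set es \<subseteq> I"
  shows integrable_mon: "integrable (gauss_space I) (mon es)"
    and integral_mon: "(\<integral>x. mon es x \<partial>gauss_space I) = mon_expectation es"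
proof -
  interpret product_prob_space "\<lambda>_::'a. std_normal_distribution" by (rule product_prob_space_std_normal)
  have eq: "mon es = (\<lambda>x. \<Prod>e\<in>I. x e ^ count_list es e)" using mon_eq_prod[OF assms] by auto
  show "integrable (gauss_space I) (mon es)"
    unfolding eq gauss_space_def
    by (rule product_integrable_prod) (use assms integrable_std_normal_distribution_moment in auto)
  have "(\<integral>x. mon es x \<partial>gauss_space I) = (\<Prod>e\<in>I. normal_moment (count_list es e))"
    unfolding eq gauss_space_def normal_moment_def
    by (rule product_integral_prod) (use assms integrable_std_normal_distribution_moment in auto)
  also have "\<dots> = mon_expectation es"
    unfolding mon_expectation_def
  proof (rule prod.mono_neutral_right[OF assms])
    show "\<forall>i\<in>I - set es. normal_moment (count_list es i) = 1"
      using prob_space.prob_space[OF prob_space_std_normal]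
      by (auto simp: normal_moment_def count_list_0_iff)
  qed
  finally show "(\<integral>x. mon es x \<partial>gauss_space I) = mon_expectation es" .
qed

lemma normal_moment_odd: "odd m \<Longrightarrow> normal_moment m = 0"
  by (simp add: normal_moment_def integral_std_normal_distribution_moment_odd)

lemma normal_moment_2: "normal_moment 2 = 1" "normal_moment (Suc 0) = 0" "normal_moment 0 = 1"
  using std_normal_distribution_even_moments(1)[of 1] std_normal_distribution_even_moments(1)[of 0]
    normal_moment_odd[of 1]
  by (auto simp: normal_moment_def)

lemma mon_expectation_odd: "odd (count_list es e) \<Longrightarrow> mon_expectation es = 0"
proof -
  assume o: "odd (count_list es e)"
  then have "e \<in> set es" by (metis count_list_0_iff even_zero)
  then show ?thesis using normal_moment_odd[OF o] by (auto simp: mon_expectation_def)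
qed

lemma mon_expectation_append_disjoint:
  assumes "set es \<inter> set fs = {}"
  shows "mon_expectation (es @ fs) = mon_expectation es * mon_expectation fs"
proof -
  have "mon_expectation (es @ fs) = (\<Prod>e\<in>set es. normal_moment (count_list (es @ fs) e)) *
      (\<Prod>e\<in>set fs. normal_moment (count_list (es @ fs) e))"
    unfolding mon_expectation_def set_append by (rule prod.union_disjoint) (use assms in auto)
  also have "(\<Prod>e\<in>set es. normal_moment (count_list (es @ fs) e)) = mon_expectation es"
    unfolding mon_expectation_def by (rule prod.cong) (use assms in \<open>auto simp: count_list_0_iff disjoint_iff\<close>)
  also have "(\<Prod>e\<in>set fs. normal_moment (count_list (es @ fs) e)) = mon_expectation fs"
    unfolding mon_expectation_def
  proof (rule prod.cong)
    fix e assume "e \<in> set fs"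
    then have "e \<notin> set es" using assms by auto
    then show "normal_moment (count_list (es @ fs) e) = normal_moment (count_list fs e)" by simp
  qed simp
  finally show ?thesis .
qed

text \<open>Bounds all monomials of degree at most \<open>N\<close>, independently of the number of
  variables and hence of \<open>n\<close>. The summand 1 makes the base at least 1, so the exponent
  can be raised from the number of distinct variables to \<open>N\<close>.\<close>

definition moment_bound :: "nat \<Rightarrow> real" where
  "moment_bound N = (1 + (\<Sum>m\<le>N. \<bar>normal_moment m\<bar>)) ^ N"

lemma moment_bound_ge_1: "1 \<le> moment_bound N"
  unfolding moment_bound_def by (rule one_le_power) (simp add: sum_nonneg)

lemma mon_expectation_bound:
  assumes "length es \<le> N"
  shows "\<bar>mon_expectation es\<bar> \<le> moment_bound N"
proof -
  let ?K = "1 + (\<Sum>m\<le>N. \<bar>normal_moment m\<bar>)"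
  have "\<bar>mon_expectation es\<bar> = (\<Prod>e\<in>set es. \<bar>normal_moment (count_list es e)\<bar>)"
    by (simp add: mon_expectation_def abs_prod)
  also have "\<dots> \<le> (\<Prod>e\<in>set es. ?K)"
  proof (rule prod_mono, intro conjI)
    fix e assume "e \<in> set es"
    have "count_list es e \<le> N" using count_le_length[of es e] assms by linarith
    then have "\<bar>normal_moment (count_list es e)\<bar> \<le> (\<Sum>m\<le>N. \<bar>normal_moment m\<bar>)"
      by (intro member_le_sum) auto
    then show "\<bar>normal_moment (count_list es e)\<bar> \<le> ?K" by simp
  qed simp
  also have "\<dots> = ?K ^ card (set es)" by simp
  also have "\<dots> \<le> ?K ^ N"
    by (rule power_increasing) (use card_length[of es] assms in \<open>auto simp: sum_nonneg\<close>)
  finally show ?thesis by (simp add: moment_bound_def)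
qed

section \<open>Polynomials in the Gaussian coordinates, all of them integrable\<close>

definition gpoly :: "'i set \<Rightarrow> (('i \<Rightarrow> real) \<Rightarrow> real) \<Rightarrow> bool" where
  "gpoly I F \<longleftrightarrow> (\<exists>T. (\<forall>(a, es)\<in>set T. set es \<subseteq> I) \<and> F = (\<lambda>x. \<Sum>(a, es)\<leftarrow>T. a * mon es x))"

lemma gpoly_const: "gpoly I (\<lambda>x. c)"
  unfolding gpoly_def by (rule exI[of _ "[(c, [])]"]) auto

lemma gpoly_mon: "set es \<subseteq> I \<Longrightarrow> gpoly I (mon es)"
  unfolding gpoly_def by (rule exI[of _ "[(1, es)]"]) auto

lemma gpoly_add: "gpoly I F \<Longrightarrow> gpoly I G \<Longrightarrow> gpoly I (\<lambda>x. F x + G x)"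
proof -
  assume "gpoly I F" "gpoly I G"
  then obtain T U where "\<forall>(a, es)\<in>set T. set es \<subseteq> I" "F = (\<lambda>x. \<Sum>(a, es)\<leftarrow>T. a * mon es x)"
    "\<forall>(a, es)\<in>set U. set es \<subseteq> I" "G = (\<lambda>x. \<Sum>(a, es)\<leftarrow>U. a * mon es x)" unfolding gpoly_def by blast
  then show ?thesis unfolding gpoly_def by (intro exI[of _ "T @ U"]) auto
qed

lemma gpoly_mult_mon: "gpoly I F \<Longrightarrow> set fs \<subseteq> I \<Longrightarrow> gpoly I (\<lambda>x. (c * mon fs x) * F x)"
proof -
  assume "gpoly I F" and fs: "set fs \<subseteq> I"
  then obtain T where T: "\<forall>(a, es)\<in>set T. set es \<subseteq> I" "F = (\<lambda>x. \<Sum>(a, es)\<leftarrow>T. a * mon es x)"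
    unfolding gpoly_def by blast
  show ?thesis unfolding gpoly_def
    by (intro exI[of _ "map (\<lambda>(a, es). (c * a, fs @ es)) T"])
      (use T fs in \<open>auto simp: sum_list_const_mult[symmetric] o_def case_prod_unfold algebra_simps fun_eq_iff\<close>)
qed

lemma gpoly_mult: "gpoly I F \<Longrightarrow> gpoly I G \<Longrightarrow> gpoly I (\<lambda>x. F x * G x)"
proof -
  assume "gpoly I F" and G: "gpoly I G"
  then obtain T where T: "\<forall>(a, es)\<in>set T. set es \<subseteq> I" "F = (\<lambda>x. \<Sum>(a, es)\<leftarrow>T. a * mon es x)"
    unfolding gpoly_def by blast
  have "gpoly I (\<lambda>x. (\<Sum>(a, es)\<leftarrow>T. a * mon es x) * G x)" using T(1)
  proof (induction T)
    case Nil
    then show ?case using gpoly_const[of I 0] by simp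
  next
    case (Cons t T)
    obtain a es where t: "t = (a, es)" by (cases t)
    have "gpoly I (\<lambda>x. (a * mon es x) * G x + (\<Sum>(a, es)\<leftarrow>T. a * mon es x) * G x)"
      by (intro gpoly_add gpoly_mult_mon Cons.IH G) (use Cons.prems t in auto)
    then show ?case using t by (simp add: algebra_simps)
  qed
  then show ?thesis using T by simp
qed

lemma gpoly_cmult: "gpoly I F \<Longrightarrow> gpoly I (\<lambda>x. c * F x)"
  by (rule gpoly_mult[OF gpoly_const])

lemma gpoly_sum: "(\<And>a. a \<in> A \<Longrightarrow> gpoly I (F a)) \<Longrightarrow> gpoly I (\<lambda>x. \<Sum>a\<in>A. F a x)"
  by (induction A rule: infinite_finite_induct) (auto intro: gpoly_add gpoly_const)

lemma gpoly_coordinate: "e \<in> I \<Longrightarrow> gpoly I (\<lambda>x. x e)"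
  using gpoly_mon[of "[e]" I] by (simp add: mon_def[abs_def])

lemma gpoly_diff: "gpoly I F \<Longrightarrow> gpoly I G \<Longrightarrow> gpoly I (\<lambda>x. F x - G x)"
  using gpoly_add[OF _ gpoly_cmult[of I G "-1"], of F] by simp

lemma gpoly_power: "gpoly I F \<Longrightarrow> gpoly I (\<lambda>x. F x ^ k)"
  by (induction k) (auto intro: gpoly_const gpoly_mult)

lemmas gpoly_intros = gpoly_const gpoly_mon gpoly_add gpoly_mult gpoly_sum gpoly_coordinate gpoly_diff
  gpoly_power

lemma gpoly_integrable:
  assumes "finite I" "gpoly I F"
  shows "integrable (gauss_space I) F"
proof -
  obtain T where T: "\<forall>(a, es)\<in>set T. set es \<subseteq> I" "F = (\<lambda>x. \<Sum>(a, es)\<leftarrow>T. a * mon es x)"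
    using assms(2) unfolding gpoly_def by blast
  have "integrable (gauss_space I) (\<lambda>x. \<Sum>(a, es)\<leftarrow>T. a * mon es x)" using T(1)
  proof (induction T)
    case (Cons t T)
    then show ?case using integrable_mon[OF assms(1)] by (cases t) auto
  qed simp
  then show ?thesis using T by simp
qed

lemma gpoly_measurable: "gpoly I F \<Longrightarrow> F \<in> borel_measurable (gauss_space I)"
proof -
  assume "gpoly I F"
  then obtain T where T: "\<forall>(a, es)\<in>set T. set es \<subseteq> I" "F = (\<lambda>x. \<Sum>(a, es)\<leftarrow>T. a * mon es x)"
    unfolding gpoly_def by blast
  have "(\<lambda>x. \<Sum>(a, es)\<leftarrow>T. a * mon es x) \<in> borel_measurable (gauss_space I)" using T(1)
  proof (induction T)
    case (Cons t T)
    obtain a es where t: "t = (a, es)" by (cases t)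
    have "(\<lambda>x. a * mon es x + (\<Sum>(a, es)\<leftarrow>T. a * mon es x)) \<in> borel_measurable (gauss_space I)"
      by (intro borel_measurable_add borel_measurable_times mon_measurable borel_measurable_const)
        (use Cons t in auto)
    then show ?case using t by simp
  qed simp
  then show ?thesis using T by simp
qed

lemma mon_restrict: "set es \<subseteq> I \<Longrightarrow> mon es (restrict x I) = mon es x"
  by (induction es) auto

lemma mon_poly: "\<exists>p. \<forall>y. mon es (x(e := y)) = poly p (y::real)"
proof (induction es)
  case Nil
  show ?case by (rule exI[of _ 1]) simp
next
  case (Cons f es)
  then obtain p where p: "\<forall>y. mon es (x(e := y)) = poly p y" by blast
  show ?case
    by (rule exI[of _ "(if f = e then [:0, 1:] else [:x f:]) * p"])
      (use p in \<open>cases "f = e"; simp del: fun_upd_apply; simp\<close>)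
qed

text \<open>Along a single coordinate everything is an ordinary polynomial, which reduces
  integration by parts to one dimension.\<close>

lemma gpoly_poly:
  assumes "gpoly I F"
  shows "\<exists>p. \<forall>y. F (x(e := y)) = poly p (y::real)"
proof -
  obtain T where T: "F = (\<lambda>x. \<Sum>(a, es)\<leftarrow>T. a * mon es x)"
    using assms unfolding gpoly_def by (elim exE conjE)
  have "\<exists>p. \<forall>y. (\<Sum>(a, es)\<leftarrow>T. a * mon es (x(e := y))) = poly p y"
  proof (induction T)
    case Nil
    show ?case by (rule exI[of _ 0]) simp
  next
    case (Cons t T)
    obtain a es where t: "t = (a, es)" by (cases t)
    obtain p where p: "\<forall>y. (\<Sum>(a, es)\<leftarrow>T. a * mon es (x(e := y))) = poly p y" using Cons by blast
    obtain q where q: "\<forall>y. mon es (x(e := y)) = poly q y" using mon_poly[of es x e] by blast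
    show ?case by (rule exI[of _ "smult a q + p"]) (use p q t in \<open>simp del: fun_upd_apply\<close>)
  qed
  then show ?thesis using T by simp
qed

section \<open>Partial derivatives and Gaussian integration by parts\<close>

definition has_pd :: "'i \<Rightarrow> (('i \<Rightarrow> real) \<Rightarrow> real) \<Rightarrow> (('i \<Rightarrow> real) \<Rightarrow> real) \<Rightarrow> bool" where
  "has_pd e F F' \<longleftrightarrow>
    (\<forall>x y. ((\<lambda>y. F (x(e := y))) has_real_derivative F' (x(e := y))) (at y))"

fun dmon :: "'i \<Rightarrow> 'i list \<Rightarrow> ('i \<Rightarrow> real) \<Rightarrow> real" where
  "dmon e [] x = 0"
| "dmon e (f # es) x = (if f = e then mon es x else 0) + x f * dmon e es x"

lemma has_pd_const: "has_pd e (\<lambda>x. c) (\<lambda>x. 0)"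
  by (simp add: has_pd_def)

lemma has_pd_mult: "has_pd e F F' \<Longrightarrow> has_pd e G G' \<Longrightarrow> has_pd e (\<lambda>x. F x * G x) (\<lambda>x. F' x * G x + F x * G' x)"
  unfolding has_pd_def by (auto intro!: derivative_eq_intros)

lemma has_pd_cmult: "has_pd e F F' \<Longrightarrow> has_pd e (\<lambda>x. c * F x) (\<lambda>x. c * F' x)"
  unfolding has_pd_def by (auto intro!: derivative_eq_intros)

lemma has_pd_add: "has_pd e F F' \<Longrightarrow> has_pd e G G' \<Longrightarrow> has_pd e (\<lambda>x. F x + G x) (\<lambda>x. F' x + G' x)"
  unfolding has_pd_def by (auto intro!: derivative_eq_intros)

lemma has_pd_diff_const: "has_pd e F F' \<Longrightarrow> has_pd e (\<lambda>x. F x - c) F'"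
  unfolding has_pd_def by (auto intro!: derivative_eq_intros)

lemma has_pd_sum: "(\<And>a. a \<in> A \<Longrightarrow> has_pd e (F a) (F' a)) \<Longrightarrow>
    has_pd e (\<lambda>x. \<Sum>a\<in>A. F a x) (\<lambda>x. \<Sum>a\<in>A. F' a x)"
  by (induction A rule: infinite_finite_induct) (auto intro: has_pd_add has_pd_const)

lemma has_pd_mon: "has_pd e (mon es) (dmon e es)"
proof (induction es)
  case Nil
  then show ?case by (simp add: has_pd_def)
next
  case (Cons f es)
  have "has_pd e (\<lambda>x. x f) (\<lambda>x. if f = e then 1 else 0)" by (auto simp: has_pd_def)
  from has_pd_mult[OF this Cons] show ?case by (cases "f = e") (simp_all add: has_pd_def)
qed

lemma gpoly_dmon: "set es \<subseteq> I \<Longrightarrow> gpoly I (dmon e es)"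
proof (induction es)
  case Nil
  then show ?case using gpoly_const[of I 0] by (simp add: fun_eq_iff)
next
  case (Cons f es)
  have "gpoly I (\<lambda>x. (if f = e then mon es x else 0) + x f * dmon e es x)"
    by (cases "f = e") (use Cons in \<open>auto intro!: gpoly_intros\<close>)
  then show ?case by simp
qed

text \<open>The product rule as a sum over the occurrences of \<open>e\<close>, each deleted in
  turn; for a cycle, deleting an edge leaves a path.\<close>

lemma dmon_eq: "dmon e es x = (\<Sum>p<length es. if es ! p = e then mon (take p es @ drop (Suc p) es) x else 0)"
proof (induction es)
  case (Cons f es)
  have "(\<Sum>p<length (f # es). if (f # es) ! p = e then mon (take p (f # es) @ drop (Suc p) (f # es)) x else 0)
    = (if f = e then mon es x else 0) + (\<Sum>p<length es. x f * (if es ! p = e then mon (take p es @ drop (Suc p) es) x else 0))"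
    by (simp add: sum.lessThan_Suc_shift del: sum.lessThan_Suc) (auto intro!: sum.cong)
  then show ?case using Cons by (simp add: sum_distrib_left[symmetric])
qed simp

lemma integrable_std_normal_poly: "integrable lborel (\<lambda>y. std_normal_density y * \<bar>poly p y\<bar>)"
proof -
  have "integrable lborel (\<lambda>y. \<Sum>i\<le>degree p. coeff p i * (std_normal_density y * y ^ i))"
    by (intro Bochner_Integration.integrable_sum integrable_mult_right integrable_std_normal_moment)
  also have "(\<lambda>y. \<Sum>i\<le>degree p. coeff p i * (std_normal_density y * y ^ i)) = (\<lambda>y. std_normal_density y * poly p y)"
    by (simp add: poly_altdef sum_distrib_left mult_ac fun_eq_iff)
  finally have "integrable lborel (\<lambda>y. std_normal_density y * poly p y)" .
  from integrable_norm[OF this] show ?thesis by (simp add: abs_mult)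
qed

lemma std_normal_poly_tendsto_0:
  "((\<lambda>y. std_normal_density y * poly p y) \<longlongrightarrow> 0) at_top"
  "((\<lambda>y. std_normal_density y * poly p y) \<longlongrightarrow> 0) at_bot"
proof -
  have "((\<lambda>y::real. std_normal_density y * y ^ i) \<longlongrightarrow> 0) at_top" for i
    unfolding normal_density_def by (simp, real_asymp)
  then have "((\<lambda>y. \<Sum>i\<le>degree p. coeff p i * (std_normal_density y * y ^ i)) \<longlongrightarrow> (\<Sum>i\<le>degree p. coeff p i * 0)) at_top" for p
    by (intro tendsto_intros)
  then have *: "((\<lambda>y. std_normal_density y * poly p y) \<longlongrightarrow> 0) at_top" for p
    by (simp add: poly_altdef sum_distrib_left mult_ac)
  show "((\<lambda>y. std_normal_density y * poly p y) \<longlongrightarrow> 0) at_top" by (rule *)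
  have "((\<lambda>y. std_normal_density y * poly (pcompose p [:0, -1:]) y) \<longlongrightarrow> 0) at_top" by (rule *)
  then have "((\<lambda>y. std_normal_density (-y) * poly p (- y)) \<longlongrightarrow> 0) at_top"
    by (simp add: poly_pcompose normal_density_def)
  then show "((\<lambda>y. std_normal_density y * poly p y) \<longlongrightarrow> 0) at_bot"
    by (simp add: filterlim_at_bot_mirror)
qed

text \<open>The normal density times \<open>p\<close> times the oscillating factor vanishes at both
  ends of the line, so its derivative integrates to 0. The oscillating factor has modulus 1, so
  moments of the normal law dominate every term.\<close>

lemma stein_one_dim:
  fixes p q :: "real poly"
  shows "(\<integral>y. of_real (y * poly p y) * iexp (t * poly q y) \<partial>std_normal_distribution) =
    (\<integral>y. (of_real (poly (pderiv p) y) + \<i> * of_real (t * poly p y * poly (pderiv q) y)) * iexp (t * poly q y)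
      \<partial>std_normal_distribution)" (is "?L = ?R")
proof -
  let ?\<phi> = "std_normal_density"
  have [measurable]: "(\<lambda>y. poly r y) \<in> borel_measurable borel" for r :: "real poly"
    by (intro borel_measurable_continuous_onI continuous_intros)
  let ?a = "\<lambda>y. of_real (y * poly p y) * iexp (t * poly q y)"
  let ?b = "\<lambda>y. (of_real (poly (pderiv p) y) + \<i> * of_real (t * poly p y * poly (pderiv q) y)) * iexp (t * poly q y)"
  \<comment> \<open>\<open>f\<close> will be the derivative of \<open>F\<close>: differentiating the
    density gives the term \<open>?a\<close>, differentiating \<open>p\<close> and the oscillating
    factor gives \<open>?b\<close>.\<close>
  define F where "F = (\<lambda>y. (?\<phi> y * poly p y) *\<^sub>R iexp (t * poly q y))"
  define f where "f = (\<lambda>y. ?\<phi> y *\<^sub>R (?b y - ?a y))"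
  have int_a: "integrable lborel (\<lambda>y. ?\<phi> y *\<^sub>R ?a y)"
    by (rule Bochner_Integration.integrable_bound[OF integrable_std_normal_poly[of "[:0,1:] * p"]])
      (auto simp: norm_mult abs_mult)
  have int_b1: "integrable lborel (\<lambda>y. ?\<phi> y *\<^sub>R (of_real (poly (pderiv p) y) * iexp (t * poly q y)))"
    by (rule Bochner_Integration.integrable_bound[OF integrable_std_normal_poly[of "pderiv p"]])
      (auto simp: norm_mult abs_mult)
  have int_b2: "integrable lborel (\<lambda>y. ?\<phi> y *\<^sub>R (\<i> * of_real (t * poly p y * poly (pderiv q) y) * iexp (t * poly q y)))"
    by (rule Bochner_Integration.integrable_bound[OF integrable_std_normal_poly[of "smult t (p * pderiv q)"]])
      (auto simp: norm_mult abs_mult)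
  have int_b: "integrable lborel (\<lambda>y. ?\<phi> y *\<^sub>R ?b y)"
    using Bochner_Integration.integrable_add[OF int_b1 int_b2] by (simp add: algebra_simps)
  have int_f: "integrable lborel f"
    using Bochner_Integration.integrable_diff[OF int_b int_a] unfolding f_def by (simp add: scaleR_diff_right)
  have der: "(F has_vector_derivative f y) (at y)" for y
  proof -
    have "((\<lambda>y. ?\<phi> y * poly p y) has_real_derivative (- y * ?\<phi> y * poly p y + ?\<phi> y * poly (pderiv p) y)) (at y)"
    proof -
      define k where "k = 1 / sqrt (2 * pi)"
      have "?\<phi> = (\<lambda>y. k * exp (- y\<^sup>2 / 2))" by (simp add: std_normal_density_def k_def fun_eq_iff)
      then show ?thesis by (auto intro!: derivative_eq_intros poly_DERIV simp: algebra_simps)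
    qed
    moreover have "((\<lambda>y. iexp (t * poly q y)) has_vector_derivative (t * poly (pderiv q) y) *\<^sub>R (\<i> * iexp (t * poly q y))) (at y)"
    proof -
      have "((\<lambda>y. t * poly q y) has_vector_derivative (t * poly (pderiv q) y)) (at y)"
        unfolding has_real_derivative_iff_has_vector_derivative[symmetric]
        by (auto intro!: derivative_eq_intros poly_DERIV)
      from vector_diff_chain_at[OF this has_vector_derivative_iexp] show ?thesis by (simp add: o_def)
    qed
    ultimately have "(F has_vector_derivative ((?\<phi> y * poly p y) *\<^sub>R ((t * poly (pderiv q) y) *\<^sub>R (\<i> * iexp (t * poly q y)))
       + (- y * ?\<phi> y * poly p y + ?\<phi> y * poly (pderiv p) y) *\<^sub>R iexp (t * poly q y))) (at y)"
      unfolding F_def by (rule has_vector_derivative_scaleR)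
    also have "((?\<phi> y * poly p y) *\<^sub>R ((t * poly (pderiv q) y) *\<^sub>R (\<i> * iexp (t * poly q y)))
       + (- y * ?\<phi> y * poly p y + ?\<phi> y * poly (pderiv p) y) *\<^sub>R iexp (t * poly q y)) = f y"
      unfolding f_def scaleR_conv_of_real by (simp add: algebra_simps)
    finally show ?thesis .
  qed
  have cont: "isCont f y" for y
    unfolding f_def normal_density_def by (intro continuous_intros) auto
  have Fn: "norm (F y) = \<bar>?\<phi> y * poly p y\<bar>" for y
    by (simp add: F_def)
  have lim: "(F \<longlongrightarrow> 0) at_top" "(F \<longlongrightarrow> 0) at_bot"
    using std_normal_poly_tendsto_0[of p]
    by (auto intro!: tendsto_norm_zero_cancel[of F] simp: Fn tendsto_rabs_zero_iff)
  have "(LBINT y=-\<infinity>..\<infinity>. f y) = 0 - 0"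
    by (rule interval_integral_FTC_integrable[where F=F])
      (use der cont int_f lim in \<open>auto simp: set_integrable_def ereal_tendsto_simps\<close>)
  then have "integral\<^sup>L lborel f = 0"
    by (simp add: interval_lebesgue_integral_def set_lebesgue_integral_def)
  also have "integral\<^sup>L lborel f = ?R - ?L"
    unfolding f_def scaleR_diff_right
    using int_a int_b by (subst Bochner_Integration.integral_diff) (auto simp: integral_density)
  finally show ?thesis by simp
qed

text \<open>Fubini separates the coordinate \<open>e\<close>. With the other coordinates frozen,
  \<open>F\<close> and \<open>G\<close> are one-variable polynomials, and uniqueness of derivatives
  identifies \<open>F'\<close> and \<open>G'\<close> with their \<open>pderiv\<close>.\<close>

lemma stein_identity:
  assumes I: "finite I" "e \<in> I"
    and F: "gpoly I F" "gpoly I F'" "has_pd e F F'"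
    and G: "gpoly I G" "gpoly I G'" "has_pd e G G'"
  shows "(\<integral>x. of_real (x e * F x) * iexp (t * G x) \<partial>gauss_space I) =
    (\<integral>x. (of_real (F' x) + \<i> * of_real (t * F x * G' x)) * iexp (t * G x) \<partial>gauss_space I)"
proof -
  interpret product_prob_space "\<lambda>_::'a. std_normal_distribution" by (rule product_prob_space_std_normal)
  define I' where "I' = I - {e}"
  have I': "finite I'" "e \<notin> I'" "I = insert e I'" using I by (auto simp: I'_def)
  note [measurable] = F(1,2)[THEN gpoly_measurable] G(1,2)[THEN gpoly_measurable] measurable_coordinate[OF I(2)]
  have int1: "integrable (gauss_space I) (\<lambda>x. of_real (x e * F x) * iexp (t * G x))"
    by (rule Bochner_Integration.integrable_bound[OF gpoly_integrable[OF I(1) gpoly_mult[OF gpoly_coordinate[OF I(2)] F(1)]]])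
      (auto simp: norm_mult)
  have "integrable (gauss_space I) (\<lambda>x. of_real (F' x) * iexp (t * G x))"
    by (rule Bochner_Integration.integrable_bound[OF gpoly_integrable[OF I(1) F(2)]]) (auto simp: norm_mult)
  moreover have "integrable (gauss_space I) (\<lambda>x. \<i> * of_real (t * F x * G' x) * iexp (t * G x))"
    by (rule Bochner_Integration.integrable_bound[OF gpoly_integrable[OF I(1) gpoly_cmult[OF gpoly_mult[OF F(1) G(2)], of t]]])
      (auto simp: norm_mult)
  ultimately have int2: "integrable (gauss_space I) (\<lambda>x. (of_real (F' x) + \<i> * of_real (t * F x * G' x)) * iexp (t * G x))"
    using Bochner_Integration.integrable_add by (simp add: distrib_right)
  show ?thesis
    unfolding gauss_space_def I'(3)
    apply (subst product_integral_insert[OF I'(1,2)])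
     apply (use int1 in \<open>simp add: gauss_space_def I'(3)\<close>)
    apply (subst product_integral_insert[OF I'(1,2)])
     apply (use int2 in \<open>simp add: gauss_space_def I'(3)\<close>)
  proof (rule Bochner_Integration.integral_cong[OF refl])
    fix x assume "x \<in> space (PiM I' (\<lambda>_. std_normal_distribution))"
    obtain p where p: "\<And>y. F (x(e := y)) = poly p y" using gpoly_poly[OF F(1), of x e] by auto
    obtain q where q: "\<And>y. G (x(e := y)) = poly q y" using gpoly_poly[OF G(1), of x e] by auto
    have "F' (x(e := y)) = poly (pderiv p) y" for y
    proof -
      have "((\<lambda>y. F (x(e := y))) has_real_derivative F' (x(e := y))) (at y)"
        using F(3) unfolding has_pd_def by blast
      then show ?thesis unfolding p by (rule DERIV_unique) (rule poly_DERIV)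
    qed
    moreover have "G' (x(e := y)) = poly (pderiv q) y" for y
    proof -
      have "((\<lambda>y. G (x(e := y))) has_real_derivative G' (x(e := y))) (at y)"
        using G(3) unfolding has_pd_def by blast
      then show ?thesis unfolding q by (rule DERIV_unique) (rule poly_DERIV)
    qed
    ultimately show "(\<integral>y. of_real ((x(e := y)) e * F (x(e := y))) * iexp (t * G (x(e := y))) \<partial>std_normal_distribution) =
      (\<integral>y. (of_real (F' (x(e := y))) + \<i> * of_real (t * F (x(e := y)) * G' (x(e := y)))) * iexp (t * G (x(e := y))) \<partial>std_normal_distribution)"
      unfolding p q using stein_one_dim[of p t q] by simp
  qed
qed

section \<open>The Cameron--Martin formula and exponential moments\<close>

lemma nn_integral_gauss_prod:
  assumes "finite I" "\<And>e. e \<in> I \<Longrightarrow> f e \<in> borel_measurable borel"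
  shows "(\<integral>\<^sup>+x. (\<Prod>e\<in>I. f e (x e)) \<partial>gauss_space I) = (\<Prod>e\<in>I. \<integral>\<^sup>+y. f e y \<partial>std_normal_distribution)"
proof -
  interpret product_prob_space "\<lambda>_::'a. std_normal_distribution" by (rule product_prob_space_std_normal)
  show ?thesis unfolding gauss_space_def
    by (rule product_nn_integral_prod) (use assms in auto)
qed

lemma indicator_PiE:
  assumes "finite I" "x \<in> extensional I"
  shows "indicator (Pi\<^sub>E I B) x = (\<Prod>e\<in>I. indicator (B e) (x e) :: ennreal)"
proof (cases "x \<in> Pi\<^sub>E I B")
  case True
  then have "\<And>e. e \<in> I \<Longrightarrow> indicator (B e) (x e) = (1::ennreal)" by (auto simp: indicator_def)
  then show ?thesis using True by simp
next
  case False
  then obtain e where "e \<in> I" "x e \<notin> B e" using assms(2) by (auto simp: PiE_def)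
  then have "(\<Prod>e\<in>I. indicator (B e) (x e) :: ennreal) = 0"
    using assms(1) by (intro prod_zero) (auto intro!: bexI[of _ e])
  then show ?thesis using False by simp
qed

lemma measurable_shift:
  "(\<lambda>x. \<lambda>e\<in>I. x e + c e) \<in> measurable (gauss_space I) (gauss_space I)"
  unfolding measurable_gauss_space_cong
  by (subst measurable_cong_sets[OF refl sets_gauss_space]) measurable

text \<open>Both measures are the product of the normal laws with means \<open>c e\<close>. On boxes
  this splits into the one-dimensional identities \<open>K1\<close> (change of density) and
  \<open>K2\<close> (translation).\<close>

lemma cameron_martin_measure:
  assumes fin: "finite I"
  shows "density (gauss_space I) (\<lambda>x. ennreal (exp ((\<Sum>e\<in>I. c e * x e) - (\<Sum>e\<in>I. (c e)\<^sup>2) / 2)))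
    = distr (gauss_space I) (gauss_space I) (\<lambda>x. \<lambda>e\<in>I. x e + c e)" (is "?D = ?R")
proof -
  let ?K = "\<lambda>e. density lborel (normal_density (c e) 1)"
  have "product_prob_space ?K" by (rule product_prob_spaceI) (rule prob_space_normal_density, simp)
  then interpret K: product_prob_space ?K .
  have setsK: "sets (PiM I ?K) = sets (gauss_space I)"
    unfolding sets_gauss_space by (rule sets_PiM_cong) auto
  have meas[measurable]: "(\<lambda>x. x e) \<in> borel_measurable (gauss_space I)" if "e \<in> I" for e
    using that by (rule measurable_coordinate)
  have K1: "(\<integral>\<^sup>+y. ennreal (exp (a * y - a\<^sup>2 / 2)) * indicator B y \<partial>std_normal_distribution)
      = emeasure (density lborel (normal_density a 1)) B" if [measurable]: "B \<in> sets borel" for B a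
  proof -
    have e: "std_normal_density y * exp (a * y - a\<^sup>2 / 2) = normal_density a 1 y" for y
      by (simp add: normal_density_def exp_add[symmetric] power2_eq_square field_simps)
    have "(\<integral>\<^sup>+y. ennreal (exp (a * y - a\<^sup>2 / 2)) * indicator B y \<partial>std_normal_distribution) =
      (\<integral>\<^sup>+y. ennreal (std_normal_density y) * (ennreal (exp (a * y - a\<^sup>2 / 2)) * indicator B y) \<partial>lborel)"
      by (rule nn_integral_density) auto
    also have "\<dots> = (\<integral>\<^sup>+y. ennreal (normal_density a 1 y) * indicator B y \<partial>lborel)"
      by (rule nn_integral_cong) (simp add: mult.assoc[symmetric] ennreal_mult[symmetric] e)
    finally show ?thesis by (simp add: emeasure_density)
  qed
  have K2: "(\<integral>\<^sup>+y. indicator B (y + a) \<partial>std_normal_distribution)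
      = emeasure (density lborel (normal_density a 1)) B" if [measurable]: "B \<in> sets borel" for B a
  proof -
    have "(\<integral>\<^sup>+y. indicator B (y + a) \<partial>std_normal_distribution) =
      (\<integral>\<^sup>+y. ennreal (std_normal_density y) * indicator B (y + a) \<partial>lborel)"
      by (rule nn_integral_density) auto
    also have "\<dots> = (\<integral>\<^sup>+y. ennreal (normal_density a 1 (a + 1 * y)) * indicator B (a + 1 * y) \<partial>lborel)"
      by (rule nn_integral_cong) (simp add: normal_density_def add.commute)
    also have "\<dots> = (\<integral>\<^sup>+y. ennreal (normal_density a 1 y) * indicator B y \<partial>lborel)"
      using nn_integral_real_affine[of "\<lambda>y. ennreal (normal_density a 1 y) * indicator B y" 1 a] by simp
    finally show ?thesis by (simp add: emeasure_density)
  qed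
  have box: "Pi\<^sub>E I B \<in> sets (gauss_space I)" if "\<And>e. e \<in> I \<Longrightarrow> B e \<in> sets (?K e)" for B
    unfolding sets_gauss_space by (rule sets_PiM_I_finite) (use fin that in auto)
  have "?D = PiM I ?K"
  proof (rule K.PiM_eqI[OF fin])
    show "sets ?D = sets (PiM I ?K)" using setsK by simp
    fix B assume B: "\<And>e. e \<in> I \<Longrightarrow> B e \<in> sets (?K e)"
    have "emeasure ?D (Pi\<^sub>E I B) = (\<integral>\<^sup>+x. ennreal (exp ((\<Sum>e\<in>I. c e * x e) - (\<Sum>e\<in>I. (c e)\<^sup>2) / 2)) * indicator (Pi\<^sub>E I B) x \<partial>gauss_space I)"
      by (rule emeasure_density) (use box[OF B] in auto)
    also have "\<dots> = (\<integral>\<^sup>+x. (\<Prod>e\<in>I. ennreal (exp (c e * x e - (c e)\<^sup>2 / 2)) * indicator (B e) (x e)) \<partial>gauss_space I)"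
    proof (rule nn_integral_cong)
      fix x assume "x \<in> space (gauss_space I)"
      then have "x \<in> extensional I" by (simp add: space_gauss_space)
      then show "ennreal (exp ((\<Sum>e\<in>I. c e * x e) - (\<Sum>e\<in>I. (c e)\<^sup>2) / 2)) * indicator (Pi\<^sub>E I B) x =
         (\<Prod>e\<in>I. ennreal (exp (c e * x e - (c e)\<^sup>2 / 2)) * indicator (B e) (x e))"
        by (simp add: indicator_PiE[OF fin] prod.distrib prod_ennreal exp_sum[OF fin, symmetric]
            sum_subtractf sum_divide_distrib)
    qed
    also have "\<dots> = (\<Prod>e\<in>I. emeasure (?K e) (B e))"
      by (subst nn_integral_gauss_prod[OF fin]) (use B K1 in auto)
    finally show "emeasure ?D (Pi\<^sub>E I B) = (\<Prod>e\<in>I. emeasure (?K e) (B e))" .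
  qed
  moreover have "?R = PiM I ?K"
  proof (rule K.PiM_eqI[OF fin])
    show "sets ?R = sets (PiM I ?K)" using setsK by simp
    fix B assume B: "\<And>e. e \<in> I \<Longrightarrow> B e \<in> sets (?K e)"
    have "emeasure ?R (Pi\<^sub>E I B) = (\<integral>\<^sup>+x. indicator (Pi\<^sub>E I B) x \<partial>?R)"
      using box[OF B] by simp
    also have "\<dots> = (\<integral>\<^sup>+x. indicator (Pi\<^sub>E I B) (\<lambda>e\<in>I. x e + c e) \<partial>gauss_space I)"
      by (rule nn_integral_distr[OF measurable_shift]) (use box[OF B] in simp)
    also have "\<dots> = (\<integral>\<^sup>+x. (\<Prod>e\<in>I. indicator (B e) (x e + c e)) \<partial>gauss_space I)"
      by (rule nn_integral_cong) (simp add: indicator_PiE[OF fin])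
    also have "\<dots> = (\<Prod>e\<in>I. emeasure (?K e) (B e))"
      by (subst nn_integral_gauss_prod[OF fin]) (use B K2 in auto)
    finally show "emeasure ?R (Pi\<^sub>E I B) = (\<Prod>e\<in>I. emeasure (?K e) (B e))" .
  qed
  ultimately show ?thesis by simp
qed

lemma linear_measurable: "(\<lambda>x. \<Sum>e\<in>I. c e * x e) \<in> borel_measurable (gauss_space I)"
  by (intro borel_measurable_sum borel_measurable_times borel_measurable_const measurable_coordinate)

lemma cameron_martin:
  fixes g :: "('i \<Rightarrow> real) \<Rightarrow> real"
  assumes fin: "finite I" and g[measurable]: "g \<in> borel_measurable (gauss_space I)"
  shows "(\<integral>x. exp ((\<Sum>e\<in>I. c e * x e) - (\<Sum>e\<in>I. (c e)\<^sup>2) / 2) * g x \<partial>gauss_space I)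
    = (\<integral>x. g (\<lambda>e\<in>I. x e + c e) \<partial>gauss_space I)"
proof -
  have [measurable]: "(\<lambda>x. \<Sum>e\<in>I. c e * x e) \<in> borel_measurable (gauss_space I)" by (rule linear_measurable)
  have "(\<integral>x. exp ((\<Sum>e\<in>I. c e * x e) - (\<Sum>e\<in>I. (c e)\<^sup>2) / 2) * g x \<partial>gauss_space I)
    = (\<integral>x. g x \<partial>density (gauss_space I) (\<lambda>x. ennreal (exp ((\<Sum>e\<in>I. c e * x e) - (\<Sum>e\<in>I. (c e)\<^sup>2) / 2))))"
    by (subst integral_density) auto
  also have "\<dots> = (\<integral>x. g (\<lambda>e\<in>I. x e + c e) \<partial>gauss_space I)"
    unfolding cameron_martin_measure[OF fin] by (rule integral_distr[OF measurable_shift g])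
  finally show ?thesis .
qed

lemma
  assumes fin: "finite I"
  shows integrable_exp_linear: "integrable (gauss_space I) (\<lambda>x. exp (\<Sum>e\<in>I. c e * x e))"
    and integral_exp_linear: "(\<integral>x. exp (\<Sum>e\<in>I. c e * x e) \<partial>gauss_space I) = exp ((\<Sum>e\<in>I. (c e)\<^sup>2) / 2)"
proof -
  interpret prob_space "gauss_space I" by (rule prob_space_gauss_space)
  have [measurable]: "(\<lambda>x. \<Sum>e\<in>I. c e * x e) \<in> borel_measurable (gauss_space I)" by (rule linear_measurable)
  let ?w = "\<lambda>x. exp ((\<Sum>e\<in>I. c e * x e) - (\<Sum>e\<in>I. (c e)\<^sup>2) / 2)"
  have eq: "exp (\<Sum>e\<in>I. c e * x e) = exp ((\<Sum>e\<in>I. (c e)\<^sup>2) / 2) * (?w x * 1)" for x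
    by (simp add: exp_add[symmetric])
  have 1: "integral\<^sup>L (gauss_space I) (\<lambda>x. ?w x * 1) = 1"
    by (subst cameron_martin[OF fin]) (auto simp: prob_space)
  \<comment> \<open>The Bochner integral of a non-integrable function is 0, so the value 1 supplied
    by the shift formula already proves integrability.\<close>
  then have 2: "integrable (gauss_space I) (\<lambda>x. ?w x * 1)" using not_integrable_integral_eq by fastforce
  show "integrable (gauss_space I) (\<lambda>x. exp (\<Sum>e\<in>I. c e * x e))"
    unfolding eq by (rule integrable_mult_right) (rule 2)
  show "(\<integral>x. exp (\<Sum>e\<in>I. c e * x e) \<partial>gauss_space I) = exp ((\<Sum>e\<in>I. (c e)\<^sup>2) / 2)"
    unfolding eq integral_mult_right_zero 1 by simp
qed

section \<open>Signed cycles as Gaussian polynomials\<close>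

definition idx :: "nat \<Rightarrow> (nat \<times> nat) set" where
  "idx n = {(i, j). 1 \<le> i \<and> i \<le> j \<and> j \<le> n}"

definition cyc :: "nat \<Rightarrow> nat \<Rightarrow> (nat \<times> nat \<Rightarrow> real) \<Rightarrow> real" where
  "cyc n k x = (1 / sqrt n) ^ k * (\<Sum>w\<in>tuples n k. mon (cycle_edges w) x)"

text \<open>Only 2-cycles have a nonzero mean: they are squares of entries, and the n(n - 1) ordered
  pairs divided by \<open>n\<close> give n - 1.\<close>

definition cyc0 :: "nat \<Rightarrow> nat \<Rightarrow> (nat \<times> nat \<Rightarrow> real) \<Rightarrow> real" where
  "cyc0 n k x = cyc n k x - (if k = 2 then real n - 1 else 0)"

lemma finite_idx [simp]: "finite (idx n)"
  by (rule finite_subset[of _ "{1..n} \<times> {1..n}"]) (auto simp: idx_def)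

lemma edge_in_idx: "i \<in> {1..n} \<Longrightarrow> j \<in> {1..n} \<Longrightarrow> edge i j \<in> idx n"
  by (auto simp: edge_def idx_def)

lemma mon_eq_prod_nth: "mon es x = (\<Prod>l<length es. x (es ! l))"
  by (induction es) (auto simp: prod.lessThan_Suc_shift simp del: prod.lessThan_Suc)

lemma signed_cycle_eq_cyc:
  assumes "k \<ge> 1"
  shows "signed_cycle n k (\<lambda>i j. x (edge i j)) = cyc n k x"
proof (cases "k = 1")
  case True
  have "tuples n 1 = (\<lambda>i. [i]) ` {1..n}"
    by (auto simp: tuples_def length_Suc_conv)
  then have "(\<Sum>w\<in>tuples n 1. mon (cycle_edges w) x) = (\<Sum>i\<in>{1..n}. mon (cycle_edges [i]) x)"
    by (simp add: sum.reindex inj_on_def)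
  then show ?thesis using True
    by (simp add: signed_cycle_def cyc_def cycle_edges_def closing_edge_def)
next
  case False
  have "(\<Prod>l<k. x (edge (w ! l) (w ! ((l + 1) mod k)))) = mon (cycle_edges w) x" if "w \<in> tuples n k" for w
  proof -
    have "w \<noteq> []" "length w = k" using that assms by (auto simp: tuples_def)
    then show ?thesis by (simp add: mon_eq_prod_nth cycle_edges_nth)
  qed
  then have "(\<Sum>w\<in>tuples n k. \<Prod>l<k. x (edge (w ! l) (w ! ((l + 1) mod k)))) = (\<Sum>w\<in>tuples n k. mon (cycle_edges w) x)"
    by (rule sum.cong[OF refl])
  then show ?thesis using False
    unfolding signed_cycle_def cyc_def tuples_def[symmetric] by simp
qed

lemma path_edges_idx: "w \<in> tuples n k \<Longrightarrow> set (path_edges w) \<subseteq> idx n"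
  using path_edges_form edge_in_idx unfolding tuples_def by blast

lemma closing_edge_idx: "w \<in> tuples n k \<Longrightarrow> k \<ge> 1 \<Longrightarrow> closing_edge w \<in> idx n"
  unfolding closing_edge_def tuples_def
  by (intro edge_in_idx) (metis (mono_tags, lifting) hd_in_set last_in_set list.size(3) mem_Collect_eq not_one_le_zero subsetD)+

lemma cycle_edges_idx: "w \<in> tuples n k \<Longrightarrow> k \<ge> 1 \<Longrightarrow> set (cycle_edges w) \<subseteq> idx n"
  using path_edges_idx closing_edge_idx by (auto simp: cycle_edges_def)

lemma gpoly_cyc: "k \<ge> 1 \<Longrightarrow> gpoly (idx n) (cyc n k)"
  unfolding cyc_def[abs_def] by (intro gpoly_intros cycle_edges_idx)

lemma gpoly_cyc0: "k \<ge> 1 \<Longrightarrow> gpoly (idx n) (cyc0 n k)"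
  unfolding cyc0_def[abs_def] by (intro gpoly_intros gpoly_cyc)

lemma card_tuples_le: "card (tuples n k) \<le> n ^ k"
proof -
  have "card (tuples n k) \<le> card {w. set w \<subseteq> {1..n} \<and> length w = k}"
    by (rule card_mono) (auto simp: tuples_def finite_lists_length_eq)
  then show ?thesis by (simp add: card_lists_length_eq)
qed

lemma card_tuples: "k \<le> n \<Longrightarrow> card (tuples n k) = (\<Prod>i<k. n - i)"
proof -
  assume k: "k \<le> n"
  have "card (tuples n k) = \<Prod>{card {1..n} - k + 1 .. card {1..n}}"
    unfolding tuples_def by (rule card_lists_distinct_length_eq) (use k in auto)
  also have "\<dots> = (\<Prod>i<k. n - i)"
    by (rule prod.reindex_bij_witness[of _ "\<lambda>i. n - i" "\<lambda>i. n - i"]) (use k in auto)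
  finally show ?thesis .
qed

lemma card_tuples_limit: "(\<lambda>n. real (card (tuples n k)) / real n ^ k) \<longlonglongrightarrow> 1"
proof -
  have "(\<lambda>n. \<Prod>i<k. (real n - real i) / real n) \<longlonglongrightarrow> (\<Prod>i<k. 1)"
    by (intro tendsto_prod) real_asymp
  moreover have "\<forall>\<^sub>F n in sequentially. (\<Prod>i<k. (real n - real i) / real n) = real (card (tuples n k)) / real n ^ k"
    using eventually_ge_at_top[of k]
  proof eventually_elim
    case (elim n)
    then show ?case by (simp add: card_tuples prod_dividef of_nat_diff)
  qed
  ultimately show ?thesis using Lim_transform_eventually by fastforce
qed

text \<open>Deleting the edge at position \<open>p\<close> of a cycle leaves, after a rotation, the
  path of a tuple whose closing edge is the deleted one. Rotations permute the tuples, so all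
  \<open>k\<close> positions contribute equally.\<close>

lemma sum_dmon_cycle:
  assumes "k \<ge> 1"
  shows "(\<Sum>w\<in>tuples n k. dmon e (cycle_edges w) x) =
    real k * (\<Sum>w\<in>tuples n k. if closing_edge w = e then mon (path_edges w) x else 0)"
proof -
  let ?h = "\<lambda>w. if closing_edge w = e then mon (path_edges w) x else 0"
  have rot: "(if cycle_edges w ! p = e then mon (take p (cycle_edges w) @ drop (Suc p) (cycle_edges w)) x else 0)
      = ?h (rotate (Suc p) w)" if w: "w \<in> tuples n k" and p: "p < k" for w p
  proof -
    have "w \<noteq> []" "length w = k" using w assms by (auto simp: tuples_def)
    then have ne: "w \<noteq> []" "length (cycle_edges w) = k" by simp_all
    let ?es = "cycle_edges w"
    have "cycle_edges (rotate (Suc p) w) = rotate (Suc p) ?es" by (rule cycle_edges_rotate) fact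
    also have "\<dots> = drop (Suc p) ?es @ take (Suc p) ?es"
    proof (cases "Suc p = k")
      case True
      then have "rotate (Suc p) ?es = ?es" using rotate_id[of "Suc p" ?es] ne by simp
      then show ?thesis using True ne by simp
    next
      case False
      then show ?thesis using p ne by (subst rotate_drop_take) simp
    qed
    also have "\<dots> = (drop (Suc p) ?es @ take p ?es) @ [?es ! p]"
      using p ne by (simp add: take_Suc_conv_app_nth)
    finally have "path_edges (rotate (Suc p) w) = drop (Suc p) ?es @ take p ?es"
      "closing_edge (rotate (Suc p) w) = ?es ! p"
      by (auto simp: cycle_edges_def)
    then show ?thesis by simp
  qed
  have "(\<Sum>w\<in>tuples n k. dmon e (cycle_edges w) x) = (\<Sum>w\<in>tuples n k. \<Sum>p<k. ?h (rotate (Suc p) w))"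
  proof (rule sum.cong[OF refl])
    fix w assume w: "w \<in> tuples n k"
    then have "w \<noteq> []" "length w = k" using assms by (auto simp: tuples_def)
    then have l: "length (cycle_edges w) = k" by simp
    show "dmon e (cycle_edges w) x = (\<Sum>p<k. ?h (rotate (Suc p) w))"
      unfolding dmon_eq l by (rule sum.cong[OF refl]) (use rot[OF w] in auto)
  qed
  also have "\<dots> = (\<Sum>p<k. \<Sum>w\<in>tuples n k. ?h (rotate (Suc p) w))" by (rule sum.swap)
  also have "\<dots> = (\<Sum>p<k. \<Sum>w\<in>tuples n k. ?h w)"
    by (rule sum.cong[OF refl]) (rule sum.reindex_bij_betw[OF bij_betw_rotate_tuples])
  finally show ?thesis by simp
qed

definition dcyc :: "nat \<Rightarrow> nat \<Rightarrow> nat \<times> nat \<Rightarrow> (nat \<times> nat \<Rightarrow> real) \<Rightarrow> real" where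
  "dcyc n k e x = (1 / sqrt n) ^ k * (real k * (\<Sum>w\<in>tuples n k. if closing_edge w = e then mon (path_edges w) x else 0))"

lemma has_pd_cyc:
  assumes "k \<ge> 1"
  shows "has_pd e (cyc n k) (dcyc n k e)"
proof -
  have "has_pd e (cyc n k) (\<lambda>x. (1 / sqrt n) ^ k * (\<Sum>w\<in>tuples n k. dmon e (cycle_edges w) x))"
    unfolding cyc_def[abs_def] by (intro has_pd_cmult has_pd_sum has_pd_mon)
  then show ?thesis using sum_dmon_cycle[OF assms] by (simp add: dcyc_def[abs_def])
qed

lemma has_pd_cyc0: "k \<ge> 1 \<Longrightarrow> has_pd e (cyc0 n k) (dcyc n k e)"
  unfolding cyc0_def[abs_def] by (rule has_pd_diff_const) (rule has_pd_cyc)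

lemma gpoly_dcyc: "gpoly (idx n) (dcyc n k e)"
proof -
  have "gpoly (idx n) (\<lambda>x. if closing_edge w = e then mon (path_edges w) x else 0)" if "w \<in> tuples n k" for w
    by (cases "closing_edge w = e") (simp_all add: gpoly_const gpoly_mon path_edges_idx[OF that])
  then show ?thesis unfolding dcyc_def[abs_def] by (intro gpoly_intros)
qed

text \<open>For \<open>k \<ge> 3\<close> the closing edge is not on the path, for
  \<open>k = 1\<close> the path is empty, and for \<open>k = 2\<close> it is the only path edge.
  This exceptional term is what the centring in \<open>cyc0\<close> removes.\<close>

lemma dmon_closing_path:
  assumes "w \<in> tuples n k" "k \<ge> 1"
  shows "dmon (closing_edge w) (path_edges w) x = (if k = 2 then 1 else 0)"
proof (cases "k = 2")
  case True
  then obtain a b where "w = [a, b]" using assms by (auto simp: tuples_def length_Suc_conv numeral_2_eq_2)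
  then show ?thesis using True by (auto simp: closing_edge_def edge_eq_iff)
next
  case False
  have w: "distinct w" "length w = k" using assms by (auto simp: tuples_def)
  have "path_edges w ! p \<noteq> closing_edge w" if p: "p < length (path_edges w)" for p
  proof -
    have pw: "p < length w" using p by simp
    have k3: "length w \<ge> 3" using p w False by simp
    have e: "cycle_edges w ! p = path_edges w ! p" "cycle_edges w ! (k - 1) = closing_edge w"
      using p w by (auto simp: cycle_edges_def nth_append)
    show ?thesis using cycle_edges_inj[OF w(1) k3, of p "k - 1"] p pw w e by auto
  qed
  then show ?thesis using False by (simp add: dmon_eq)
qed

lemma cyc_mean_coefficient:
  assumes "n \<ge> 1"
  shows "(1 / sqrt n) ^ k * (real (card (tuples n k)) * (if k = 2 then 1 else 0)) = (if k = 2 then real n - 1 else 0)"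
proof (cases "k = 2 \<and> n \<ge> 2")
  case True
  then have "card (tuples n k) = n * (n - 1)" by (simp add: card_tuples numeral_2_eq_2)
  then show ?thesis using True by (simp add: power2_eq_square of_nat_diff field_simps)
next
  case False
  have "card (tuples n 2) = 0" if "n = 1"
  proof -
    have "tuples n 2 = {}" using that by (auto simp: tuples_def length_Suc_conv numeral_2_eq_2)
    then show ?thesis by simp
  qed
  moreover have "k = 2 \<Longrightarrow> n = 1" using False assms by auto
  ultimately show ?thesis by auto
qed

text \<open>Each cycle monomial is the variable of its closing edge times a path monomial, and the
  integration by parts is done in that one variable. Differentiating the path monomial contributes
  only for \<open>k = 2\<close>, where it reproduces exactly the subtracted mean.\<close>

lemma cyc_stein:
  assumes k: "k \<ge> 1" and n: "n \<ge> 1"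
    and F: "gpoly (idx n) F" "\<And>e. e \<in> idx n \<Longrightarrow> gpoly (idx n) (F' e)" "\<And>e. e \<in> idx n \<Longrightarrow> has_pd e F (F' e)"
    and G: "gpoly (idx n) G" "\<And>e. e \<in> idx n \<Longrightarrow> gpoly (idx n) (G' e)" "\<And>e. e \<in> idx n \<Longrightarrow> has_pd e G (G' e)"
  shows "(\<integral>x. of_real (cyc0 n k x * F x) * iexp (t * G x) \<partial>gauss_space (idx n)) =
    (\<integral>x. of_real ((1 / sqrt n) ^ k) * (\<Sum>w\<in>tuples n k. of_real (mon (path_edges w) x) *
      (of_real (F' (closing_edge w) x) + \<i> * of_real (t * F x * G' (closing_edge w) x))) * iexp (t * G x) \<partial>gauss_space (idx n))"
proof -
  let ?N = "gauss_space (idx n)"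
  let ?c = "(1 / sqrt n) ^ k"
  let ?b = "if k = 2 then real n - 1 else 0"
  define r where "r = (\<lambda>w x. of_real (mon (path_edges w) x) *
      (of_real (F' (closing_edge w) x) + \<i> * of_real (t * F x * G' (closing_edge w) x)) * iexp (t * G x))"
  define I where "I = (\<integral>x. of_real (F x) * iexp (t * G x) \<partial>?N)"
  have [measurable]: "G \<in> borel_measurable ?N" using G(1) by (rule gpoly_measurable)
  have int: "integrable ?N (\<lambda>x. of_real (H x) * iexp (t * G x))" if H: "gpoly (idx n) H" for H
  proof -
    have [measurable]: "H \<in> borel_measurable ?N" using H by (rule gpoly_measurable)
    show ?thesis
      by (rule Bochner_Integration.integrable_bound[OF gpoly_integrable[OF finite_idx H]]) (auto simp: norm_mult)
  qed
  have r: "integrable ?N (r w)"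
    "(\<integral>x. of_real (mon (cycle_edges w) x * F x) * iexp (t * G x) \<partial>?N) = of_real (if k = 2 then 1 else 0) * I + (\<integral>x. r w x \<partial>?N)"
    if w: "w \<in> tuples n k" for w
  proof -
    have e: "closing_edge w \<in> idx n" by (rule closing_edge_idx[OF w k])
    have 1: "gpoly (idx n) (mon (path_edges w))" by (intro gpoly_mon path_edges_idx[OF w])
    have 2: "gpoly (idx n) (dmon (closing_edge w) (path_edges w))" by (rule gpoly_dmon[OF path_edges_idx[OF w]])
    have "r w = (\<lambda>x. of_real (mon (path_edges w) x * F' (closing_edge w) x) * iexp (t * G x) +
        \<i> * of_real t * (of_real (mon (path_edges w) x * (F x * G' (closing_edge w) x)) * iexp (t * G x)))"
      by (simp add: r_def fun_eq_iff algebra_simps)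
    then show ri: "integrable ?N (r w)"
      by (simp only:) (intro Bochner_Integration.integrable_add integrable_mult_right int gpoly_mult 1 F G e)
    have "(\<integral>x. of_real (mon (cycle_edges w) x * F x) * iexp (t * G x) \<partial>?N)
       = (\<integral>x. of_real (x (closing_edge w) * (mon (path_edges w) x * F x)) * iexp (t * G x) \<partial>?N)"
      by (simp add: cycle_edges_def mult_ac)
    also have "\<dots> = (\<integral>x. (of_real (dmon (closing_edge w) (path_edges w) x * F x + mon (path_edges w) x * F' (closing_edge w) x) +
        \<i> * of_real (t * (mon (path_edges w) x * F x) * G' (closing_edge w) x)) * iexp (t * G x) \<partial>?N)"
      by (rule stein_identity[OF finite_idx e]) (intro gpoly_add gpoly_mult has_pd_mult has_pd_mon 1 2 F G e)+
    also have "\<dots> = (\<integral>x. of_real (if k = 2 then 1 else 0) * (of_real (F x) * iexp (t * G x)) + r w x \<partial>?N)"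
      unfolding dmon_closing_path[OF w k] r_def by (rule Bochner_Integration.integral_cong) (auto simp: algebra_simps)
    also have "\<dots> = of_real (if k = 2 then 1 else 0) * I + (\<integral>x. r w x \<partial>?N)"
      unfolding I_def using int[OF F(1)] ri by (subst Bochner_Integration.integral_add) auto
    finally show "(\<integral>x. of_real (mon (cycle_edges w) x * F x) * iexp (t * G x) \<partial>?N) = of_real (if k = 2 then 1 else 0) * I + (\<integral>x. r w x \<partial>?N)" .
  qed
  have ic: "integrable ?N (\<lambda>x. of_real (mon (cycle_edges w) x * F x) * iexp (t * G x))" if "w \<in> tuples n k" for w
    by (intro int gpoly_mult gpoly_mon cycle_edges_idx[OF that k] F)
  have "(\<integral>x. of_real (cyc n k x * F x) * iexp (t * G x) \<partial>?N) =
     (\<integral>x. of_real ?c * (\<Sum>w\<in>tuples n k. of_real (mon (cycle_edges w) x * F x) * iexp (t * G x)) \<partial>?N)"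
    by (rule Bochner_Integration.integral_cong) (auto simp: cyc_def sum_distrib_right mult.assoc)
  also have "\<dots> = of_real ?c * (\<Sum>w\<in>tuples n k. \<integral>x. of_real (mon (cycle_edges w) x * F x) * iexp (t * G x) \<partial>?N)"
    unfolding integral_mult_right_zero using ic by (subst Bochner_Integration.integral_sum) auto
  also have "\<dots> = of_real ?c * (\<Sum>w\<in>tuples n k. of_real (if k = 2 then 1 else 0) * I + (\<integral>x. r w x \<partial>?N))"
    by (intro arg_cong2[of _ _ _ _ "(*)"] sum.cong refl r(2))
  also have "\<dots> = of_real (?c * (real (card (tuples n k)) * (if k = 2 then 1 else 0))) * I + of_real ?c * (\<Sum>w\<in>tuples n k. \<integral>x. r w x \<partial>?N)"
    by (simp add: sum.distrib distrib_left)
  also have "of_real ?c * (\<Sum>w\<in>tuples n k. \<integral>x. r w x \<partial>?N) = (\<integral>x. of_real ?c * (\<Sum>w\<in>tuples n k. r w x) \<partial>?N)"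
    unfolding integral_mult_right_zero using r(1) by (subst Bochner_Integration.integral_sum) auto
  finally have main: "(\<integral>x. of_real (cyc n k x * F x) * iexp (t * G x) \<partial>?N) = of_real ?b * I + \<dots>"
    unfolding cyc_mean_coefficient[OF n] .
  have "(\<integral>x. of_real (cyc0 n k x * F x) * iexp (t * G x) \<partial>?N) =
    (\<integral>x. of_real (cyc n k x * F x) * iexp (t * G x) - of_real ?b * (of_real (F x) * iexp (t * G x)) \<partial>?N)"
    by (rule Bochner_Integration.integral_cong) (auto simp: cyc0_def algebra_simps)
  also have "\<dots> = (\<integral>x. of_real (cyc n k x * F x) * iexp (t * G x) \<partial>?N) - of_real ?b * I"
    unfolding I_def using int[OF gpoly_mult[OF gpoly_cyc[OF k] F(1)]] int[OF F(1)]
    by (subst Bochner_Integration.integral_diff) auto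
  finally show ?thesis using main by (simp add: r_def sum_distrib_right mult.assoc)
qed

lemma cyc_stein_char:
  assumes "k \<ge> 1" "n \<ge> 1"
    and "gpoly (idx n) G" "\<And>e. e \<in> idx n \<Longrightarrow> gpoly (idx n) (G' e)" "\<And>e. e \<in> idx n \<Longrightarrow> has_pd e G (G' e)"
  shows "(\<integral>x. of_real (cyc0 n k x) * iexp (t * G x) \<partial>gauss_space (idx n)) =
    \<i> * of_real t * (\<integral>x. of_real ((1 / sqrt n) ^ k * (\<Sum>w\<in>tuples n k. mon (path_edges w) x * G' (closing_edge w) x)) * iexp (t * G x) \<partial>gauss_space (idx n))"
  using cyc_stein[OF assms(1,2) gpoly_const[of _ 1] gpoly_const[of _ 0] has_pd_const assms(3-5), of t]
  unfolding integral_mult_right_zero[symmetric]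
  by (simp add: sum_distrib_left sum_distrib_right mult_ac)

lemma integral_square_centered_mon_sum:
  assumes fin: "finite I" "finite Q" and es: "\<And>q. q \<in> Q \<Longrightarrow> set (es q) \<subseteq> I"
  shows "(\<integral>x. ((\<Sum>q\<in>Q. c q * mon (es q) x) - (\<Sum>q\<in>Q. c q * mon_expectation (es q)))\<^sup>2 \<partial>gauss_space I)
    = (\<Sum>q\<in>Q. \<Sum>r\<in>Q. c q * c r * (mon_expectation (es q @ es r) - mon_expectation (es q) * mon_expectation (es r)))"
proof -
  let ?N = "gauss_space I"
  interpret prob_space ?N by (rule prob_space_gauss_space)
  have i1: "integrable ?N (mon (es q))" "integrable ?N (\<lambda>x. mon (es q) x * mon (es r) x)"
    "(\<integral>x. mon (es q) x \<partial>?N) = mon_expectation (es q)"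
    "(\<integral>x. mon (es q) x * mon (es r) x \<partial>?N) = mon_expectation (es q @ es r)"
    if "q \<in> Q" "r \<in> Q" for q r
    using integrable_mon[OF fin(1), of "es q"] integral_mon[OF fin(1), of "es q"]
      integrable_mon[OF fin(1), of "es q @ es r"] integral_mon[OF fin(1), of "es q @ es r"] es that
    by (auto simp: fun_eq_iff cong: Bochner_Integration.integrable_cong)
  let ?m = "\<lambda>q. mon_expectation (es q)"
  define f where "f = (\<lambda>q r x. c q * c r * (mon (es q) x * mon (es r) x - ?m r * mon (es q) x - ?m q * mon (es r) x + ?m q * ?m r))"
  have "(\<lambda>x. ((\<Sum>q\<in>Q. c q * mon (es q) x) - (\<Sum>q\<in>Q. c q * ?m q))\<^sup>2) = (\<lambda>x. \<Sum>q\<in>Q. \<Sum>r\<in>Q. f q r x)"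
    unfolding f_def by (simp add: fun_eq_iff sum_subtractf[symmetric] power2_eq_square sum_product algebra_simps)
  moreover have "(\<integral>x. f q r x \<partial>?N) = c q * c r * (mon_expectation (es q @ es r) - ?m q * ?m r)" if "q \<in> Q" "r \<in> Q" for q r
    unfolding f_def using i1[OF that] i1[OF that(2) that(1)] by (simp add: prob_space)
  moreover have "integrable ?N (\<lambda>x. f q r x)" if "q \<in> Q" "r \<in> Q" for q r
    unfolding f_def using i1[OF that] i1[OF that(2) that(1)] by simp
  ultimately show ?thesis
    by (simp add: Bochner_Integration.integral_sum Bochner_Integration.integrable_sum cong: sum.cong)
qed

section \<open>Brackets of signed cycles: mean and concentration\<close>

definition path_pairs :: "nat \<Rightarrow> nat \<Rightarrow> nat \<Rightarrow> (nat list \<times> nat list) set" where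
  "path_pairs n k l = {(u, w). u \<in> tuples n k \<and> w \<in> tuples n l \<and> closing_edge w = closing_edge u}"

abbreviation pair_edges :: "nat list \<times> nat list \<Rightarrow> (nat \<times> nat) list" where
  "pair_edges q \<equiv> path_edges (fst q) @ path_edges (snd q)"

lemma finite_path_pairs [simp]: "finite (path_pairs n k l)"
  by (rule finite_subset[of _ "tuples n k \<times> tuples n l"]) (auto simp: path_pairs_def)

text \<open>\<open>bracket n k l\<close> is \<open>1/k\<close> times the inner product of the gradients of the signed
  cycles of lengths \<open>k\<close> and \<open>l\<close>.\<close>

definition bracket :: "nat \<Rightarrow> nat \<Rightarrow> nat \<Rightarrow> (nat \<times> nat \<Rightarrow> real) \<Rightarrow> real" where
  "bracket n k l x = (\<Sum>q\<in>path_pairs n k l. ((1 / sqrt n) ^ (k + l) * real l) * mon (pair_edges q) x)"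

definition bracket_mean :: "nat \<Rightarrow> nat \<Rightarrow> nat \<Rightarrow> real" where
  "bracket_mean n k l = (\<Sum>q\<in>path_pairs n k l. ((1 / sqrt n) ^ (k + l) * real l) * mon_expectation (pair_edges q))"

lemma bracket_eq:
  "(1 / sqrt n) ^ k * (\<Sum>w\<in>tuples n k. mon (path_edges w) x * dcyc n l (closing_edge w) x) = bracket n k l x"
proof -
  have "bracket n k l x = (\<Sum>q\<in>{q \<in> tuples n k \<times> tuples n l. closing_edge (snd q) = closing_edge (fst q)}.
     ((1 / sqrt n) ^ (k + l) * real l) * mon (pair_edges q) x)"
    unfolding bracket_def by (rule sum.cong) (auto simp: path_pairs_def)
  also have "\<dots> = (\<Sum>q\<in>tuples n k \<times> tuples n l. if closing_edge (snd q) = closing_edge (fst q) then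
     ((1 / sqrt n) ^ (k + l) * real l) * mon (pair_edges q) x else 0)"
    by (rule sum.inter_filter) auto
  also have "\<dots> = (\<Sum>u\<in>tuples n k. \<Sum>w\<in>tuples n l. if closing_edge w = closing_edge u then
     ((1 / sqrt n) ^ (k + l) * real l) * mon (path_edges u @ path_edges w) x else 0)"
    by (simp add: sum.cartesian_product case_prod_unfold)
  also have "\<dots> = (1 / sqrt n) ^ k * (\<Sum>w\<in>tuples n k. mon (path_edges w) x * dcyc n l (closing_edge w) x)"
    unfolding dcyc_def sum_distrib_left
    by (intro sum.cong refl) (auto simp: power_add)
  finally show ?thesis by simp
qed

lemma path_pairs_idx: "q \<in> path_pairs n k l \<Longrightarrow> set (pair_edges q) \<subseteq> idx n"
  using path_edges_idx by (auto simp: path_pairs_def dest!: path_edges_idx)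

lemma gpoly_bracket: "gpoly (idx n) (bracket n k l)"
  unfolding bracket_def[abs_def] by (intro gpoly_cmult gpoly_sum gpoly_mon path_pairs_idx)

text \<open>Each path uses an edge at most once, so a nonzero moment forces equal edge sets;
  together with the common closing edge the paths then agree up to reversal. In that case every edge
  occurs twice and contributes the second moment 1.\<close>

lemma path_pair_expectation:
  assumes q: "(u, w) \<in> path_pairs n k l" and kl: "k \<ge> 1" "l \<ge> 1"
  shows "mon_expectation (path_edges u @ path_edges w) = (if k = l \<and> (w = u \<or> w = rev u) then 1 else 0)"
proof -
  have uw: "distinct u" "length u = k" "distinct w" "length w = l" "closing_edge w = closing_edge u"
    using q by (auto simp: path_pairs_def tuples_def)
  have ne: "u \<noteq> []" "w \<noteq> []" using uw kl by auto
  have cnt: "count_list es e = (if e \<in> set es then 1 else 0)" if "distinct es" for es :: "(nat \<times> nat) list" and e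
    using that by (induction es) auto
  show ?thesis
  proof (cases "w = u \<or> w = rev u")
    case True
    then have s: "set (path_edges w) = set (path_edges u)" by (auto simp: path_edges_rev)
    have kl': "k = l" using True uw by auto
    have "normal_moment (count_list (path_edges u @ path_edges w) e) = 1"
      if "e \<in> set (path_edges u @ path_edges w)" for e
      using that s uw by (simp add: cnt distinct_path_edges normal_moment_2 normal_moment_2[unfolded numeral_2_eq_2])
    then have "mon_expectation (path_edges u @ path_edges w) = 1"
      unfolding mon_expectation_def by (intro prod.neutral) blast
    then show ?thesis using True kl' by simp
  next
    case False
    have "mon_expectation (path_edges u @ path_edges w) = 0"
    proof (rule ccontr)
      assume "mon_expectation (path_edges u @ path_edges w) \<noteq> 0"
      then have "even (count_list (path_edges u @ path_edges w) e)" for e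
        using mon_expectation_odd[of "path_edges u @ path_edges w" e] by metis
      then have "set (path_edges u) = set (path_edges w)"
        by (rule even_counts_distinct_eq) (use uw distinct_path_edges in auto)
      then have "w = u \<or> w = rev u"
        by (intro path_determine_up_to_rev) (use uw ne in auto)
      then show False using False by simp
    qed
    then show ?thesis using False by simp
  qed
qed

text \<open>For \<open>k \<ge> 2\<close> a path and its reversal are two different tuples; for \<open>k = 1\<close> they
  coincide.\<close>

definition limit_variance :: "nat \<Rightarrow> real" where
  "limit_variance k = (if k = 1 then 1 else 2 * real k)"

lemma bracket_mean_eq:
  assumes n: "n \<ge> 1" and kl: "k \<ge> 1" "l \<ge> 1"
  shows "bracket_mean n k l = (if k = l then limit_variance k * (real (card (tuples n k)) / real n ^ k) else 0)"
proof (cases "k = l")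
  case False
  have "mon_expectation (pair_edges q) = 0" if "q \<in> path_pairs n k l" for q
    using path_pair_expectation[of "fst q" "snd q" n k l] that kl False by simp
  then show ?thesis using False by (simp add: bracket_mean_def)
next
  case True
  \<comment> \<open>The surviving pairs: a path with itself and with its reversal. The factor
    \<open>real l\<close> in the bracket turns their number into the limiting variance times the
    number of tuples.\<close>
  let ?P = "(\<lambda>u. (u, u)) ` tuples n k \<union> (\<lambda>u. (u, rev u)) ` tuples n k"
  have sub: "?P \<subseteq> path_pairs n k k"
    using kl by (auto simp: path_pairs_def tuples_def closing_edge_def hd_rev last_rev edge_commute)
  have "(\<Sum>q\<in>path_pairs n k k. mon_expectation (pair_edges q)) = (\<Sum>q\<in>path_pairs n k k. if q \<in> ?P then 1 else 0)"
  proof (rule sum.cong[OF refl])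
    fix q assume q: "q \<in> path_pairs n k k"
    obtain u w where uw: "q = (u, w)" by (cases q)
    have "q \<in> ?P \<longleftrightarrow> w = u \<or> w = rev u" using q uw by (auto simp: path_pairs_def)
    then show "mon_expectation (pair_edges q) = (if q \<in> ?P then 1 else 0)"
      using path_pair_expectation[of u w n k k] q uw kl by auto
  qed
  also have "\<dots> = real (card ?P)"
  proof -
    have "(\<Sum>q\<in>path_pairs n k k. if q \<in> ?P then 1 else 0) = (\<Sum>q\<in>path_pairs n k k \<inter> ?P. 1::real)"
      by (rule sum.inter_restrict[symmetric]) simp
    also have "path_pairs n k k \<inter> ?P = ?P" using sub by blast
    finally show ?thesis by simp
  qed
  finally have s1: "(\<Sum>q\<in>path_pairs n k k. mon_expectation (pair_edges q)) = real (card ?P)" .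
  have s2: "real k * real (card ?P) = limit_variance k * real (card (tuples n k))"
  proof (cases "k = 1")
    case True
    have "(\<lambda>u. (u, rev u)) ` tuples n k = (\<lambda>u. (u, u)) ` tuples n k"
      by (rule image_cong) (use True in \<open>auto simp: tuples_def length_Suc_conv\<close>)
    then have "card ?P = card ((\<lambda>u. (u, u)) ` tuples n k)" by simp
    also have "\<dots> = card (tuples n k)" by (rule card_image) (auto simp: inj_on_def)
    finally show ?thesis using True by (simp add: limit_variance_def)
  next
    case False
    have nr: "rev u \<noteq> u" if "u \<in> tuples n k" for u
    proof
      assume e: "rev u = u"
      have u: "length u = k" "distinct u" using that by (auto simp: tuples_def)
      have "k \<ge> 2" using False kl by simp
      then have "u ! 0 = u ! (k - 1)" using e u rev_nth[of 0 u] by simp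
      then show False using u \<open>k \<ge> 2\<close> nth_eq_iff_index_eq[of u 0 "k - 1"] by simp
    qed
    have "card ?P = card ((\<lambda>u. (u, u)) ` tuples n k) + card ((\<lambda>u. (u, rev u)) ` tuples n k)"
      by (rule card_Un_disjoint) (use nr in \<open>auto, metis\<close>)
    also have "\<dots> = card (tuples n k) + card (tuples n k)"
      by (intro arg_cong2[of _ _ _ _ "(+)"] card_image) (auto simp: inj_on_def)
    finally show ?thesis using False kl by (simp add: limit_variance_def)
  qed
  have "bracket_mean n k k = ((1 / sqrt n) ^ (k + k) * real k) * (\<Sum>q\<in>path_pairs n k k. mon_expectation (pair_edges q))"
    by (simp add: bracket_mean_def sum_distrib_left)
  also have "\<dots> = (1 / sqrt n) ^ (k + k) * (real k * real (card ?P))" unfolding s1 by simp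
  also have "(1 / sqrt n) ^ (k + k) = 1 / real n ^ k"
    using n by (simp add: power_add power_mult_distrib[symmetric] power_divide)
  finally have f: "bracket_mean n k k = 1 / real n ^ k * (real k * real (card ?P))" .
  show ?thesis unfolding True[symmetric] f s2 by simp
qed

text \<open>\<open>h\<close> writes a pair of indices injectively as one list of vertices. A nonzero
  covariance forces few distinct vertices, so \<open>card_lists_few_values\<close> bounds the number
  of nonzero terms.\<close>

lemma covariance_sum_bound:
  assumes B0: "0 \<le> B" and n: "n \<ge> 1" and p: "p \<ge> 1" and fin: "finite Q"
    and inj: "inj_on h (Q \<times> Q)"
    and h: "\<And>q r. q \<in> Q \<Longrightarrow> r \<in> Q \<Longrightarrow> length (h (q, r)) = N \<and> set (h (q, r)) \<subseteq> {1..n}"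
    and B: "\<And>q r. q \<in> Q \<Longrightarrow> r \<in> Q \<Longrightarrow> \<bar>V q r\<bar> \<le> B"
    and z: "\<And>q r. q \<in> Q \<Longrightarrow> r \<in> Q \<Longrightarrow> V q r \<noteq> 0 \<Longrightarrow> card (set (h (q, r))) \<le> p"
  shows "(\<Sum>q\<in>Q. \<Sum>r\<in>Q. V q r) \<le> B * (real p ^ N * real n ^ p)"
proof -
  let ?L = "{xs. length xs = N \<and> set xs \<subseteq> {1..n} \<and> card (set xs) \<le> p}"
  let ?Z = "{(q, r) \<in> Q \<times> Q. V q r \<noteq> 0}"
  have L: "finite ?L" "card ?L \<le> p ^ N * n ^ p" using card_lists_few_values[OF n p] by auto
  have "(\<Sum>q\<in>Q. \<Sum>r\<in>Q. V q r) = (\<Sum>(q, r)\<in>Q \<times> Q. V q r)" by (rule sum.cartesian_product)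
  also have "\<dots> = (\<Sum>(q, r)\<in>?Z. V q r)"
    by (rule sum.mono_neutral_right) (use fin in auto)
  also have "\<dots> \<le> (\<Sum>(q, r)\<in>?Z. B)"
    by (rule sum_mono) (use B in \<open>auto intro: order_trans[OF abs_ge_self]\<close>)
  also have "\<dots> = B * real (card ?Z)" by (simp add: case_prod_unfold)
  also have "\<dots> \<le> B * real (card ?L)"
  proof (rule mult_left_mono[OF _ B0], rule of_nat_mono)
    show "card ?Z \<le> card ?L"
    proof (rule card_inj_on_le[of h])
      show "inj_on h ?Z" by (rule inj_on_subset[OF inj]) auto
      show "h ` ?Z \<subseteq> ?L"
      proof (rule image_subsetI)
        fix s assume "s \<in> ?Z"
        then obtain q r where s: "s = (q, r)" "q \<in> Q" "r \<in> Q" "V q r \<noteq> 0" by auto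
        show "h s \<in> ?L" using h[OF s(2,3)] z[OF s(2-4)] unfolding s(1) by blast
      qed
    qed (rule L)
  qed
  also have "\<dots> \<le> B * (real p ^ N * real n ^ p)"
  proof (rule mult_left_mono[OF _ B0])
    have "real (card ?L) \<le> real (p ^ N * n ^ p)" by (rule of_nat_mono) (rule L(2))
    then show "real (card ?L) \<le> real p ^ N * real n ^ p" by simp
  qed
  finally show ?thesis .
qed

text \<open>In a nonvanishing covariance every edge has even multiplicity and the four paths form a
  connected graph, which therefore has at most \<open>k + l - 2\<close> edges and \<open>k + l - 1\<close> vertices,
  one less than the power of \<open>n\<close> in the normalisation.\<close>

lemma bracket_variance:
  assumes kl: "k \<ge> 1" "l \<ge> 1"
  shows "\<exists>C. \<forall>n\<ge>1. (\<integral>x. (bracket n k l x - bracket_mean n k l)\<^sup>2 \<partial>gauss_space (idx n)) \<le> C / real n"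
proof (rule exI, intro allI impI)
  fix n :: nat assume n: "n \<ge> 1"
  let ?Q = "path_pairs n k l"
  let ?N = "2 * (k + l)"
  let ?p = "k + l - 1"
  let ?B = "moment_bound ?N"
  let ?c = "(1 / sqrt n) ^ (k + l) * real l"
  let ?V = "\<lambda>q r. ?c * ?c * (mon_expectation (pair_edges q @ pair_edges r) - mon_expectation (pair_edges q) * mon_expectation (pair_edges r))"
  let ?h = "\<lambda>(q, r). fst q @ snd q @ fst r @ snd r"
  have len: "length (fst q) = k" "length (snd q) = l" "fst q \<noteq> []" "snd q \<noteq> []"
    "distinct (fst q)" "distinct (snd q)" "closing_edge (fst q) = closing_edge (snd q)"
    "set (fst q) \<subseteq> {1..n}" "set (snd q) \<subseteq> {1..n}"
    if "q \<in> ?Q" for q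
  proof -
    have a: "fst q \<in> tuples n k" "snd q \<in> tuples n l" "closing_edge (snd q) = closing_edge (fst q)"
      using that by (simp_all add: path_pairs_def case_prod_beta)
    show "length (fst q) = k" "length (snd q) = l" "distinct (fst q)" "distinct (snd q)"
      "closing_edge (fst q) = closing_edge (snd q)" "set (fst q) \<subseteq> {1..n}" "set (snd q) \<subseteq> {1..n}"
      using a by (simp_all add: tuples_def)
    then show "fst q \<noteq> []" "snd q \<noteq> []" using kl by (metis list.size(3) not_one_le_zero)+
  qed
  have B1: "1 \<le> ?B" by (rule moment_bound_ge_1)
  have "(\<Sum>q\<in>?Q. \<Sum>r\<in>?Q. ?V q r) \<le> ?c * ?c * (2 * ?B\<^sup>2) * (real ?p ^ ?N * real n ^ ?p)"
  proof (rule covariance_sum_bound[OF _ n, where h = ?h])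
    show "0 \<le> ?c * ?c * (2 * ?B\<^sup>2)" by simp
    show "1 \<le> ?p" using kl by simp
    show "inj_on ?h (?Q \<times> ?Q)"
    proof (rule inj_onI)
      fix s t assume s: "s \<in> ?Q \<times> ?Q" and t: "t \<in> ?Q \<times> ?Q" and e: "?h s = ?h t"
      obtain u w u' w' where s': "s = ((u, w), (u', w'))" by (metis surj_pair)
      obtain v z v' z' where t': "t = ((v, z), (v', z'))" by (metis surj_pair)
      have "length u = k" "length w = l" "length u' = k" "length w' = l"
         "length v = k" "length z = l" "length v' = k" "length z' = l"
        using s t s' t' len[of "(u, w)"] len[of "(u', w')"] len[of "(v, z)"] len[of "(v', z')"] by auto
      then show "s = t" using e s' t' by simp
    qed
    fix q r assume q: "q \<in> ?Q" and r: "r \<in> ?Q"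
    show "length (?h (q, r)) = ?N \<and> set (?h (q, r)) \<subseteq> {1..n}" using len[OF q] len[OF r] by simp
    have b: "\<bar>mon_expectation es\<bar> \<le> ?B" if "length es \<le> ?N" for es :: "(nat \<times> nat) list"
      by (rule mon_expectation_bound[OF that])
    have "\<bar>mon_expectation (pair_edges q @ pair_edges r) - mon_expectation (pair_edges q) * mon_expectation (pair_edges r)\<bar>
      \<le> \<bar>mon_expectation (pair_edges q @ pair_edges r)\<bar> + \<bar>mon_expectation (pair_edges q)\<bar> * \<bar>mon_expectation (pair_edges r)\<bar>"
      unfolding abs_mult[symmetric] by (rule abs_triangle_ineq4)
    also have "\<dots> \<le> ?B + ?B * ?B"
      by (intro add_mono mult_mono b) (use len[OF q] len[OF r] B1 in auto)
    also have "\<dots> \<le> 2 * ?B\<^sup>2" using mult_right_mono[OF B1, of ?B] B1 by (simp add: power2_eq_square)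
    finally show "\<bar>?V q r\<bar> \<le> ?c * ?c * (2 * ?B\<^sup>2)"
      unfolding abs_mult by (intro mult_mono) auto
    assume "?V q r \<noteq> 0"
    then have ne: "mon_expectation (pair_edges q @ pair_edges r) \<noteq> mon_expectation (pair_edges q) * mon_expectation (pair_edges r)"
      by auto
    then have "set (pair_edges q) \<inter> set (pair_edges r) \<noteq> {}"
      using mon_expectation_append_disjoint by blast
    then have c1: "card (set (?h (q, r))) \<le> card (set (pair_edges q @ pair_edges r)) + 1"
      using four_paths_card[of "fst q" "snd q" "fst r" "snd r"] len[OF q] len[OF r] by simp
    \<comment> \<open>An edge of odd total multiplicity kills the joint moment; being odd in one of
      the two factors, it also kills the product of the means.\<close>
    have ev: "even (count_list (pair_edges q @ pair_edges r) e)" for e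
    proof (rule ccontr)
      assume o: "odd (count_list (pair_edges q @ pair_edges r) e)"
      then have "mon_expectation (pair_edges q @ pair_edges r) = 0" by (rule mon_expectation_odd)
      moreover have "odd (count_list (pair_edges q) e) \<or> odd (count_list (pair_edges r) e)"
        using o by (auto simp only: count_list_append even_add)
      then have "mon_expectation (pair_edges q) * mon_expectation (pair_edges r) = 0"
        by (metis mult_zero_left mult_zero_right mon_expectation_odd)
      ultimately show False using ne by simp
    qed
    have "2 * card (set (pair_edges q @ pair_edges r)) \<le> length (pair_edges q @ pair_edges r)"
      by (rule even_counts_card[OF ev])
    then show "card (set (?h (q, r))) \<le> ?p" using c1 len[OF q] len[OF r] kl by simp
  qed simp
  also have "?c * ?c * (2 * ?B\<^sup>2) * (real ?p ^ ?N * real n ^ ?p)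
     = (2 * ?B\<^sup>2 * (real l)\<^sup>2 * real ?p ^ ?N) * ((1 / sqrt n) ^ (k + l) * (1 / sqrt n) ^ (k + l) * real n ^ ?p)"
    by (simp add: power2_eq_square mult_ac)
  also have "(1 / sqrt n) ^ (k + l) * (1 / sqrt n) ^ (k + l) * real n ^ ?p = 1 / real n"
  proof -
    have "(1 / sqrt n) ^ (k + l) * (1 / sqrt n) ^ (k + l) = 1 / real n ^ Suc ?p"
      using n kl by (simp add: power_mult_distrib[symmetric] power_divide)
    then show ?thesis using n by simp
  qed
  also have "(\<Sum>q\<in>?Q. \<Sum>r\<in>?Q. ?V q r) = (\<integral>x. (bracket n k l x - bracket_mean n k l)\<^sup>2 \<partial>gauss_space (idx n))"
    unfolding bracket_def bracket_mean_def
    by (rule integral_square_centered_mon_sum[OF finite_idx finite_path_pairs path_pairs_idx, symmetric])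
  finally show "(\<integral>x. (bracket n k l x - bracket_mean n k l)\<^sup>2 \<partial>gauss_space (idx n)) \<le>
    (2 * ?B\<^sup>2 * (real l)\<^sup>2 * real ?p ^ ?N) / real n" by simp
qed

section \<open>A central limit theorem for signed cycles\<close>

lemma integral_bracket: "(\<integral>x. bracket n k l x \<partial>gauss_space (idx n)) = bracket_mean n k l"
proof -
  have "integrable (gauss_space (idx n)) (\<lambda>x. mon (pair_edges q) x)" if "q \<in> path_pairs n k l" for q
    by (rule integrable_mon[OF finite_idx path_pairs_idx[OF that]])
  moreover have "(\<integral>x. mon (pair_edges q) x \<partial>gauss_space (idx n)) = mon_expectation (pair_edges q)" if "q \<in> path_pairs n k l" for q
    by (rule integral_mon[OF finite_idx path_pairs_idx[OF that]])
  ultimately show ?thesis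
    unfolding bracket_def bracket_mean_def
    by (subst Bochner_Integration.integral_sum) (auto intro!: sum.cong)
qed

text \<open>Integration by parts with \<open>F\<close> the cycle itself and \<open>t = 0\<close>
  turns the second moment into the mean of the bracket. The bound holds for each \<open>n\<close>,
  not just in the limit, and this uniformity carries the later tail estimates.\<close>

lemma cyc0_second_moment:
  assumes n: "n \<ge> 1" and k: "k \<ge> 1"
  shows "(\<integral>x. (cyc0 n k x)\<^sup>2 \<partial>gauss_space (idx n)) \<le> limit_variance k"
proof -
  have "(\<integral>x. complex_of_real (cyc0 n k x * cyc0 n k x) \<partial>gauss_space (idx n)) =
     (\<integral>x. complex_of_real ((1 / sqrt n) ^ k * (\<Sum>w\<in>tuples n k. mon (path_edges w) x * dcyc n k (closing_edge w) x)) \<partial>gauss_space (idx n))"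
    using cyc_stein[OF k n gpoly_cyc0[OF k] gpoly_dcyc has_pd_cyc0[OF k] gpoly_const gpoly_const has_pd_const, of 0] by simp
  then have "(\<integral>x. (cyc0 n k x)\<^sup>2 \<partial>gauss_space (idx n)) = bracket_mean n k k"
    unfolding integral_complex_of_real of_real_eq_iff bracket_eq by (simp add: power2_eq_square integral_bracket)
  also have "\<dots> = limit_variance k * (real (card (tuples n k)) / real n ^ k)"
    by (simp add: bracket_mean_eq[OF n k k])
  also have "\<dots> \<le> limit_variance k * 1"
  proof (rule mult_left_mono)
    have "real (card (tuples n k)) \<le> real (n ^ k)" by (rule of_nat_mono) (rule card_tuples_le)
    then show "real (card (tuples n k)) / real n ^ k \<le> 1" using n by simp
  qed (simp add: limit_variance_def)
  finally show ?thesis by simp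
qed

lemma (in prob_space) expectation_abs_le_sqrt:
  fixes X :: "'a \<Rightarrow> real"
  assumes "integrable M (\<lambda>x. (X x)\<^sup>2)" "X \<in> borel_measurable M"
  shows "integrable M X" "expectation (\<lambda>x. \<bar>X x\<bar>) \<le> sqrt (expectation (\<lambda>x. (X x)\<^sup>2))"
proof -
  have "integrable M (\<lambda>x. 1 + (X x)\<^sup>2)" using assms by simp
  then show i: "integrable M X"
  proof (rule Bochner_Integration.integrable_bound)
    have "\<bar>X x\<bar> \<le> 1 + (X x)\<^sup>2" for x
      using zero_le_power2[of "\<bar>X x\<bar> - 1"] by (simp add: power2_eq_square algebra_simps)
    then show "AE x in M. norm (X x) \<le> norm (1 + (X x)\<^sup>2)" by (auto intro: order_trans[OF _ abs_ge_self])
  qed (rule assms)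
  let ?m = "expectation (\<lambda>x. \<bar>X x\<bar>)"
  have "0 \<le> expectation (\<lambda>x. (\<bar>X x\<bar> - ?m)\<^sup>2)" by simp
  also have "\<dots> = expectation (\<lambda>x. (X x)\<^sup>2 - 2 * ?m * \<bar>X x\<bar> + ?m\<^sup>2)"
    by (rule Bochner_Integration.integral_cong) (auto simp: power2_eq_square algebra_simps)
  also have "\<dots> = expectation (\<lambda>x. (X x)\<^sup>2) - ?m\<^sup>2"
    using assms i by (simp add: prob_space power2_eq_square)
  finally have "?m\<^sup>2 \<le> expectation (\<lambda>x. (X x)\<^sup>2)" by simp
  then show "?m \<le> sqrt (expectation (\<lambda>x. (X x)\<^sup>2))" by (rule real_le_rsqrt)
qed

text \<open>The Taylor bound |exp(iu) - 1 - iu| <= u^2/2 makes the error of the difference quotient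
  linear in the increment once the second moment is finite.\<close>

lemma (in prob_space) char_derivative:
  fixes X :: "'a \<Rightarrow> real"
  assumes X2: "integrable M (\<lambda>x. (X x)\<^sup>2)" and X[measurable]: "X \<in> borel_measurable M"
  shows "((\<lambda>t. expectation (\<lambda>x. iexp (t * X x))) has_vector_derivative
    \<i> * expectation (\<lambda>x. of_real (X x) * iexp (t * X x))) (at t)"
proof -
  let ?f = "\<lambda>t. expectation (\<lambda>x. iexp (t * X x))"
  let ?D = "\<i> * expectation (\<lambda>x. of_real (X x) * iexp (t * X x))"
  let ?C = "expectation (\<lambda>x. (X x)\<^sup>2) / 2"
  have i1: "integrable M X" by (rule expectation_abs_le_sqrt(1)[OF X2 X])
  have ie: "integrable M (\<lambda>x. iexp (s * X x))" for s
    by (rule integrable_const_bound[of _ 1]) auto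
  have ix: "integrable M (\<lambda>x. of_real (X x) * iexp (s * X x))" for s
    by (rule Bochner_Integration.integrable_bound[OF i1]) (auto simp: norm_mult)
  have bnd: "norm (?f y - ?f t - (y - t) *\<^sub>R ?D) \<le> (y - t)\<^sup>2 * ?C" for y
  proof -
    have "?f y - ?f t - (y - t) *\<^sub>R ?D =
      expectation (\<lambda>x. iexp (y * X x) - iexp (t * X x) - of_real (y - t) * (\<i> * (of_real (X x) * iexp (t * X x))))"
      using ie[of y] ie[of t] ix[of t]
      by (simp add: scaleR_conv_of_real del: of_real_diff)
    also have "norm \<dots> \<le> expectation (\<lambda>x. (y - t)\<^sup>2 * ((X x)\<^sup>2 / 2))"
    proof (rule order_trans[OF integral_norm_bound integral_mono])
      show "integrable M (\<lambda>x. norm (iexp (y * X x) - iexp (t * X x) - of_real (y - t) * (\<i> * (of_real (X x) * iexp (t * X x)))))"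
        using ie[of y] ie[of t] ix[of t] by (intro integrable_norm Bochner_Integration.integrable_diff integrable_mult_right) auto
      show "integrable M (\<lambda>x. (y - t)\<^sup>2 * ((X x)\<^sup>2 / 2))" using X2 by simp
      fix x
      have e: "iexp (y * X x) = iexp (t * X x) * iexp ((y - t) * X x)"
        by (simp add: exp_add[symmetric] algebra_simps)
      have "iexp (y * X x) - iexp (t * X x) - of_real (y - t) * (\<i> * (of_real (X x) * iexp (t * X x)))
        = iexp (t * X x) * (iexp ((y - t) * X x) - (1 + \<i> * of_real ((y - t) * X x)))"
        unfolding e by (simp add: algebra_simps)
      also have "norm \<dots> = norm (iexp ((y - t) * X x) - (1 + \<i> * of_real ((y - t) * X x)))"
        by (simp add: norm_mult)
      also have "\<dots> \<le> \<bar>(y - t) * X x\<bar> ^ 2 / 2"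
        using iexp_approx1[of "(y - t) * X x" 1] by (simp add: numeral_2_eq_2)
      also have "\<dots> = (y - t)\<^sup>2 * ((X x)\<^sup>2 / 2)" by (simp add: power_mult_distrib)
      finally show "norm (iexp (y * X x) - iexp (t * X x) - of_real (y - t) * (\<i> * (of_real (X x) * iexp (t * X x)))) \<le> (y - t)\<^sup>2 * ((X x)\<^sup>2 / 2)" .
    qed
    also have "\<dots> = (y - t)\<^sup>2 * ?C" by simp
    finally show ?thesis .
  qed
  show ?thesis
    unfolding has_vector_derivative_def has_derivative_iff_norm
  proof (intro conjI)
    show "bounded_linear (\<lambda>x. x *\<^sub>R ?D)" by (rule bounded_linear_scaleR_left)
    have "((\<lambda>y. \<bar>y - t\<bar> * ?C) \<longlongrightarrow> \<bar>t - t\<bar> * ?C) (at t)" by (intro tendsto_intros)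
    then have lim: "((\<lambda>y. \<bar>y - t\<bar> * ?C) \<longlongrightarrow> 0) (at t)" by simp
    show "((\<lambda>y. norm (?f y - ?f t - (y - t) *\<^sub>R ?D) / norm (y - t)) \<longlongrightarrow> 0) (at t)"
    proof (rule Lim_null_comparison[OF _ lim], rule always_eventually, rule allI)
      fix y
      show "norm (norm (?f y - ?f t - (y - t) *\<^sub>R ?D) / norm (y - t)) \<le> \<bar>y - t\<bar> * ?C"
      proof (cases "y = t")
        case False
        have g: "norm (z / d) \<le> d * C" if "z \<le> d * C * d" "d > 0" "z \<ge> 0" for z d C :: real
          using that by (simp add: divide_le_eq)
        have e: "(y - t)\<^sup>2 * ?C = \<bar>y - t\<bar> * ?C * \<bar>y - t\<bar>" by (simp add: power2_eq_square abs_mult_self_eq)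
        show ?thesis unfolding real_norm_def[of "y - t"]
        proof (rule g)
          show "norm (?f y - ?f t - (y - t) *\<^sub>R ?D) \<le> \<bar>y - t\<bar> * ?C * \<bar>y - t\<bar>"
            using bnd[of y] unfolding e .
        qed (use False in simp_all)
      qed simp
    qed
  qed
qed

text \<open>With the integrating factor \<open>exp (v * t\<^sup>2 / 2)\<close> only the error
  \<open>r\<close> is left in the derivative. Between -|t| and |t| it is bounded by its bound at the
  ends, and dividing by the factor cancels the exponential growth.\<close>

lemma gaussian_ode:
  fixes \<phi> r :: "real \<Rightarrow> complex"
  assumes d: "\<And>t. (\<phi> has_vector_derivative (- of_real (t * v) * \<phi> t + r t)) (at t)"
    and r: "\<And>t. norm (r t) \<le> \<bar>t\<bar> * \<epsilon>" and v: "v \<ge> 0" and \<epsilon>: "\<epsilon> \<ge> 0" and 0: "\<phi> 0 = 1"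
  shows "norm (\<phi> t - of_real (exp (- v * t\<^sup>2 / 2))) \<le> \<epsilon> * t\<^sup>2"
proof -
  define h where "h = (\<lambda>t. exp (v * t\<^sup>2 / 2) *\<^sub>R \<phi> t)"
  have dh: "(h has_vector_derivative (exp (v * t\<^sup>2 / 2) *\<^sub>R r t)) (at t within S)" for t S
  proof -
    have "((\<lambda>t. exp (v * t\<^sup>2 / 2)) has_real_derivative (v * t * exp (v * t\<^sup>2 / 2))) (at t)"
      by (auto intro!: derivative_eq_intros)
    from has_vector_derivative_scaleR[OF this d[of t]]
    have "(h has_vector_derivative (exp (v * t\<^sup>2 / 2) *\<^sub>R r t)) (at t)"
      unfolding h_def by (simp add: scaleR_conv_of_real algebra_simps)
    then show ?thesis by (rule has_vector_derivative_at_within)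
  qed
  let ?S = "{- \<bar>t\<bar>..\<bar>t\<bar>}"
  let ?B = "exp (v * t\<^sup>2 / 2) * (\<bar>t\<bar> * \<epsilon>)"
  have "norm (h t - h 0) \<le> ?B * norm (t - 0)"
  proof (rule differentiable_bound[of ?S h "\<lambda>s x. x *\<^sub>R (exp (v * s\<^sup>2 / 2) *\<^sub>R r s)"])
    fix s assume s: "s \<in> ?S"
    show "(h has_derivative (\<lambda>x. x *\<^sub>R (exp (v * s\<^sup>2 / 2) *\<^sub>R r s))) (at s within ?S)"
      using dh[of s ?S] by (simp add: has_vector_derivative_def)
    have "\<bar>s\<bar> \<le> \<bar>t\<bar>" using s by auto
    then have "s\<^sup>2 \<le> t\<^sup>2" by (rule abs_le_square_iff[THEN iffD1])
    then have "exp (v * s\<^sup>2 / 2) \<le> exp (v * t\<^sup>2 / 2)" using v by (simp add: mult_left_mono)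
    moreover have "norm (r s) \<le> \<bar>t\<bar> * \<epsilon>"
      using r[of s] mult_right_mono[OF \<open>\<bar>s\<bar> \<le> \<bar>t\<bar>\<close> \<epsilon>] by linarith
    ultimately have le: "exp (v * s\<^sup>2 / 2) * norm (r s) \<le> ?B" by (intro mult_mono) auto
    show "onorm (\<lambda>x. x *\<^sub>R (exp (v * s\<^sup>2 / 2) *\<^sub>R r s)) \<le> ?B"
    proof (intro onorm_le)
      fix x :: real
      from le have "\<bar>x\<bar> * (exp (v * s\<^sup>2 / 2) * norm (r s)) \<le> \<bar>x\<bar> * ?B" by (rule mult_left_mono) simp
      then show "norm (x *\<^sub>R (exp (v * s\<^sup>2 / 2) *\<^sub>R r s)) \<le> ?B * norm x" by (simp add: abs_mult mult_ac)
    qed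
  qed auto
  then have le: "norm (h t - 1) \<le> exp (v * t\<^sup>2 / 2) * (\<epsilon> * t\<^sup>2)"
    by (simp add: h_def 0 mult_ac power2_eq_square)
  have "\<phi> t - of_real (exp (- v * t\<^sup>2 / 2)) = exp (- v * t\<^sup>2 / 2) *\<^sub>R (h t - 1)"
    by (simp add: h_def scaleR_diff_right exp_add[symmetric] of_real_def)
  then have "norm (\<phi> t - of_real (exp (- v * t\<^sup>2 / 2))) = exp (- v * t\<^sup>2 / 2) * norm (h t - 1)"
    by simp
  also have "\<dots> \<le> exp (- v * t\<^sup>2 / 2) * (exp (v * t\<^sup>2 / 2) * (\<epsilon> * t\<^sup>2))"
    by (rule mult_left_mono[OF le]) simp
  also have "\<dots> = \<epsilon> * t\<^sup>2" by (simp add: mult.assoc[symmetric] exp_add[symmetric])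
  finally show ?thesis .
qed

text \<open>The sum starts at \<open>k = 1\<close>, so that the diagonal term \<open>\<beta> C\<^bsub>n,1\<^esub>\<close> is covered by
  the same central limit theorem.\<close>

definition lin :: "(nat \<Rightarrow> real) \<Rightarrow> nat \<Rightarrow> nat \<Rightarrow> (nat \<times> nat \<Rightarrow> real) \<Rightarrow> real" where
  "lin a M n x = (\<Sum>k=1..M. a k * cyc0 n k x)"

definition lin_variance :: "(nat \<Rightarrow> real) \<Rightarrow> nat \<Rightarrow> real" where
  "lin_variance a M = (\<Sum>k=1..M. (a k)\<^sup>2 * limit_variance k)"

lemma gpoly_lin: "gpoly (idx n) (lin a M n)"
  unfolding lin_def[abs_def] by (intro gpoly_sum gpoly_cmult gpoly_cyc0) auto

lemma bracket_tendsto: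
  assumes kl: "k \<ge> 1" "l \<ge> 1"
  shows "(\<lambda>n. \<integral>x. \<bar>bracket n k l x - (if k = l then limit_variance k else 0)\<bar> \<partial>gauss_space (idx n)) \<longlonglongrightarrow> 0"
proof -
  let ?m = "if k = l then limit_variance k else 0"
  obtain C where C: "\<And>n. n \<ge> 1 \<Longrightarrow> (\<integral>x. (bracket n k l x - bracket_mean n k l)\<^sup>2 \<partial>gauss_space (idx n)) \<le> C / real n"
    using bracket_variance[OF kl] by auto
  have bnd: "(\<integral>x. \<bar>bracket n k l x - ?m\<bar> \<partial>gauss_space (idx n)) \<le> sqrt (C / real n) + \<bar>bracket_mean n k l - ?m\<bar>" if n: "n \<ge> 1" for n
  proof -
    interpret prob_space "gauss_space (idx n)" by (rule prob_space_gauss_space)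
    note gi = gpoly_integrable[OF finite_idx]
    let ?X = "\<lambda>x. bracket n k l x - bracket_mean n k l"
    have p: "gpoly (idx n) ?X" "gpoly (idx n) (\<lambda>x. (?X x)\<^sup>2)" "gpoly (idx n) (\<lambda>x. bracket n k l x - ?m)"
      by (intro gpoly_power gpoly_diff gpoly_bracket gpoly_const)+
    have "expectation (\<lambda>x. \<bar>bracket n k l x - ?m\<bar>) \<le> expectation (\<lambda>x. \<bar>?X x\<bar> + \<bar>bracket_mean n k l - ?m\<bar>)"
      using gi[OF p(1)] gi[OF p(3)] by (intro integral_mono) auto
    also have "\<dots> = expectation (\<lambda>x. \<bar>?X x\<bar>) + \<bar>bracket_mean n k l - ?m\<bar>"
      using gi[OF p(1)] by (simp add: prob_space)
    also have "expectation (\<lambda>x. \<bar>?X x\<bar>) \<le> sqrt (expectation (\<lambda>x. (?X x)\<^sup>2))"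
      by (rule expectation_abs_le_sqrt(2)[OF gi[OF p(2)] gpoly_measurable[OF p(1)]])
    also have "\<dots> \<le> sqrt (C / real n)" using C[OF n] by simp
    finally show ?thesis by simp
  qed
  have "(\<lambda>n. bracket_mean n k l) \<longlonglongrightarrow> ?m"
  proof -
    have "(\<lambda>n. if k = l then limit_variance k * (real (card (tuples n k)) / real n ^ k) else 0) \<longlonglongrightarrow> ?m"
      using tendsto_mult[OF tendsto_const[of "limit_variance k"] card_tuples_limit[of k]] by auto
    moreover have "\<forall>\<^sub>F n in sequentially. (if k = l then limit_variance k * (real (card (tuples n k)) / real n ^ k) else 0) = bracket_mean n k l"
      using eventually_ge_at_top[of 1] by eventually_elim (simp add: bracket_mean_eq[OF _ kl])
    ultimately show ?thesis by (rule Lim_transform_eventually)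
  qed
  then have 1: "(\<lambda>n. \<bar>bracket_mean n k l - ?m\<bar>) \<longlonglongrightarrow> 0"
    by (simp add: tendsto_rabs_zero_iff LIM_zero)
  have 2: "(\<lambda>n. sqrt (C / real n)) \<longlonglongrightarrow> 0"
    using tendsto_real_sqrt[OF lim_const_over_n[of C]] by simp
  show ?thesis
  proof (rule tendsto_sandwich[OF _ _ tendsto_const])
    show "(\<lambda>n. sqrt (C / real n) + \<bar>bracket_mean n k l - ?m\<bar>) \<longlonglongrightarrow> 0"
      using tendsto_add[OF 2 1] by simp
    show "\<forall>\<^sub>F n in sequentially. (\<integral>x. \<bar>bracket n k l x - ?m\<bar> \<partial>gauss_space (idx n)) \<le> sqrt (C / real n) + \<bar>bracket_mean n k l - ?m\<bar>"
      using eventually_ge_at_top[of 1] by eventually_elim (rule bnd)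
  qed simp
qed

lemma lin_char_tendsto:
  "(\<lambda>n. \<integral>x. iexp (t * lin a M n x) \<partial>gauss_space (idx n)) \<longlonglongrightarrow> of_real (exp (- lin_variance a M * t\<^sup>2 / 2))"
proof -
  define v where "v = lin_variance a M"
  \<comment> \<open>\<open>\<Gamma>\<close> is the bracket of the linear combination
    \<open>L\<close> with itself. Integration by parts gives E(L exp(isL)) = is
    E(\<open>\<Gamma>\<close> exp(isL)), and \<open>\<epsilon> n\<close> measures how far
    \<open>\<Gamma>\<close> is from the constant \<open>v\<close>.\<close>
  define \<Gamma> where "\<Gamma> = (\<lambda>n x. \<Sum>k=1..M. \<Sum>l=1..M. (a k * a l) * bracket n k l x)"
  define \<epsilon> where "\<epsilon> = (\<lambda>n. \<integral>x. \<bar>\<Gamma> n x - v\<bar> \<partial>gauss_space (idx n))"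
  let ?\<phi> = "\<lambda>n t. \<integral>x. iexp (t * lin a M n x) \<partial>gauss_space (idx n)"
  have p\<Gamma>: "gpoly (idx n) (\<Gamma> n)" for n
    unfolding \<Gamma>_def by (intro gpoly_sum gpoly_cmult gpoly_bracket)
  have bound: "norm (?\<phi> n t - of_real (exp (- v * t\<^sup>2 / 2))) \<le> \<epsilon> n * t\<^sup>2" if n: "n \<ge> 1" for n
  proof -
    interpret prob_space "gauss_space (idx n)" by (rule prob_space_gauss_space)
    note gi = gpoly_integrable[OF finite_idx]
    let ?L = "lin a M n"
    let ?L' = "\<lambda>e x. \<Sum>l=1..M. a l * dcyc n l e x"
    have [measurable]: "?L \<in> borel_measurable (gauss_space (idx n))" "\<Gamma> n \<in> borel_measurable (gauss_space (idx n))"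
      using gpoly_measurable[OF gpoly_lin] gpoly_measurable[OF p\<Gamma>] by auto
    have int: "integrable (gauss_space (idx n)) (\<lambda>x. of_real (F x) * iexp (s * ?L x))" if F: "gpoly (idx n) F" for F s
    proof -
      have [measurable]: "F \<in> borel_measurable (gauss_space (idx n))" using F by (rule gpoly_measurable)
      show ?thesis
        by (rule Bochner_Integration.integrable_bound[OF gi[OF F]]) (auto simp: norm_mult)
    qed
    have L': "gpoly (idx n) (?L' e)" "has_pd e ?L (?L' e)" for e
      unfolding lin_def[abs_def] by (intro gpoly_sum gpoly_cmult gpoly_dcyc has_pd_sum has_pd_cmult has_pd_cyc0, auto)+
    have stein: "expectation (\<lambda>x. of_real (?L x) * iexp (s * ?L x)) = \<i> * of_real s * expectation (\<lambda>x. of_real (\<Gamma> n x) * iexp (s * ?L x))" for s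
    proof -
      let ?g = "\<lambda>k x. (1 / sqrt n) ^ k * (\<Sum>w\<in>tuples n k. mon (path_edges w) x * ?L' (closing_edge w) x)"
      have g: "?g k x = (\<Sum>l=1..M. a l * bracket n k l x)" for k x
        unfolding bracket_eq[symmetric] by (simp add: sum_distrib_left mult_ac) (rule sum.swap)
      have pg: "gpoly (idx n) (?g k)" for k unfolding g by (intro gpoly_sum gpoly_cmult gpoly_bracket)
      have "expectation (\<lambda>x. of_real (?L x) * iexp (s * ?L x)) =
        expectation (\<lambda>x. \<Sum>k=1..M. of_real (a k) * (of_real (cyc0 n k x) * iexp (s * ?L x)))"
        by (rule Bochner_Integration.integral_cong) (auto simp: lin_def sum_distrib_right mult.assoc)
      also have "\<dots> = (\<Sum>k=1..M. of_real (a k) * expectation (\<lambda>x. of_real (cyc0 n k x) * iexp (s * ?L x)))"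
        using int[OF gpoly_cyc0] by (subst Bochner_Integration.integral_sum) auto
      also have "\<dots> = (\<Sum>k=1..M. of_real (a k) * (\<i> * of_real s * expectation (\<lambda>x. of_real (?g k x) * iexp (s * ?L x))))"
      proof (rule sum.cong[OF refl])
        fix k assume "k \<in> {1..M}"
        then have k: "k \<ge> 1" by simp
        show "of_real (a k) * expectation (\<lambda>x. of_real (cyc0 n k x) * iexp (s * ?L x)) =
          of_real (a k) * (\<i> * of_real s * expectation (\<lambda>x. of_real (?g k x) * iexp (s * ?L x)))"
          by (simp only: cyc_stein_char[OF k n gpoly_lin L'])
      qed
      also have "\<dots> = \<i> * of_real s * (\<Sum>k=1..M. of_real (a k) * expectation (\<lambda>x. of_real (?g k x) * iexp (s * ?L x)))"
        by (simp add: sum_distrib_left mult_ac)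
      also have "(\<Sum>k=1..M. of_real (a k) * expectation (\<lambda>x. of_real (?g k x) * iexp (s * ?L x))) =
        expectation (\<lambda>x. \<Sum>k=1..M. of_real (a k) * (of_real (?g k x) * iexp (s * ?L x)))"
        using int[OF pg] by (subst Bochner_Integration.integral_sum) auto
      also have "\<dots> = expectation (\<lambda>x. of_real (\<Gamma> n x) * iexp (s * ?L x))"
        unfolding g \<Gamma>_def
        by (rule Bochner_Integration.integral_cong) (auto simp: sum_distrib_right sum_distrib_left mult_ac)
      finally show ?thesis .
    qed
    \<comment> \<open>Replacing \<open>\<Gamma> n\<close> by \<open>v\<close> produces the
      differential equation of a Gaussian characteristic function, with this remainder.\<close>
    let ?r = "\<lambda>s. - of_real s * expectation (\<lambda>x. of_real (\<Gamma> n x - v) * iexp (s * ?L x))"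
    show ?thesis
    proof (rule gaussian_ode[where r = ?r])
      fix s
      have "(?\<phi> n has_vector_derivative \<i> * expectation (\<lambda>x. of_real (?L x) * iexp (s * ?L x))) (at s)"
        by (rule char_derivative) (auto intro!: gi gpoly_power gpoly_lin)
      also have "\<i> * expectation (\<lambda>x. of_real (?L x) * iexp (s * ?L x)) = - of_real s * expectation (\<lambda>x. of_real (\<Gamma> n x) * iexp (s * ?L x))"
        unfolding stein by (simp add: mult.assoc[symmetric])
      also have "expectation (\<lambda>x. of_real (\<Gamma> n x) * iexp (s * ?L x)) = expectation (\<lambda>x. of_real (\<Gamma> n x - v) * iexp (s * ?L x) + of_real v * iexp (s * ?L x))"
        by (rule Bochner_Integration.integral_cong) (auto simp: algebra_simps)
      also have "\<dots> = expectation (\<lambda>x. of_real (\<Gamma> n x - v) * iexp (s * ?L x)) + of_real v * ?\<phi> n s"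
        using int[OF gpoly_diff[OF p\<Gamma> gpoly_const[of _ v]]] int[OF gpoly_const[of _ v]]
        by (subst Bochner_Integration.integral_add) auto
      finally show "(?\<phi> n has_vector_derivative - of_real (s * v) * ?\<phi> n s + ?r s) (at s)"
        by (simp add: algebra_simps)
      have "norm (expectation (\<lambda>x. of_real (\<Gamma> n x - v) * iexp (s * ?L x))) \<le> expectation (\<lambda>x. norm (of_real (\<Gamma> n x - v) * iexp (s * ?L x)))"
        by (rule integral_norm_bound)
      also have "\<dots> = \<epsilon> n" by (simp add: \<epsilon>_def norm_mult del: of_real_diff)
      finally show "norm (?r s) \<le> \<bar>s\<bar> * \<epsilon> n" by (simp add: norm_mult mult_left_mono)
    next
      show "0 \<le> v" by (simp add: v_def lin_variance_def limit_variance_def sum_nonneg)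
      show "0 \<le> \<epsilon> n" by (simp add: \<epsilon>_def)
      show "?\<phi> n 0 = 1" by (simp add: prob_space)
    qed
  qed
  have \<epsilon>: "\<epsilon> \<longlonglongrightarrow> 0"
  proof (rule tendsto_sandwich[OF _ _ tendsto_const])
    let ?e = "\<lambda>n k l. \<integral>x. \<bar>bracket n k l x - (if k = l then limit_variance k else 0)\<bar> \<partial>gauss_space (idx n)"
    have "(\<lambda>n. \<Sum>k=1..M. \<Sum>l=1..M. \<bar>a k * a l\<bar> * ?e n k l) \<longlonglongrightarrow> (\<Sum>k=1..M. \<Sum>l=1..M. \<bar>a k * a l\<bar> * 0)"
      by (intro tendsto_sum tendsto_mult tendsto_const bracket_tendsto) auto
    then show "(\<lambda>n. \<Sum>k=1..M. \<Sum>l=1..M. \<bar>a k * a l\<bar> * ?e n k l) \<longlonglongrightarrow> 0" by simp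
    show "\<forall>\<^sub>F n in sequentially. 0 \<le> \<epsilon> n" by (simp add: \<epsilon>_def)
    have "\<epsilon> n \<le> (\<Sum>k=1..M. \<Sum>l=1..M. \<bar>a k * a l\<bar> * ?e n k l)" for n
    proof -
      interpret prob_space "gauss_space (idx n)" by (rule prob_space_gauss_space)
      note gi = gpoly_integrable[OF finite_idx]
      let ?m = "\<lambda>k l. if k = l then limit_variance k else 0"
      have v: "v = (\<Sum>k=1..M. \<Sum>l=1..M. (a k * a l) * ?m k l)"
        unfolding v_def lin_variance_def
        by (rule sum.cong[OF refl]) (simp add: if_distrib[of "\<lambda>z. _ * z"] sum.delta power2_eq_square cong: if_cong)
      have ib: "integrable (gauss_space (idx n)) (\<lambda>x. \<bar>bracket n k l x - ?m k l\<bar>)" for k l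
        by (intro integrable_abs gi gpoly_diff gpoly_bracket gpoly_const)
      have "\<epsilon> n \<le> expectation (\<lambda>x. \<Sum>k=1..M. \<Sum>l=1..M. \<bar>a k * a l\<bar> * \<bar>bracket n k l x - ?m k l\<bar>)"
        unfolding \<epsilon>_def
      proof (rule integral_mono)
        show "integrable (gauss_space (idx n)) (\<lambda>x. \<bar>\<Gamma> n x - v\<bar>)"
          by (intro integrable_abs gi gpoly_diff p\<Gamma> gpoly_const)
        show "integrable (gauss_space (idx n)) (\<lambda>x. \<Sum>k=1..M. \<Sum>l=1..M. \<bar>a k * a l\<bar> * \<bar>bracket n k l x - ?m k l\<bar>)"
          using ib by (intro Bochner_Integration.integrable_sum integrable_mult_right) auto
        fix x
        have "\<bar>\<Gamma> n x - v\<bar> = \<bar>\<Sum>k=1..M. \<Sum>l=1..M. (a k * a l) * (bracket n k l x - ?m k l)\<bar>"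
          unfolding v \<Gamma>_def by (simp add: sum_subtractf[symmetric] right_diff_distrib)
        also have "\<dots> \<le> (\<Sum>k=1..M. \<Sum>l=1..M. \<bar>a k * a l\<bar> * \<bar>bracket n k l x - ?m k l\<bar>)"
          by (intro order_trans[OF sum_abs] sum_mono) (auto intro!: order_trans[OF sum_abs] simp: abs_mult)
        finally show "\<bar>\<Gamma> n x - v\<bar> \<le> (\<Sum>k=1..M. \<Sum>l=1..M. \<bar>a k * a l\<bar> * \<bar>bracket n k l x - ?m k l\<bar>)" .
      qed
      also have "\<dots> = (\<Sum>k=1..M. \<Sum>l=1..M. \<bar>a k * a l\<bar> * ?e n k l)"
        using ib by (simp add: Bochner_Integration.integral_sum Bochner_Integration.integrable_sum)
      finally show ?thesis .
    qed
    then show "\<forall>\<^sub>F n in sequentially. \<epsilon> n \<le> (\<Sum>k=1..M. \<Sum>l=1..M. \<bar>a k * a l\<bar> * ?e n k l)" by simp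
  qed
  show ?thesis
  proof (rule LIM_zero_cancel, rule Lim_null_comparison)
    show "(\<lambda>n. \<epsilon> n * t\<^sup>2) \<longlonglongrightarrow> 0" using tendsto_mult_left_zero[OF \<epsilon>] by simp
    show "\<forall>\<^sub>F n in sequentially. norm (?\<phi> n t - of_real (exp (- lin_variance a M * t\<^sup>2 / 2))) \<le> \<epsilon> n * t\<^sup>2"
      using eventually_ge_at_top[of 1] unfolding v_def[symmetric] by eventually_elim (rule bound)
  qed
qed

section \<open>Signed cycles under spin shifts\<close>

text \<open>The drift that the tilt by the spin configuration \<open>s\<close> gives to the entries.
  It vanishes on the diagonal, which is treated separately through \<open>cyc n 1\<close>.\<close>

definition spin_shift :: "real \<Rightarrow> (nat \<Rightarrow> real) \<Rightarrow> nat \<times> nat \<Rightarrow> real" where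
  "spin_shift c s e = (if fst e < snd e then c * (s (fst e) * s (snd e)) else 0)"

lemma spin_shift_edge: "a \<noteq> b \<Longrightarrow> spin_shift c s (edge a b) = c * (s a * s b)"
  by (auto simp: spin_shift_def edge_def min_def max_def)

lemma spin_square: "\<bar>y\<bar> = 1 \<Longrightarrow> y * y = (1::real)"
  by (metis abs_mult_self_eq mult_1)

text \<open>Every inner vertex lies on two consecutive edges, so its spin is squared away and only
  the spins at the two ends survive.\<close>

lemma mon_path_spin_shift:
  assumes "\<And>i. i \<in> set w \<Longrightarrow> \<bar>s i\<bar> = 1" "distinct w" "w \<noteq> []"
  shows "mon (path_edges w) (spin_shift c s) = c ^ (length w - 1) * (s (hd w) * s (last w))"
  using assms
proof (induction w rule: path_edges.induct)
  case (1 a b r)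
  have "mon (path_edges (a # b # r)) (spin_shift c s)
    = c * (s a * s b) * (c ^ (length (b # r) - 1) * (s b * s (last (b # r))))"
    using 1 by (simp add: spin_shift_edge)
  also have "\<dots> = c ^ (length (a # b # r) - 1) * (s a * ((s b * s b) * s (last (b # r))))"
    by simp
  also have "s b * s b = 1" using 1 by (intro spin_square) auto
  finally show ?case by simp
qed (auto simp: spin_square)

text \<open>Around a closed cycle all spins cancel, so the drift of a signed cycle is the same for
  every configuration. For \<open>k = 1\<close> this would fail, because loops are not
  shifted.\<close>

lemma mon_cycle_spin_shift:
  assumes w: "w \<in> tuples n k" and k: "k \<ge> 2" and s: "\<And>i. i \<in> {1..n} \<Longrightarrow> \<bar>s i\<bar> = 1"
  shows "mon (cycle_edges w) (spin_shift c s) = c ^ k"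
proof -
  have d: "distinct w" "length w = k" "set w \<subseteq> {1..n}" using w by (auto simp: tuples_def)
  then have ne: "w \<noteq> []" using k by auto
  have "hd w \<noteq> last w"
    using d k ne nth_eq_iff_index_eq[of w 0 "k - 1"] by (simp add: hd_conv_nth last_conv_nth)
  then have "mon (cycle_edges w) (spin_shift c s) = (c ^ (k - 1) * (s (hd w) * s (last w))) * (c * (s (last w) * s (hd w)))"
  proof -
    have "mon (path_edges w) (spin_shift c s) = c ^ (k - 1) * (s (hd w) * s (last w))"
      using mon_path_spin_shift[of w s c] d(2) by (metis d(1,3) ne s subsetD)
    then show ?thesis using \<open>hd w \<noteq> last w\<close>
      by (simp add: cycle_edges_def closing_edge_def spin_shift_edge)
  qed
  also have "\<dots> = (c * c ^ (k - 1)) * ((s (hd w) * s (hd w)) * (s (last w) * s (last w)))"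
    by simp
  also have "\<dots> = c ^ k"
  proof -
    have "s (hd w) * s (hd w) = 1" "s (last w) * s (last w) = 1"
      using hd_in_set[OF ne] last_in_set[OF ne] d(3) by (auto intro!: spin_square s)
    moreover have "c * c ^ (k - 1) = c ^ k" using k by (metis power_Suc Suc_diff_1 less_le_trans zero_less_numeral)
    ultimately show ?thesis by simp
  qed
  finally show ?thesis .
qed

lemma mon_selected_edges:
  "finite T \<Longrightarrow> mon (selected_edges T w) x = (\<Prod>l\<in>T. x (cycle_edges w ! l))"
proof -
  assume "finite T"
  then have "(\<Prod>l\<in>T. x (cycle_edges w ! l)) = prod_list (map (\<lambda>l. x (cycle_edges w ! l)) (sorted_list_of_set T))"
    using prod.distinct_set_conv_list[of "sorted_list_of_set T" "\<lambda>l. x (cycle_edges w ! l)"] by simp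
  then show ?thesis by (simp add: mon_def selected_edges_def o_def)
qed

text \<open>The part of the expanded product over a shifted cycle in which the entries are kept at
  the positions \<open>T\<close> and replaced by the drift \<open>\<kappa>\<close> at all
  others.\<close>

definition shift_term :: "nat \<Rightarrow> nat \<Rightarrow> (nat \<times> nat \<Rightarrow> real) \<Rightarrow> nat set \<Rightarrow> (nat \<times> nat \<Rightarrow> real) \<Rightarrow> real" where
  "shift_term n k \<kappa> T x = (\<Sum>w\<in>tuples n k. ((1 / sqrt n) ^ k * (\<Prod>l\<in>{..<k} - T. \<kappa> (cycle_edges w ! l))) * mon (selected_edges T w) x)"

lemma selected_edges_idx:
  assumes "w \<in> tuples n k" "T \<subseteq> {..<k}"
  shows "set (selected_edges T w) \<subseteq> idx n"
proof (cases "k = 0")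
  case False
  have f: "finite T" using assms(2) finite_subset by blast
  have w: "length w = k" "w \<noteq> []" using assms False by (auto simp: tuples_def)
  have "set (selected_edges T w) \<subseteq> set (cycle_edges w)"
    using f w assms(2) by (auto simp: selected_edges_def intro!: nth_mem)
  then show ?thesis using cycle_edges_idx[OF assms(1)] False by auto
next
  case True
  then show ?thesis using assms by (simp add: selected_edges_def)
qed

text \<open>In the expanded product the full set of positions returns the cycle and the empty set
  gives the deterministic drift; the proper nonempty sets remain as noise.\<close>

lemma cyc_shift_expand:
  assumes k: "k \<ge> 2" and s: "\<And>i. i \<in> {1..n} \<Longrightarrow> \<bar>s i\<bar> = 1"
  shows "cyc n k (\<lambda>e\<in>idx n. x e + spin_shift c s e) - cyc n k x - (c / sqrt n) ^ k * real (card (tuples n k))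
    = (\<Sum>T\<in>Pow {..<k} - {{}, {..<k}}. shift_term n k (spin_shift c s) T x)"
proof -
  let ?\<kappa> = "spin_shift c s"
  let ?r = "(1 / sqrt n) ^ k"
  let ?P = "Pow {..<k} - {{}, {..<k}}"
  have "0 \<in> {..<k}" using k by simp
  then have ne: "{} \<noteq> {..<k}" by blast
  have m: "mon (cycle_edges w) (\<lambda>e\<in>idx n. x e + ?\<kappa> e) = mon (cycle_edges w) x + c ^ k +
     (\<Sum>T\<in>?P. (\<Prod>l\<in>{..<k} - T. ?\<kappa> (cycle_edges w ! l)) * mon (selected_edges T w) x)" if w: "w \<in> tuples n k" for w
  proof -
    let ?es = "cycle_edges w"
    have l: "length ?es = k" using w k by (subst length_cycle_edges) (auto simp: tuples_def)
    let ?g = "\<lambda>T. (\<Prod>l\<in>T. x (?es ! l)) * (\<Prod>l\<in>{..<k} - T. ?\<kappa> (?es ! l))"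
    have "mon ?es (\<lambda>e\<in>idx n. x e + ?\<kappa> e) = mon ?es (\<lambda>e. x e + ?\<kappa> e)"
      using cycle_edges_idx[OF w] k by (intro mon_restrict) auto
    also have "\<dots> = (\<Prod>l<k. x (?es ! l) + ?\<kappa> (?es ! l))"
      by (simp add: mon_eq_prod_nth l)
    also have "\<dots> = (\<Sum>T\<in>Pow {..<k}. ?g T)" by (rule prod_add) simp
    also have "\<dots> = ?g {} + (?g {..<k} + (\<Sum>T\<in>?P. ?g T))"
    proof -
      have "(\<Sum>T\<in>Pow {..<k}. ?g T) = ?g {} + (\<Sum>T\<in>Pow {..<k} - {{}}. ?g T)"
        by (rule sum.remove) auto
      also have "(\<Sum>T\<in>Pow {..<k} - {{}}. ?g T) = ?g {..<k} + (\<Sum>T\<in>Pow {..<k} - {{}} - {{..<k}}. ?g T)"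
        by (rule sum.remove) (use ne in auto)
      also have "Pow {..<k} - {{}} - {{..<k}} = ?P" by auto
      finally show ?thesis .
    qed
    also have "?g {} = c ^ k"
      using mon_cycle_spin_shift[where c = c, OF w k s] by (simp add: mon_eq_prod_nth l)
    also have "?g {..<k} = mon ?es x" by (simp add: mon_eq_prod_nth l)
    also have "(\<Sum>T\<in>?P. ?g T) = (\<Sum>T\<in>?P. (\<Prod>l\<in>{..<k} - T. ?\<kappa> (?es ! l)) * mon (selected_edges T w) x)"
    proof (rule sum.cong[OF refl])
      fix T assume "T \<in> ?P"
      then have "finite T" by (auto intro: finite_subset)
      then show "?g T = (\<Prod>l\<in>{..<k} - T. ?\<kappa> (?es ! l)) * mon (selected_edges T w) x"
        by (simp add: mon_selected_edges)
    qed
    finally show ?thesis by (simp only: add_ac)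
  qed
  have "cyc n k (\<lambda>e\<in>idx n. x e + ?\<kappa> e) = ?r * (\<Sum>w\<in>tuples n k. mon (cycle_edges w) x) + ?r * (real (card (tuples n k)) * c ^ k) +
     ?r * (\<Sum>w\<in>tuples n k. \<Sum>T\<in>?P. (\<Prod>l\<in>{..<k} - T. ?\<kappa> (cycle_edges w ! l)) * mon (selected_edges T w) x)"
    unfolding cyc_def by (simp add: m sum.distrib distrib_left cong: sum.cong)
  also have "?r * (\<Sum>w\<in>tuples n k. \<Sum>T\<in>?P. (\<Prod>l\<in>{..<k} - T. ?\<kappa> (cycle_edges w ! l)) * mon (selected_edges T w) x)
     = (\<Sum>T\<in>?P. shift_term n k ?\<kappa> T x)"
    unfolding shift_term_def by (subst sum.swap) (simp add: sum_distrib_left mult.assoc)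
  also have "?r * (real (card (tuples n k)) * c ^ k) = (c / sqrt n) ^ k * real (card (tuples n k))"
    by (simp add: power_divide)
  finally have f: "cyc n k (\<lambda>e\<in>idx n. x e + ?\<kappa> e) = cyc n k x + (c / sqrt n) ^ k * real (card (tuples n k)) + (\<Sum>T\<in>?P. shift_term n k ?\<kappa> T x)"
    unfolding cyc_def[of n k x] .
  show ?thesis unfolding f by simp
qed

lemma gpoly_shift_term: "T \<subseteq> {..<k} \<Longrightarrow> gpoly (idx n) (shift_term n k \<kappa> T)"
  unfolding shift_term_def[abs_def] by (intro gpoly_sum gpoly_cmult gpoly_mon selected_edges_idx)

text \<open>Two cycles sharing the edges of a proper nonempty set \<open>T\<close> share at least
  \<open>card T + 1\<close> vertices; this is what makes all mixed terms negligible.\<close>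

lemma shift_term_second_moment:
  assumes n: "n \<ge> 1" and k: "k \<ge> 2" and T: "T \<noteq> {}" "T \<subset> {..<k}" and lam: "0 \<le> lam" "lam \<le> 1"
    and s: "\<And>i. i \<in> {1..n} \<Longrightarrow> \<bar>s i\<bar> = 1"
  shows "(\<integral>x. (shift_term n k (spin_shift (lam / sqrt n) s) T x)\<^sup>2 \<partial>gauss_space (idx n))
    \<le> moment_bound (2 * k) * real (2 * k - card T - 1) ^ (2 * k) / real n"
proof -
  let ?c = "lam / sqrt n"
  let ?\<kappa> = "spin_shift ?c s"
  let ?r = "(1 / sqrt n) ^ k"
  let ?K = "\<lambda>w. \<Prod>l\<in>{..<k} - T. ?\<kappa> (cycle_edges w ! l)"
  \<comment> \<open>By \<open>selected_edges_vertices\<close>, two tuples with the same selected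
    edges have at most this many vertices together.\<close>
  let ?p = "2 * k - card T - 1"
  let ?V = "\<lambda>u w. (?r * ?K u) * (?r * ?K w) * (mon_expectation (selected_edges T u @ selected_edges T w)
     - mon_expectation (selected_edges T u) * mon_expectation (selected_edges T w))"
  let ?B = "?r * ?c ^ (k - card T) * (?r * ?c ^ (k - card T)) * moment_bound (2 * k)"
  have fin: "finite T" by (rule finite_subset[of T "{..<k}"]) (use T in auto)
  have cT: "card T < k" using psubset_card_mono[OF _ T(2)] by simp
  have cT0: "card T > 0" using T fin by (simp add: card_gt_0_iff)
  have c0: "0 \<le> ?c" using lam by simp
  have w: "distinct w" "length w = k" "set w \<subseteq> {1..n}" if "w \<in> tuples n k" for w
    using that by (simp_all add: tuples_def)
  have sel: "distinct (selected_edges T w)" "length (selected_edges T w) = card T" if "w \<in> tuples n k" for w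
    using selected_edges[OF w(1,2)[OF that] T(2)] by auto
  \<comment> \<open>The selected edges are distinct and there is at least one, so the monomial is
    centred and covariances are plain joint moments.\<close>
  have m0: "mon_expectation (selected_edges T w) = 0" if "w \<in> tuples n k" for w
  proof -
    have "selected_edges T w \<noteq> []" using sel[OF that] cT0 by auto
    then obtain e es where e: "selected_edges T w = e # es" by (cases "selected_edges T w") auto
    then have "count_list (selected_edges T w) e = 1" using sel(1)[OF that] by auto
    then show ?thesis using mon_expectation_odd[of "selected_edges T w" e] by simp
  qed
  have K: "\<bar>?K w\<bar> \<le> ?c ^ (k - card T)" if "w \<in> tuples n k" for w
  proof -
    have "\<bar>?K w\<bar> = (\<Prod>l\<in>{..<k} - T. \<bar>?\<kappa> (cycle_edges w ! l)\<bar>)" by (rule abs_prod)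
    also have "\<dots> \<le> (\<Prod>l\<in>{..<k} - T. ?c)"
    proof (rule prod_mono, intro conjI)
      fix l assume "l \<in> {..<k} - T"
      then have "l < length (cycle_edges w)" using w[OF that] k by (subst length_cycle_edges) auto
      then have "cycle_edges w ! l \<in> idx n"
        using cycle_edges_idx[OF that] k nth_mem by fastforce
      then have "fst (cycle_edges w ! l) \<in> {1..n}" "snd (cycle_edges w ! l) \<in> {1..n}" by (auto simp: idx_def)
      then show "\<bar>?\<kappa> (cycle_edges w ! l)\<bar> \<le> ?c" using s lam by (simp add: spin_shift_def abs_mult)
    qed simp
    also have "\<dots> = ?c ^ (k - card T)" using T fin by (simp add: card_Diff_subset)
    finally show ?thesis .
  qed
  have "(\<integral>x. (shift_term n k ?\<kappa> T x)\<^sup>2 \<partial>gauss_space (idx n)) = (\<Sum>u\<in>tuples n k. \<Sum>w\<in>tuples n k. ?V u w)"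
  proof -
    have "set (selected_edges T w) \<subseteq> idx n" if "w \<in> tuples n k" for w
      using selected_edges_idx[OF that] T by auto
    then show ?thesis
      using integral_square_centered_mon_sum[of "idx n" "tuples n k" "selected_edges T" "\<lambda>w. ?r * ?K w"] m0
      by (simp add: shift_term_def cong: sum.cong)
  qed
  also have "\<dots> \<le> ?B * (real ?p ^ (2 * k) * real n ^ ?p)"
  proof (rule covariance_sum_bound[OF _ n, where h = "\<lambda>(u, w). u @ w"])
    show "0 \<le> ?B" using c0 moment_bound_ge_1[of "2 * k"] by (intro mult_nonneg_nonneg) auto
    show "1 \<le> ?p" using cT k by simp
    show "finite (tuples n k)" by simp
    show "inj_on (\<lambda>(u, w). u @ w) (tuples n k \<times> tuples n k)"
    proof (rule inj_onI, elim SigmaE)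
      fix x y u v u' v' assume "u \<in> tuples n k" "v \<in> tuples n k" "u' \<in> tuples n k" "v' \<in> tuples n k"
        and e: "(case x of (u, w) \<Rightarrow> u @ w) = (case y of (u, w) \<Rightarrow> u @ w)" "x = (u, v)" "y = (u', v')"
      then have "length u = length u'" using w by metis
      then show "x = y" using e by simp
    qed
    fix u v assume u: "u \<in> tuples n k" and v: "v \<in> tuples n k"
    show "length ((\<lambda>(u, w). u @ w) (u, v)) = 2 * k \<and> set ((\<lambda>(u, w). u @ w) (u, v)) \<subseteq> {1..n}"
      using w[OF u] w[OF v] by simp
    have "\<bar>?V u v\<bar> = (?r * \<bar>?K u\<bar>) * (?r * \<bar>?K v\<bar>) * \<bar>mon_expectation (selected_edges T u @ selected_edges T v)\<bar>"
      unfolding m0[OF u] by (simp add: abs_mult)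
    also have "\<dots> \<le> ?B"
    proof (intro mult_mono mult_left_mono K u v mon_expectation_bound)
      show "length (selected_edges T u @ selected_edges T v) \<le> 2 * k"
        using sel(2)[OF u] sel(2)[OF v] cT by simp
    qed (use c0 in auto)
    finally show "\<bar>?V u v\<bar> \<le> ?B" .
    assume "?V u v \<noteq> 0"
    then have "mon_expectation (selected_edges T u @ selected_edges T v) \<noteq> 0" unfolding m0[OF u] by auto
    then have "even (count_list (selected_edges T u @ selected_edges T v) e)" for e
      using mon_expectation_odd[of "selected_edges T u @ selected_edges T v" e] by metis
    then have "set (selected_edges T u) = set (selected_edges T v)"
      by (rule even_counts_distinct_eq) (use sel u v in auto)
    then have "card (set (u @ v)) + card T + 1 \<le> 2 * k"
      by (intro selected_edges_vertices) (use w[OF u] w[OF v] T in auto)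
    then show "card (set ((\<lambda>(u, w). u @ w) (u, v))) \<le> ?p" by simp
  qed
  also have "\<dots> = moment_bound (2 * k) * real ?p ^ (2 * k) * (lam ^ (2 * (k - card T)) / real n)"
  proof -
    \<comment> \<open>Normalisation and drift together supply the power 2k - card T of 1/n, exactly
      one more than the exponent \<open>?p\<close> from the vertex count.\<close>
    have h: "?r * ?c ^ (k - card T) * (?r * ?c ^ (k - card T)) * real n ^ ?p = lam ^ (2 * (k - card T)) / real n"
    proof -
      have e: "?r * ?c ^ (k - card T) * (?r * ?c ^ (k - card T)) = lam ^ (2 * (k - card T)) / real n ^ (k + (k - card T))"
      proof -
        have "?r * ?r = 1 / real n ^ k" using n by (simp add: power_mult_distrib[symmetric] power_divide)
        moreover have "?c ^ (k - card T) * ?c ^ (k - card T) = lam ^ (2 * (k - card T)) / real n ^ (k - card T)"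
          using n by (simp add: power_mult_distrib[symmetric] power_divide mult_2 power_add)
        moreover have "?r * ?c ^ (k - card T) * (?r * ?c ^ (k - card T)) = (?r * ?r) * (?c ^ (k - card T) * ?c ^ (k - card T))"
          by (simp only: mult_ac)
        ultimately show ?thesis by (simp add: power_add)
      qed
      have "k + (k - card T) = Suc ?p" using cT by simp
      then show ?thesis unfolding e using n by simp
    qed
    have "?B * (real ?p ^ (2 * k) * real n ^ ?p) = moment_bound (2 * k) * real ?p ^ (2 * k) *
        (?r * ?c ^ (k - card T) * (?r * ?c ^ (k - card T)) * real n ^ ?p)"
      by (simp only: mult_ac)
    then show ?thesis unfolding h .
  qed
  also have "\<dots> \<le> moment_bound (2 * k) * real ?p ^ (2 * k) * (1 / real n)"
    using lam moment_bound_ge_1[of "2 * k"]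
    by (intro mult_left_mono divide_right_mono power_le_one mult_nonneg_nonneg) auto
  finally show ?thesis by simp
qed

lemma cyc_shift_bound:
  assumes k: "k \<ge> 2" and lam: "0 \<le> lam" "lam \<le> 1"
  shows "\<exists>C. \<forall>n\<ge>1. \<forall>s. (\<forall>i\<in>{1..n}. \<bar>s i\<bar> = 1) \<longrightarrow>
    (\<integral>x. \<bar>cyc n k (\<lambda>e\<in>idx n. x e + spin_shift (lam / sqrt n) s e) - cyc n k x - lam ^ k * (real (card (tuples n k)) / real n ^ k)\<bar> \<partial>gauss_space (idx n)) \<le> C / sqrt n"
proof (rule exI, intro allI impI)
  fix n :: nat and s :: "nat \<Rightarrow> real" assume n: "n \<ge> 1" and s: "\<forall>i\<in>{1..n}. \<bar>s i\<bar> = 1"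
  interpret prob_space "gauss_space (idx n)" by (rule prob_space_gauss_space)
  note gi = gpoly_integrable[OF finite_idx]
  let ?P = "Pow {..<k} - {{}, {..<k}}"
  let ?\<kappa> = "spin_shift (lam / sqrt n) s"
  let ?C = "\<lambda>T. moment_bound (2 * k) * real (2 * k - card T - 1) ^ (2 * k)"
  have g: "gpoly (idx n) (shift_term n k ?\<kappa> T)" if "T \<in> ?P" for T
    using that by (intro gpoly_shift_term) auto
  have e: "lam ^ k * (real (card (tuples n k)) / real n ^ k) = (lam / sqrt n / sqrt n) ^ k * real (card (tuples n k))"
    using n by (simp add: power_divide)
  have "(\<integral>x. \<bar>cyc n k (\<lambda>e\<in>idx n. x e + ?\<kappa> e) - cyc n k x - lam ^ k * (real (card (tuples n k)) / real n ^ k)\<bar> \<partial>gauss_space (idx n))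
     = expectation (\<lambda>x. \<bar>\<Sum>T\<in>?P. shift_term n k ?\<kappa> T x\<bar>)"
    unfolding e by (subst cyc_shift_expand[OF k]) (use s in auto)
  also have "\<dots> \<le> expectation (\<lambda>x. \<Sum>T\<in>?P. \<bar>shift_term n k ?\<kappa> T x\<bar>)"
    by (intro integral_mono integrable_abs Bochner_Integration.integrable_sum gi g sum_abs)
  also have "\<dots> = (\<Sum>T\<in>?P. expectation (\<lambda>x. \<bar>shift_term n k ?\<kappa> T x\<bar>))"
    by (intro Bochner_Integration.integral_sum integrable_abs gi g)
  also have "\<dots> \<le> (\<Sum>T\<in>?P. sqrt (?C T) / sqrt n)"
  proof (rule sum_mono)
    fix T assume T: "T \<in> ?P"
    have "expectation (\<lambda>x. \<bar>shift_term n k ?\<kappa> T x\<bar>) \<le> sqrt (expectation (\<lambda>x. (shift_term n k ?\<kappa> T x)\<^sup>2))"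
      by (rule expectation_abs_le_sqrt(2)) (auto intro!: gi gpoly_power gpoly_measurable g T)
    also have "\<dots> \<le> sqrt (?C T / real n)"
      by (intro real_sqrt_le_mono shift_term_second_moment[OF n k _ _ lam]) (use T s in auto)
    finally show "expectation (\<lambda>x. \<bar>shift_term n k ?\<kappa> T x\<bar>) \<le> sqrt (?C T) / sqrt n" by (simp add: real_sqrt_divide)
  qed
  finally show "(\<integral>x. \<bar>cyc n k (\<lambda>e\<in>idx n. x e + ?\<kappa> e) - cyc n k x - lam ^ k * (real (card (tuples n k)) / real n ^ k)\<bar> \<partial>gauss_space (idx n)) \<le> (\<Sum>T\<in>?P. sqrt (?C T)) / sqrt n"
    by (simp add: sum_divide_distrib)
qed

text \<open>The error is uniform over all sign configurations \<open>s\<close>, so it survives the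
  average over spins that makes up \<open>Z\<close>. The assumption \<open>a 1 = 0\<close> excludes
  the diagonal, which the shift does not move.\<close>

lemma lin_shift_tendsto:
  assumes lam: "0 \<le> lam" "lam \<le> 1" and a1: "a 1 = 0"
  shows "\<exists>\<epsilon>. \<epsilon> \<longlonglongrightarrow> 0 \<and> (\<forall>n\<ge>1. \<forall>s. (\<forall>i\<in>{1..n}. \<bar>s i\<bar> = 1) \<longrightarrow>
    integrable (gauss_space (idx n)) (\<lambda>x. lin a M n (\<lambda>e\<in>idx n. x e + spin_shift (lam / sqrt n) s e)) \<and>
    (\<integral>x. \<bar>lin a M n (\<lambda>e\<in>idx n. x e + spin_shift (lam / sqrt n) s e) - lin a M n x - (\<Sum>k=1..M. a k * lam ^ k)\<bar> \<partial>gauss_space (idx n)) \<le> \<epsilon> n)"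
proof -
  define Bd where "Bd k C \<longleftrightarrow> (\<forall>n\<ge>1. \<forall>s. (\<forall>i\<in>{1..n}. \<bar>s i\<bar> = 1) \<longrightarrow>
    (\<integral>x. \<bar>cyc n k (\<lambda>e\<in>idx n. x e + spin_shift (lam / sqrt n) s e) - cyc n k x - lam ^ k * (real (card (tuples n k)) / real n ^ k)\<bar> \<partial>gauss_space (idx n)) \<le> C / sqrt n)"
    for k C
  have "\<exists>C. Bd k C" if "k \<ge> 2" for k unfolding Bd_def by (rule cyc_shift_bound[OF that lam])
  then obtain C where "\<And>k. k \<ge> 2 \<Longrightarrow> Bd k (C k)" by metis
  note C = this[unfolded Bd_def, rule_format]
  \<comment> \<open>The first summand bounds the noise of the mixed terms; the second accounts for
    tuples being distinct, through their number divided by n^k.\<close>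
  define \<epsilon> where "\<epsilon> = (\<lambda>n. \<Sum>k=1..M. \<bar>a k\<bar> * (C k / sqrt (real n) + \<bar>lam ^ k * (real (card (tuples n k)) / real n ^ k) - lam ^ k\<bar>))"
  have lim: "\<epsilon> \<longlonglongrightarrow> 0"
  proof -
    have "(\<lambda>n. lam ^ k * (real (card (tuples n k)) / real n ^ k) - lam ^ k) \<longlonglongrightarrow> lam ^ k * 1 - lam ^ k" for k
      by (intro tendsto_intros card_tuples_limit)
    then have "(\<lambda>n. \<bar>lam ^ k * (real (card (tuples n k)) / real n ^ k) - lam ^ k\<bar>) \<longlonglongrightarrow> 0" for k
      by (simp add: tendsto_rabs_zero_iff)
    moreover have "(\<lambda>n. C k / sqrt (real n)) \<longlonglongrightarrow> 0" for k by real_asymp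
    ultimately have "\<epsilon> \<longlonglongrightarrow> (\<Sum>k=1..M. \<bar>a k\<bar> * (0 + 0))"
      unfolding \<epsilon>_def by (intro tendsto_sum tendsto_mult tendsto_add tendsto_const)
    then show ?thesis by simp
  qed
  moreover have "integrable (gauss_space (idx n)) (\<lambda>x. lin a M n (\<lambda>e\<in>idx n. x e + spin_shift (lam / sqrt n) s e)) \<and>
    (\<integral>x. \<bar>lin a M n (\<lambda>e\<in>idx n. x e + spin_shift (lam / sqrt n) s e) - lin a M n x - (\<Sum>k=1..M. a k * lam ^ k)\<bar> \<partial>gauss_space (idx n)) \<le> \<epsilon> n"
    if n: "n \<ge> 1" and s: "\<forall>i\<in>{1..n}. \<bar>s i\<bar> = 1" for n s
  proof -
    interpret prob_space "gauss_space (idx n)" by (rule prob_space_gauss_space)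
    note gi = gpoly_integrable[OF finite_idx]
    let ?sh = "\<lambda>x. \<lambda>e\<in>idx n. x e + spin_shift (lam / sqrt n) s e"
    let ?q = "\<lambda>k. lam ^ k * (real (card (tuples n k)) / real n ^ k)"
    let ?D = "\<lambda>k x. cyc n k (?sh x) - cyc n k x - ?q k"
    have iD: "integrable (gauss_space (idx n)) (?D k)" if "k \<ge> 2" for k
    proof -
      have e: "?q k = (lam / sqrt n / sqrt n) ^ k * real (card (tuples n k))"
        using n by (simp add: power_divide)
      have "?D k = (\<lambda>x. \<Sum>T\<in>Pow {..<k} - {{}, {..<k}}. shift_term n k (spin_shift (lam / sqrt n) s) T x)"
        unfolding e by (rule ext, rule cyc_shift_expand[OF that]) (use s in auto)
      then show ?thesis
        by (simp only:) (intro gi gpoly_sum gpoly_shift_term, auto)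
    qed
    have eq: "lin a M n (?sh x) - lin a M n x - (\<Sum>k=1..M. a k * lam ^ k)
       = (\<Sum>k\<in>{2..M}. a k * (?D k x + (?q k - lam ^ k)))" for x
    proof -
      have "lin a M n (?sh x) - lin a M n x - (\<Sum>k=1..M. a k * lam ^ k) = (\<Sum>k=1..M. a k * (?D k x + (?q k - lam ^ k)))"
        unfolding lin_def sum_subtractf[symmetric] by (rule sum.cong) (auto simp: cyc0_def algebra_simps)
      also have "\<dots> = (\<Sum>k\<in>{2..M}. a k * (?D k x + (?q k - lam ^ k)))"
        by (rule sum.mono_neutral_right) (use a1 in \<open>auto simp: not_le\<close>, metis a1 One_nat_def Suc_1 le_antisym less_Suc_eq_le)
      finally show ?thesis .
    qed
    have i2: "integrable (gauss_space (idx n)) (\<lambda>x. \<Sum>k\<in>{2..M}. a k * (?D k x + (?q k - lam ^ k)))"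
      by (intro Bochner_Integration.integrable_sum integrable_mult_right Bochner_Integration.integrable_add iD) auto
    have "(\<lambda>x. lin a M n (?sh x)) = (\<lambda>x. (\<Sum>k\<in>{2..M}. a k * (?D k x + (?q k - lam ^ k))) + (lin a M n x + (\<Sum>k=1..M. a k * lam ^ k)))"
      unfolding eq[symmetric] by simp
    then have i1: "integrable (gauss_space (idx n)) (\<lambda>x. lin a M n (?sh x))"
      by (simp only:) (intro Bochner_Integration.integrable_add i2 gi gpoly_lin gpoly_const)
    have "(\<integral>x. \<bar>lin a M n (?sh x) - lin a M n x - (\<Sum>k=1..M. a k * lam ^ k)\<bar> \<partial>gauss_space (idx n))
      = expectation (\<lambda>x. \<bar>\<Sum>k\<in>{2..M}. a k * (?D k x + (?q k - lam ^ k))\<bar>)" unfolding eq ..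
    also have "\<dots> \<le> expectation (\<lambda>x. \<Sum>k\<in>{2..M}. \<bar>a k\<bar> * (\<bar>?D k x\<bar> + \<bar>?q k - lam ^ k\<bar>))"
    proof (rule integral_mono)
      show "integrable (gauss_space (idx n)) (\<lambda>x. \<bar>\<Sum>k\<in>{2..M}. a k * (?D k x + (?q k - lam ^ k))\<bar>)"
        by (rule integrable_abs[OF i2])
      show "integrable (gauss_space (idx n)) (\<lambda>x. \<Sum>k\<in>{2..M}. \<bar>a k\<bar> * (\<bar>?D k x\<bar> + \<bar>?q k - lam ^ k\<bar>))"
        by (intro Bochner_Integration.integrable_sum integrable_mult_right Bochner_Integration.integrable_add integrable_abs iD) auto
      fix x
      show "\<bar>\<Sum>k\<in>{2..M}. a k * (?D k x + (?q k - lam ^ k))\<bar> \<le> (\<Sum>k\<in>{2..M}. \<bar>a k\<bar> * (\<bar>?D k x\<bar> + \<bar>?q k - lam ^ k\<bar>))"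
        by (rule order_trans[OF sum_abs]) (intro sum_mono, simp only: abs_mult, intro mult_left_mono abs_triangle_ineq, simp)
    qed
    also have "\<dots> = (\<Sum>k\<in>{2..M}. \<bar>a k\<bar> * (expectation (\<lambda>x. \<bar>?D k x\<bar>) + \<bar>?q k - lam ^ k\<bar>))"
    proof -
      have "integrable (gauss_space (idx n)) (\<lambda>x. \<bar>a k\<bar> * (\<bar>?D k x\<bar> + \<bar>?q k - lam ^ k\<bar>))"
        "expectation (\<lambda>x. \<bar>a k\<bar> * (\<bar>?D k x\<bar> + \<bar>?q k - lam ^ k\<bar>)) = \<bar>a k\<bar> * (expectation (\<lambda>x. \<bar>?D k x\<bar>) + \<bar>?q k - lam ^ k\<bar>)"
        if "k \<in> {2..M}" for k using integrable_abs[OF iD[of k]] that by (simp_all add: prob_space)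
      then show ?thesis by (simp only: Bochner_Integration.integral_sum cong: sum.cong)
    qed
    also have "\<dots> \<le> (\<Sum>k\<in>{2..M}. \<bar>a k\<bar> * (C k / sqrt n + \<bar>?q k - lam ^ k\<bar>))"
      by (intro sum_mono mult_left_mono add_mono C) (use n s in auto)
    also have "\<dots> = \<epsilon> n"
      unfolding \<epsilon>_def by (rule sum.mono_neutral_left) (use a1 in \<open>auto simp: not_le\<close>, metis a1 One_nat_def Suc_1 le_antisym less_Suc_eq_le)
    finally show ?thesis using i1 by simp
  qed
  ultimately show ?thesis by blast
qed

section \<open>Moments of the partition function\<close>

lemma sum_symmetric_pairs:
  fixes f :: "nat \<Rightarrow> nat \<Rightarrow> real"
  assumes sym: "\<And>i j. f i j = f j i"
  shows "(\<Sum>i=1..n. \<Sum>j=1..n. f i j) = (\<Sum>i=1..n. f i i) + 2 * (\<Sum>e\<in>idx n. if fst e < snd e then f (fst e) (snd e) else 0)"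
proof (induction n)
  case 0
  have "idx 0 = {}" by (auto simp: idx_def)
  then show ?case by simp
next
  case (Suc n)
  let ?f = "\<lambda>e. if fst e < snd e then f (fst e) (snd e) else 0"
  have "idx (Suc n) = idx n \<union> (\<lambda>i. (i, Suc n)) ` {1..Suc n}" by (auto simp: idx_def)
  moreover have "idx n \<inter> (\<lambda>i. (i, Suc n)) ` {1..Suc n} = {}" by (auto simp: idx_def)
  ultimately have "(\<Sum>e\<in>idx (Suc n). ?f e) = (\<Sum>e\<in>idx n. ?f e) + (\<Sum>e\<in>(\<lambda>i. (i, Suc n)) ` {1..Suc n}. ?f e)"
    by (simp add: sum.union_disjoint)
  also have "(\<Sum>e\<in>(\<lambda>i. (i, Suc n)) ` {1..Suc n}. ?f e) = (\<Sum>i=1..Suc n. if i < Suc n then f i (Suc n) else 0)"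
    by (subst sum.reindex) (auto simp: inj_on_def)
  also have "\<dots> = (\<Sum>i=1..n. f i (Suc n))" by simp
  finally have e: "(\<Sum>e\<in>idx (Suc n). ?f e) = (\<Sum>e\<in>idx n. ?f e) + (\<Sum>i=1..n. f i (Suc n))" .
  have s: "(\<Sum>j=1..n. f (Suc n) j) = (\<Sum>i=1..n. f i (Suc n))" by (rule sum.cong[OF refl]) (rule sym)
  show ?case unfolding e using Suc s by (simp add: sum.distrib)
qed

lemma sum_idx_pairs:
  fixes u :: "nat \<Rightarrow> real"
  shows "(\<Sum>e\<in>idx n. if fst e < snd e then u (fst e) * u (snd e) else 0) =
    ((\<Sum>i=1..n. u i)\<^sup>2 - (\<Sum>i=1..n. (u i)\<^sup>2)) / 2"
  using sum_symmetric_pairs[of "\<lambda>i j. u i * u j" n]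
  by (simp add: mult.commute power2_eq_square sum_product)

definition spins :: "nat \<Rightarrow> (nat \<Rightarrow> real) set" where
  "spins n = {1..n} \<rightarrow>\<^sub>E {-1, 1}"

lemma finite_spins [simp]: "finite (spins n)"
  by (simp add: spins_def finite_PiE)

lemma card_spins: "card (spins n) = 2 ^ n"
  by (simp add: spins_def card_PiE numeral_2_eq_2)

lemma spins_abs: "\<sigma> \<in> spins n \<Longrightarrow> i \<in> {1..n} \<Longrightarrow> \<bar>\<sigma> i\<bar> = 1"
  unfolding spins_def by (drule PiE_mem) auto

lemma spins_square: "\<sigma> \<in> spins n \<Longrightarrow> i \<in> {1..n} \<Longrightarrow> (\<sigma> i)\<^sup>2 = 1"
  using spin_square[OF spins_abs] by (simp add: power2_eq_square)

definition spin_field :: "real \<Rightarrow> nat \<Rightarrow> (nat \<Rightarrow> real) \<Rightarrow> (nat \<times> nat \<Rightarrow> real) \<Rightarrow> real" where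
  "spin_field lam n \<sigma> x = (\<Sum>e\<in>idx n. spin_shift (lam / sqrt n) \<sigma> e * x e)"

text \<open>The partition function in the external field \<open>s/sqrt n\<close>, normalised to have mean
  \<open>1\<close> at \<open>s = 0\<close>.\<close>

definition zfield :: "real \<Rightarrow> real \<Rightarrow> nat \<Rightarrow> (nat \<times> nat \<Rightarrow> real) \<Rightarrow> real" where
  "zfield lam s n x = 1 / 2 ^ n * (\<Sum>\<sigma>\<in>spins n.
     exp (s / sqrt n * (\<Sum>i=1..n. \<sigma> i)) * exp (spin_field lam n \<sigma> x - lam\<^sup>2 * (real n - 1) / 4))"

text \<open>The two squares give a constant for each of the n(n - 1)/2 edges, and the mixed products
  complete the square of the overlap; the diagonal missing from that square turns n - 1 into n -
  2.\<close>

lemma spin_shift_pair_sum: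
  assumes n: "n \<ge> 1" and st: "\<sigma> \<in> spins n" "\<tau> \<in> spins n"
  shows "(\<Sum>e\<in>idx n. (spin_shift (lam / sqrt n) \<sigma> e + spin_shift (lam / sqrt n) \<tau> e)\<^sup>2) =
    lam\<^sup>2 * (real n - 2) + lam\<^sup>2 * (\<Sum>i=1..n. \<sigma> i * \<tau> i)\<^sup>2 / n"
proof -
  let ?c2 = "lam\<^sup>2 / real n"
  let ?p = "\<lambda>u e. if fst e < snd e then u (fst e) * u (snd e) else (0::real)"
  let ?\<rho> = "\<lambda>i. \<sigma> i * \<tau> i"
  have "(spin_shift (lam / sqrt n) \<sigma> e + spin_shift (lam / sqrt n) \<tau> e)\<^sup>2 =
     2 * ?c2 * ?p (\<lambda>i. 1) e + 2 * ?c2 * ?p ?\<rho> e" if e: "e \<in> idx n" for e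
  proof -
    have ij: "fst e \<in> {1..n}" "snd e \<in> {1..n}" using e by (auto simp: idx_def)
    note sq = spins_square[OF st(1) ij(1)] spins_square[OF st(1) ij(2)] spins_square[OF st(2) ij(1)] spins_square[OF st(2) ij(2)]
    have "(c * (a * b) + c * (a' * b'))\<^sup>2 = c\<^sup>2 * (2 + 2 * ((a * a') * (b * b')))"
      if "a\<^sup>2 = 1" "b\<^sup>2 = 1" "a'\<^sup>2 = 1" "b'\<^sup>2 = 1" for c a b a' b' :: real
    proof -
      have "(c * (a * b) + c * (a' * b'))\<^sup>2 = c\<^sup>2 * (a\<^sup>2 * b\<^sup>2 + a'\<^sup>2 * b'\<^sup>2 + 2 * ((a * a') * (b * b')))"
        by (simp add: power2_eq_square algebra_simps)
      then show ?thesis using that by simp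
    qed
    note k = this[OF sq]
    show ?thesis
    proof (cases "fst e < snd e")
      case True
      then have "(spin_shift (lam / sqrt n) \<sigma> e + spin_shift (lam / sqrt n) \<tau> e)\<^sup>2
         = (lam / sqrt n)\<^sup>2 * (2 + 2 * ((\<sigma> (fst e) * \<tau> (fst e)) * (\<sigma> (snd e) * \<tau> (snd e))))"
        unfolding spin_shift_def by (simp only: if_True k)
      also have "(lam / sqrt n)\<^sup>2 = ?c2" by (simp add: power_divide)
      finally show ?thesis using True by (simp add: algebra_simps)
    qed (simp add: spin_shift_def)
  qed
  then have "(\<Sum>e\<in>idx n. (spin_shift (lam / sqrt n) \<sigma> e + spin_shift (lam / sqrt n) \<tau> e)\<^sup>2) =
     2 * ?c2 * (\<Sum>e\<in>idx n. ?p (\<lambda>i. 1) e) + 2 * ?c2 * (\<Sum>e\<in>idx n. ?p ?\<rho> e)"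
    by (simp only: sum.distrib sum_distrib_left cong: sum.cong)
  also have "(\<Sum>e\<in>idx n. ?p (\<lambda>i. 1) e) = ((real n)\<^sup>2 - real n) / 2"
    using sum_idx_pairs[of "\<lambda>i. 1" n] by simp
  also have "(\<Sum>e\<in>idx n. ?p ?\<rho> e) = ((\<Sum>i=1..n. ?\<rho> i)\<^sup>2 - real n) / 2"
  proof -
    have "(\<Sum>i=1..n. (?\<rho> i)\<^sup>2) = (\<Sum>i=1..n. 1)"
      by (rule sum.cong[OF refl]) (use spins_square[OF st(1)] spins_square[OF st(2)] in \<open>simp add: power_mult_distrib\<close>)
    then show ?thesis using sum_idx_pairs[of ?\<rho> n] by simp
  qed
  finally have f: "(\<Sum>e\<in>idx n. (spin_shift (lam / sqrt n) \<sigma> e + spin_shift (lam / sqrt n) \<tau> e)\<^sup>2) =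
    2 * ?c2 * (((real n)\<^sup>2 - real n) / 2) + 2 * ?c2 * (((\<Sum>i=1..n. ?\<rho> i)\<^sup>2 - real n) / 2)" .
  show ?thesis unfolding f using n by (simp add: field_simps power2_eq_square)
qed

lemma spin_shift_sum_square:
  assumes n: "n \<ge> 1" and s: "\<sigma> \<in> spins n"
  shows "(\<Sum>e\<in>idx n. (spin_shift (lam / sqrt n) \<sigma> e)\<^sup>2) = lam\<^sup>2 * (real n - 1) / 2"
proof -
  have "(\<Sum>i=1..n. \<sigma> i * \<sigma> i) = (\<Sum>i=1..n. 1)"
    by (rule sum.cong[OF refl]) (use spins_square[OF s] in \<open>simp add: power2_eq_square\<close>)
  then have "(\<Sum>e\<in>idx n. (2 * spin_shift (lam / sqrt n) \<sigma> e)\<^sup>2) = lam\<^sup>2 * (real n - 2) + lam\<^sup>2 * real n"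
    using spin_shift_pair_sum[OF n s s, of lam] n by (simp add: power2_eq_square)
  then show ?thesis by (simp add: power_mult_distrib sum_distrib_left[symmetric] algebra_simps)
qed

section \<open>One-dimensional Gaussian integrals and the two-spin kernel\<close>

lemma
  shows integrable_exp_std_normal: "integrable std_normal_distribution (\<lambda>g. exp (a * g))"
    and integral_exp_std_normal: "(\<integral>g. exp (a * g) \<partial>std_normal_distribution) = exp (a\<^sup>2 / 2)"
proof -
  have e: "std_normal_density g * exp (a * g) = exp (a\<^sup>2 / 2) * normal_density a 1 g" for g
    by (simp add: normal_density_def exp_add[symmetric] power2_eq_square field_simps)
  show "integrable std_normal_distribution (\<lambda>g. exp (a * g))"
    by (subst integrable_density) (auto simp: e)
  show "(\<integral>g. exp (a * g) \<partial>std_normal_distribution) = exp (a\<^sup>2 / 2)"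
    by (subst integral_density) (auto simp: e)
qed

lemma
  assumes b: "b < 1"
  shows integrable_exp_square_std_normal: "integrable std_normal_distribution (\<lambda>g. exp (b * g\<^sup>2 / 2))"
    and integral_exp_square_std_normal: "(\<integral>g. exp (b * g\<^sup>2 / 2) \<partial>std_normal_distribution) = 1 / sqrt (1 - b)"
proof -
  let ?s = "1 / sqrt (1 - b)"
  have s: "?s > 0" using b by simp
  have e: "std_normal_density g * exp (b * g\<^sup>2 / 2) = ?s * normal_density 0 ?s g" for g
  proof -
    have "exp (- (g\<^sup>2 / 2)) * exp (b * g\<^sup>2 / 2) = exp (- (g\<^sup>2 * (1 - b) / 2))"
      unfolding exp_add[symmetric] by (simp add: algebra_simps diff_divide_distrib)
    then show ?thesis using b
      by (simp add: normal_density_def power_divide real_sqrt_divide real_sqrt_mult field_simps)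
  qed
  show "integrable std_normal_distribution (\<lambda>g. exp (b * g\<^sup>2 / 2))"
    by (subst integrable_density) (use s in \<open>auto simp: e simp del: times_divide_eq_left\<close>)
  show "(\<integral>g. exp (b * g\<^sup>2 / 2) \<partial>std_normal_distribution) = 1 / sqrt (1 - b)"
    by (subst integral_density) (use s in \<open>auto simp: e simp del: times_divide_eq_left\<close>)
qed

text \<open>The derivative of ln cosh is tanh, which lies below the identity on the positive
  axis.\<close>

lemma cosh_le_exp_square: "cosh x \<le> exp (x\<^sup>2 / 2)" for x :: real
proof -
  have 1: "tanh y \<le> y" if "y \<ge> 0" for y :: real
  proof -
    have "(\<lambda>y. y - tanh y) 0 \<le> (\<lambda>y. y - tanh y) y"
    proof (rule DERIV_nonneg_imp_nondecreasing[OF that])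
      fix z :: real
      show "\<exists>d. ((\<lambda>y. y - tanh y) has_real_derivative d) (at z) \<and> 0 \<le> d"
        by (rule exI[of _ "(tanh z)\<^sup>2"]) (auto intro!: derivative_eq_intros)
    qed
    then show ?thesis by simp
  qed
  have 2: "ln (cosh y) \<le> y\<^sup>2 / 2" if "y \<ge> 0" for y :: real
  proof -
    have "(\<lambda>y. y\<^sup>2 / 2 - ln (cosh y)) 0 \<le> (\<lambda>y. y\<^sup>2 / 2 - ln (cosh y)) y"
    proof (rule DERIV_nonneg_imp_nondecreasing[OF that])
      fix z :: real assume "0 \<le> z"
      then show "\<exists>d. ((\<lambda>y. y\<^sup>2 / 2 - ln (cosh y)) has_real_derivative d) (at z) \<and> 0 \<le> d"
        using 1[of z]
        by (intro exI[of _ "z - tanh z"]) (auto intro!: derivative_eq_intros simp: tanh_def cosh_real_pos)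
    qed
    then show ?thesis by simp
  qed
  have "cosh \<bar>x\<bar> \<le> exp (\<bar>x\<bar>\<^sup>2 / 2)"
    using 2[of "\<bar>x\<bar>"] ln_le_cancel_iff by (metis abs_ge_zero cosh_real_pos exp_gt_zero ln_exp)
  then show ?thesis by (simp add: abs_if split: if_splits)
qed

text \<open>The mean of exp(a u + b v + z u v) over two independent fair signs \<open>u\<close> and
  \<open>v\<close>: what a single site contributes to a product of two partition functions.\<close>

definition pair_kernel :: "real \<Rightarrow> real \<Rightarrow> real \<Rightarrow> real" where
  "pair_kernel a b z = (exp (a + b + z) + exp (a - b - z) + exp (- a + b - z) + exp (- a - b + z)) / 4"

lemma pair_kernel_pos: "pair_kernel a b z > 0"
  by (simp add: pair_kernel_def add_pos_pos)

text \<open>The constant 1/2 in front of z^2 is what matters: with z = lam g the bound stays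
  integrable against the normal law for every lam < 1. The dependence on \<open>a\<close> and
  \<open>b\<close> may be lossy.\<close>

lemma pair_kernel_le: "pair_kernel a b z \<le> exp ((\<bar>a\<bar> + \<bar>b\<bar>)\<^sup>2 / 2) * exp (z\<^sup>2 / 2)"
proof -
  have m: "cosh y \<le> cosh (\<bar>a\<bar> + \<bar>b\<bar>)" if "\<bar>y\<bar> \<le> \<bar>a\<bar> + \<bar>b\<bar>" for y
    using that cosh_real_nonneg_le_iff[of "\<bar>y\<bar>" "\<bar>a\<bar> + \<bar>b\<bar>"] by (simp add: cosh_real_abs)
  have "pair_kernel a b z = (exp z * cosh (a + b) + exp (- z) * cosh (a - b)) / 2"
    by (simp add: pair_kernel_def cosh_def exp_add exp_diff exp_minus field_simps)
  also have "\<dots> \<le> (exp z * cosh (\<bar>a\<bar> + \<bar>b\<bar>) + exp (- z) * cosh (\<bar>a\<bar> + \<bar>b\<bar>)) / 2"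
    by (intro divide_right_mono add_mono mult_left_mono m) auto
  also have "\<dots> = cosh (\<bar>a\<bar> + \<bar>b\<bar>) * cosh z"
    by (simp add: cosh_def[of z] field_simps)
  also have "\<dots> \<le> exp ((\<bar>a\<bar> + \<bar>b\<bar>)\<^sup>2 / 2) * exp (z\<^sup>2 / 2)"
    by (intro mult_mono cosh_le_exp_square) auto
  finally show ?thesis .
qed

lemma exp_scaled_limit: "(\<lambda>n. real n * (exp (y / sqrt (real n)) - 1 - y / sqrt (real n))) \<longlonglongrightarrow> y\<^sup>2 / 2"
proof (cases y "0 :: real" rule: linorder_cases)
  case less
  then show ?thesis unfolding power2_eq_square by real_asymp
next
  case greater
  then show ?thesis unfolding power2_eq_square by real_asymp
qed simp

text \<open>n ln f is squeezed between n(f - 1)/f and n(f - 1), which have the same limit.\<close>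

lemma power_exp_limit:
  fixes f :: "nat \<Rightarrow> real"
  assumes f: "(\<lambda>n. real n * (f n - 1)) \<longlonglongrightarrow> u" and pos: "\<And>n. f n > 0"
  shows "(\<lambda>n. f n ^ n) \<longlonglongrightarrow> exp u"
proof -
  have "(\<lambda>n. real n * (f n - 1) * (1 / real n)) \<longlonglongrightarrow> u * 0"
    by (intro tendsto_mult f) real_asymp
  moreover have "\<forall>\<^sub>F n in sequentially. real n * (f n - 1) * (1 / real n) = f n - 1"
    using eventually_gt_at_top[of 0] by eventually_elim simp
  ultimately have "(\<lambda>n. f n - 1) \<longlonglongrightarrow> 0" using Lim_transform_eventually by fastforce
  then have "f \<longlonglongrightarrow> 1" by (rule LIM_zero_cancel)
  then have lo: "(\<lambda>n. real n * (f n - 1) * inverse (f n)) \<longlonglongrightarrow> u * inverse 1"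
    by (intro tendsto_mult f tendsto_inverse) auto
  have "(\<lambda>n. real n * ln (f n)) \<longlonglongrightarrow> u"
  proof (rule tendsto_sandwich[OF _ _ _ f])
    show "(\<lambda>n. real n * (f n - 1) * inverse (f n)) \<longlonglongrightarrow> u" using lo by simp
    have "ln (f n) \<le> f n - 1" for n using ln_le_minus_one[OF pos] .
    then show "\<forall>\<^sub>F n in sequentially. real n * ln (f n) \<le> real n * (f n - 1)"
      by (intro always_eventually allI mult_left_mono) auto
    have "(f n - 1) * inverse (f n) \<le> ln (f n)" for n
    proof -
      have "(f n - 1) * inverse (f n) = 1 - inverse (f n)" using pos[of n] by (simp add: left_diff_distrib)
      then show ?thesis
        using ln_le_minus_one[of "inverse (f n)"] pos[of n] ln_inverse[of "f n"] by simp
    qed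
    then show "\<forall>\<^sub>F n in sequentially. real n * (f n - 1) * inverse (f n) \<le> real n * ln (f n)"
      unfolding mult.assoc by (intro always_eventually allI mult_left_mono) auto
  qed
  then have "(\<lambda>n. exp (real n * ln (f n))) \<longlonglongrightarrow> exp u" by (rule tendsto_exp)
  then show ?thesis using pos by (simp add: exp_of_nat_mult)
qed

text \<open>In the average of the four exponents the linear terms cancel, and so do the mixed
  products in their squares. Thus the two magnetisations and the overlap behave like independent
  Gaussians in the limit.\<close>

lemma pair_kernel_limit:
  "(\<lambda>n. pair_kernel (s / sqrt (real n)) (t / sqrt (real n)) (z / sqrt (real n)) ^ n) \<longlonglongrightarrow> exp ((s\<^sup>2 + t\<^sup>2 + z\<^sup>2) / 2)"
proof (rule power_exp_limit[OF _ pair_kernel_pos])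
  let ?h = "\<lambda>y n. real n * (exp (y / sqrt (real n)) - 1 - y / sqrt (real n))"
  have "(\<lambda>n. (?h (s + t + z) n + ?h (s - t - z) n + ?h (- s + t - z) n + ?h (- s - t + z) n) / 4) \<longlonglongrightarrow>
     ((s + t + z)\<^sup>2 / 2 + (s - t - z)\<^sup>2 / 2 + (- s + t - z)\<^sup>2 / 2 + (- s - t + z)\<^sup>2 / 2) / 4"
    by (intro tendsto_intros exp_scaled_limit) auto
  moreover have "((s + t + z)\<^sup>2 / 2 + (s - t - z)\<^sup>2 / 2 + (- s + t - z)\<^sup>2 / 2 + (- s - t + z)\<^sup>2 / 2) / 4 = (s\<^sup>2 + t\<^sup>2 + z\<^sup>2) / 2"
    by (simp add: power2_eq_square algebra_simps add_divide_distrib diff_divide_distrib)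
  moreover have "(?h (s + t + z) n + ?h (s - t - z) n + ?h (- s + t - z) n + ?h (- s - t + z) n) / 4 =
     real n * (pair_kernel (s / sqrt n) (t / sqrt n) (z / sqrt n) - 1)" for n
    unfolding pair_kernel_def by (simp add: add_divide_distrib diff_divide_distrib algebra_simps)
  ultimately show "(\<lambda>n. real n * (pair_kernel (s / sqrt (real n)) (t / sqrt (real n)) (z / sqrt (real n)) - 1)) \<longlonglongrightarrow> (s\<^sup>2 + t\<^sup>2 + z\<^sup>2) / 2"
    by (simp only:)
qed

section \<open>First and second moments in an external field\<close>

definition spin_weight :: "real \<Rightarrow> nat \<Rightarrow> (nat \<Rightarrow> real) \<Rightarrow> (nat \<times> nat \<Rightarrow> real) \<Rightarrow> real" where
  "spin_weight lam n \<sigma> x = exp (spin_field lam n \<sigma> x - lam\<^sup>2 * (real n - 1) / 4)"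

lemma zfield_eq: "zfield lam s n x = 1 / 2 ^ n * (\<Sum>\<sigma>\<in>spins n. exp (s / sqrt n * (\<Sum>i=1..n. \<sigma> i)) * spin_weight lam n \<sigma> x)"
  by (simp add: zfield_def spin_weight_def)

lemma spin_weight_pos: "spin_weight lam n \<sigma> x > 0"
  by (simp add: spin_weight_def)

lemma spin_weight_measurable: "spin_weight lam n \<sigma> \<in> borel_measurable (gauss_space (idx n))"
  unfolding spin_weight_def[abs_def] spin_field_def
  by (intro borel_measurable_exp borel_measurable_diff linear_measurable borel_measurable_const measurable_compose[OF _ borel_measurable_exp])

lemma
  assumes n: "n \<ge> 1" and st: "\<sigma> \<in> spins n" "\<tau> \<in> spins n"
  shows integrable_spin_weight_pair: "integrable (gauss_space (idx n)) (\<lambda>x. spin_weight lam n \<sigma> x * spin_weight lam n \<tau> x)"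
    and integral_spin_weight_pair: "(\<integral>x. spin_weight lam n \<sigma> x * spin_weight lam n \<tau> x \<partial>gauss_space (idx n))
      = exp (- lam\<^sup>2 / 2) * exp ((lam * (\<Sum>i=1..n. \<sigma> i * \<tau> i) / sqrt n)\<^sup>2 / 2)"
proof -
  let ?\<kappa> = "\<lambda>e. spin_shift (lam / sqrt n) \<sigma> e + spin_shift (lam / sqrt n) \<tau> e"
  have eq: "spin_weight lam n \<sigma> x * spin_weight lam n \<tau> x = exp (- lam\<^sup>2 * (real n - 1) / 2) * exp (\<Sum>e\<in>idx n. ?\<kappa> e * x e)" for x
    by (simp add: spin_weight_def spin_field_def exp_add[symmetric] sum.distrib distrib_right)
  show "integrable (gauss_space (idx n)) (\<lambda>x. spin_weight lam n \<sigma> x * spin_weight lam n \<tau> x)"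
    unfolding eq by (intro integrable_mult_right integrable_exp_linear finite_idx)
  show "(\<integral>x. spin_weight lam n \<sigma> x * spin_weight lam n \<tau> x \<partial>gauss_space (idx n))
      = exp (- lam\<^sup>2 / 2) * exp ((lam * (\<Sum>i=1..n. \<sigma> i * \<tau> i) / sqrt n)\<^sup>2 / 2)"
    unfolding eq integral_mult_right_zero integral_exp_linear[OF finite_idx] spin_shift_pair_sum[OF assms]
    using n by (simp add: exp_add[symmetric] power_divide power_mult_distrib field_simps)
qed

text \<open>The constant in \<open>spin_weight\<close> is half the squared length of the drift, so
  each weight is a probability density, namely the Cameron--Martin density of the shift by
  \<open>spin_shift\<close>.\<close>

lemma
  assumes n: "n \<ge> 1" and s: "\<sigma> \<in> spins n"
  shows integrable_spin_weight: "integrable (gauss_space (idx n)) (spin_weight lam n \<sigma>)"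
    and integral_spin_weight: "(\<integral>x. spin_weight lam n \<sigma> x \<partial>gauss_space (idx n)) = 1"
proof -
  have eq: "spin_weight lam n \<sigma> x = exp (- lam\<^sup>2 * (real n - 1) / 4) * exp (\<Sum>e\<in>idx n. spin_shift (lam / sqrt n) \<sigma> e * x e)" for x
    by (simp add: spin_weight_def spin_field_def exp_add[symmetric])
  show "integrable (gauss_space (idx n)) (spin_weight lam n \<sigma>)"
    unfolding eq[abs_def] by (intro integrable_mult_right integrable_exp_linear finite_idx)
  show "(\<integral>x. spin_weight lam n \<sigma> x \<partial>gauss_space (idx n)) = 1"
    unfolding eq integral_mult_right_zero integral_exp_linear[OF finite_idx] spin_shift_sum_square[OF assms]
    by (simp add: exp_add[symmetric])
qed

lemma pair_kernel_power:
  "pair_kernel a b z ^ n = 1 / 4 ^ n * (\<Sum>\<sigma>\<in>spins n. \<Sum>\<tau>\<in>spins n.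
     exp (a * (\<Sum>i=1..n. \<sigma> i)) * exp (b * (\<Sum>i=1..n. \<tau> i)) * exp (z * (\<Sum>i=1..n. \<sigma> i * \<tau> i)))"
proof -
  let ?F = "\<lambda>u v. exp (a * u + b * v + z * (u * v))"
  have "4 * pair_kernel a b z = (\<Sum>u\<in>{-1,1}. \<Sum>v\<in>{-1,1}. ?F u v)"
    by (simp add: pair_kernel_def algebra_simps)
  then have "(4 * pair_kernel a b z) ^ n = (\<Prod>i\<in>{1..n}. \<Sum>u\<in>{-1,1}. \<Sum>v\<in>{-1,1}. ?F u v)"
    by simp
  also have "\<dots> = (\<Sum>\<sigma>\<in>spins n. \<Prod>i\<in>{1..n}. \<Sum>v\<in>{-1,1}. ?F (\<sigma> i) v)"
    unfolding spins_def by (rule prod_sum_PiE) auto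
  also have "\<dots> = (\<Sum>\<sigma>\<in>spins n. \<Sum>\<tau>\<in>spins n. \<Prod>i\<in>{1..n}. ?F (\<sigma> i) (\<tau> i))"
    unfolding spins_def by (rule sum.cong[OF refl], rule prod_sum_PiE) auto
  also have "\<dots> = (\<Sum>\<sigma>\<in>spins n. \<Sum>\<tau>\<in>spins n.
     exp (a * (\<Sum>i=1..n. \<sigma> i)) * exp (b * (\<Sum>i=1..n. \<tau> i)) * exp (z * (\<Sum>i=1..n. \<sigma> i * \<tau> i)))"
    by (simp add: exp_sum prod.distrib sum_distrib_left exp_add)
  finally show ?thesis by (simp add: power_mult_distrib field_simps)
qed

lemma zfield_measurable: "zfield lam s n \<in> borel_measurable (gauss_space (idx n))"
  unfolding zfield_eq[abs_def]
  by (intro borel_measurable_times borel_measurable_sum borel_measurable_const spin_weight_measurable)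

lemma zfield_pos: "zfield lam s n x > 0"
proof -
  have "spins n \<noteq> {}" using card_spins[of n] by auto
  then show ?thesis unfolding zfield_eq
    by (intro mult_pos_pos sum_pos spin_weight_pos) auto
qed

lemma zfield_integrable: "n \<ge> 1 \<Longrightarrow> integrable (gauss_space (idx n)) (zfield lam s n)"
  unfolding zfield_eq[abs_def]
  by (intro integrable_mult_right Bochner_Integration.integrable_sum integrable_spin_weight)

lemma zfield_expectation:
  assumes n: "n \<ge> 1"
  shows "(\<integral>x. zfield lam s n x \<partial>gauss_space (idx n)) = pair_kernel (s / sqrt n) 0 0 ^ n"
proof -
  have "(\<integral>x. zfield lam s n x \<partial>gauss_space (idx n)) = 1 / 2 ^ n * (\<Sum>\<sigma>\<in>spins n. exp (s / sqrt n * (\<Sum>i=1..n. \<sigma> i)))"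
    unfolding zfield_eq integral_mult_right_zero using n
    by (subst Bochner_Integration.integral_sum) (auto simp: integrable_spin_weight integral_spin_weight cong: sum.cong)
  moreover have "pair_kernel (s / sqrt n) 0 0 ^ n = 1 / 4 ^ n * (2 ^ n * (\<Sum>\<sigma>\<in>spins n. exp (s / sqrt n * (\<Sum>i=1..n. \<sigma> i))))"
    unfolding pair_kernel_power by (simp add: card_spins sum_distrib_left)
  moreover have "(4::real) ^ n = 2 ^ n * 2 ^ n" by (simp add: power_mult_distrib[symmetric])
  ultimately show ?thesis by simp
qed

lemma pair_kernel_power_le:
  assumes n: "n \<ge> 1"
  shows "pair_kernel (s / sqrt n) (t / sqrt n) (z / sqrt n) ^ n \<le> exp ((\<bar>s\<bar> + \<bar>t\<bar>)\<^sup>2 / 2) * exp (z\<^sup>2 / 2)"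
proof -
  have "pair_kernel (s / sqrt n) (t / sqrt n) (z / sqrt n) ^ n
     \<le> (exp ((\<bar>s / sqrt n\<bar> + \<bar>t / sqrt n\<bar>)\<^sup>2 / 2) * exp ((z / sqrt n)\<^sup>2 / 2)) ^ n"
    by (intro power_mono pair_kernel_le less_imp_le pair_kernel_pos)
  also have "\<dots> = exp (real n * ((\<bar>s / sqrt n\<bar> + \<bar>t / sqrt n\<bar>)\<^sup>2 / 2)) * exp (real n * ((z / sqrt n)\<^sup>2 / 2))"
    by (simp only: power_mult_distrib exp_of_nat_mult)
  also have "(\<bar>s / sqrt n\<bar> + \<bar>t / sqrt n\<bar>)\<^sup>2 = (\<bar>s\<bar> + \<bar>t\<bar>)\<^sup>2 / n"
    by (simp add: add_divide_distrib[symmetric] power_divide)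
  finally show ?thesis using n by (simp add: power_divide)
qed

lemma zfield_expectation_le:
  assumes n: "n \<ge> 1"
  shows "(\<integral>x. zfield lam s n x \<partial>gauss_space (idx n)) \<le> exp (s\<^sup>2 / 2)"
  using pair_kernel_power_le[OF n, of s 0 0] by (simp add: zfield_expectation[OF n])

lemma zfield_pair_integrable:
  assumes n: "n \<ge> 1"
  shows "integrable (gauss_space (idx n)) (\<lambda>x. zfield lam s n x * zfield lam t n x)"
proof -
  have "(\<lambda>x. zfield lam s n x * zfield lam t n x) = (\<lambda>x. (1 / 2 ^ n * (1 / 2 ^ n)) * (\<Sum>\<sigma>\<in>spins n. \<Sum>\<tau>\<in>spins n.
     (exp (s / sqrt n * (\<Sum>i=1..n. \<sigma> i)) * exp (t / sqrt n * (\<Sum>i=1..n. \<tau> i))) * (spin_weight lam n \<sigma> x * spin_weight lam n \<tau> x)))"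
    by (rule ext) (simp add: zfield_eq sum_product mult_ac)
  moreover have "integrable (gauss_space (idx n)) \<dots>"
    by (intro integrable_mult_right Bochner_Integration.integrable_sum integrable_spin_weight_pair n)
  ultimately show ?thesis by simp
qed

text \<open>The expected product of two weights is the exponential of a squared overlap. Writing it
  as an average over an auxiliary normal variable \<open>g\<close> makes the exponent linear in the
  overlap, and the sites decouple into \<open>pair_kernel\<close>.\<close>

lemma zfield_second_moment:
  assumes n: "n \<ge> 1"
  shows "(\<integral>x. zfield lam s n x * zfield lam t n x \<partial>gauss_space (idx n)) =
    exp (- lam\<^sup>2 / 2) * (\<integral>g. pair_kernel (s / sqrt n) (t / sqrt n) (lam * g / sqrt n) ^ n \<partial>std_normal_distribution)"
proof -
  let ?e = "\<lambda>\<sigma> \<tau>. exp (s / sqrt n * (\<Sum>i=1..n. \<sigma> i)) * exp (t / sqrt n * (\<Sum>i=1..n. \<tau> i))"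
  let ?R = "\<lambda>\<sigma> \<tau>. \<Sum>i=1..n. \<sigma> i * \<tau> i"
  have 4: "(1 / 2 ^ n * (1 / 2 ^ n) :: real) = 1 / 4 ^ n" by (simp add: power_mult_distrib[symmetric])
  have "(\<lambda>x. zfield lam s n x * zfield lam t n x) = (\<lambda>x. (1 / 2 ^ n * (1 / 2 ^ n)) * (\<Sum>\<sigma>\<in>spins n. \<Sum>\<tau>\<in>spins n.
     ?e \<sigma> \<tau> * (spin_weight lam n \<sigma> x * spin_weight lam n \<tau> x)))"
    by (rule ext) (simp add: zfield_eq sum_product mult_ac)
  then have "(\<integral>x. zfield lam s n x * zfield lam t n x \<partial>gauss_space (idx n)) =
     1 / 4 ^ n * (\<integral>x. (\<Sum>\<sigma>\<in>spins n. \<Sum>\<tau>\<in>spins n. ?e \<sigma> \<tau> * (spin_weight lam n \<sigma> x * spin_weight lam n \<tau> x)) \<partial>gauss_space (idx n))"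
    unfolding 4 by simp
  also have "(\<integral>x. (\<Sum>\<sigma>\<in>spins n. \<Sum>\<tau>\<in>spins n. ?e \<sigma> \<tau> * (spin_weight lam n \<sigma> x * spin_weight lam n \<tau> x)) \<partial>gauss_space (idx n)) =
     (\<Sum>\<sigma>\<in>spins n. \<Sum>\<tau>\<in>spins n. ?e \<sigma> \<tau> * (exp (- lam\<^sup>2 / 2) * exp ((lam * ?R \<sigma> \<tau> / sqrt n)\<^sup>2 / 2)))"
    using n by (simp add: Bochner_Integration.integral_sum Bochner_Integration.integrable_sum integrable_spin_weight_pair integral_spin_weight_pair cong: sum.cong)
  also have "\<dots> = exp (- lam\<^sup>2 / 2) * (\<Sum>\<sigma>\<in>spins n. \<Sum>\<tau>\<in>spins n. ?e \<sigma> \<tau> * exp ((lam * ?R \<sigma> \<tau> / sqrt n)\<^sup>2 / 2))"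
    by (simp add: sum_distrib_left mult_ac)
  also have "(\<Sum>\<sigma>\<in>spins n. \<Sum>\<tau>\<in>spins n. ?e \<sigma> \<tau> * exp ((lam * ?R \<sigma> \<tau> / sqrt n)\<^sup>2 / 2)) =
     (\<integral>g. (\<Sum>\<sigma>\<in>spins n. \<Sum>\<tau>\<in>spins n. ?e \<sigma> \<tau> * exp ((lam * ?R \<sigma> \<tau> / sqrt n) * g)) \<partial>std_normal_distribution)"
    by (simp only: Bochner_Integration.integral_sum Bochner_Integration.integrable_sum integrable_exp_std_normal
        integrable_mult_right integral_mult_right_zero integral_exp_std_normal cong: sum.cong)
  also have "1 / 4 ^ n * (exp (- lam\<^sup>2 / 2) * \<dots>) = exp (- lam\<^sup>2 / 2) * (\<integral>g. 1 / 4 ^ n * (\<Sum>\<sigma>\<in>spins n. \<Sum>\<tau>\<in>spins n. ?e \<sigma> \<tau> * exp ((lam * ?R \<sigma> \<tau> / sqrt n) * g)) \<partial>std_normal_distribution)"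
    unfolding integral_mult_right_zero by simp
  also have "(\<lambda>g. 1 / 4 ^ n * (\<Sum>\<sigma>\<in>spins n. \<Sum>\<tau>\<in>spins n. ?e \<sigma> \<tau> * exp ((lam * ?R \<sigma> \<tau> / sqrt n) * g))) =
     (\<lambda>g. pair_kernel (s / sqrt n) (t / sqrt n) (lam * g / sqrt n) ^ n)"
    unfolding pair_kernel_power by (rule ext) (simp add: mult_ac)
  finally show ?thesis .
qed

text \<open>The limit of E Z^2: exp(-lam^2/2) times the mean of exp(lam^2 g^2/2) for a standard
  normal \<open>g\<close>.\<close>

definition overlap_limit :: "real \<Rightarrow> real" where
  "overlap_limit lam = exp (- lam\<^sup>2 / 2) / sqrt (1 - lam\<^sup>2)"

lemma zfield_second_moment_tendsto:
  assumes lam: "0 \<le> lam" "lam < 1"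
  shows "(\<lambda>n. \<integral>x. zfield lam s n x * zfield lam t n x \<partial>gauss_space (idx n)) \<longlonglongrightarrow> overlap_limit lam * exp ((s\<^sup>2 + t\<^sup>2) / 2)"
proof -
  have l1: "lam\<^sup>2 < 1" using lam by (simp add: power_less_one_iff)
  let ?f = "\<lambda>n g. pair_kernel (s / sqrt (real n)) (t / sqrt (real n)) (lam * g / sqrt (real n)) ^ n"
  \<comment> \<open>The dominating bound \<open>pair_kernel_power_le\<close> assumes
    \<open>n \<ge> 1\<close>, hence the sequence shifted by one.\<close>
  have "(\<lambda>n. \<integral>g. ?f (Suc n) g \<partial>std_normal_distribution) \<longlonglongrightarrow> (\<integral>g. exp ((s\<^sup>2 + t\<^sup>2 + (lam * g)\<^sup>2) / 2) \<partial>std_normal_distribution)"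
  proof (rule integral_dominated_convergence[where w = "\<lambda>g. exp ((\<bar>s\<bar> + \<bar>t\<bar>)\<^sup>2 / 2) * exp (lam\<^sup>2 * g\<^sup>2 / 2)"])
    show "integrable std_normal_distribution (\<lambda>g. exp ((\<bar>s\<bar> + \<bar>t\<bar>)\<^sup>2 / 2) * exp (lam\<^sup>2 * g\<^sup>2 / 2))"
      by (intro integrable_mult_right integrable_exp_square_std_normal l1)
    show "AE g in std_normal_distribution. (\<lambda>n. ?f (Suc n) g) \<longlonglongrightarrow> exp ((s\<^sup>2 + t\<^sup>2 + (lam * g)\<^sup>2) / 2)"
      by (intro always_eventually allI LIMSEQ_Suc pair_kernel_limit)
    fix n
    show "AE g in std_normal_distribution. norm (?f (Suc n) g) \<le> exp ((\<bar>s\<bar> + \<bar>t\<bar>)\<^sup>2 / 2) * exp (lam\<^sup>2 * g\<^sup>2 / 2)"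
    proof (intro always_eventually allI)
      fix g
      show "norm (?f (Suc n) g) \<le> exp ((\<bar>s\<bar> + \<bar>t\<bar>)\<^sup>2 / 2) * exp (lam\<^sup>2 * g\<^sup>2 / 2)"
        using pair_kernel_power_le[of "Suc n" s t "lam * g"] pair_kernel_pos
        by (simp add: power_mult_distrib abs_of_pos del: of_nat_Suc power_Suc)
    qed
  qed (simp_all add: pair_kernel_def)
  also have "(\<integral>g. exp ((s\<^sup>2 + t\<^sup>2 + (lam * g)\<^sup>2) / 2) \<partial>std_normal_distribution)
     = (\<integral>g. exp ((s\<^sup>2 + t\<^sup>2) / 2) * exp (lam\<^sup>2 * g\<^sup>2 / 2) \<partial>std_normal_distribution)"
    by (simp add: exp_add[symmetric] add_divide_distrib power_mult_distrib)
  also have "\<dots> = exp ((s\<^sup>2 + t\<^sup>2) / 2) * (1 / sqrt (1 - lam\<^sup>2))"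
    unfolding integral_mult_right_zero integral_exp_square_std_normal[OF l1] ..
  finally have "(\<lambda>n. \<integral>g. ?f n g \<partial>std_normal_distribution) \<longlonglongrightarrow> exp ((s\<^sup>2 + t\<^sup>2) / 2) * (1 / sqrt (1 - lam\<^sup>2))"
    by (rule LIMSEQ_imp_Suc)
  then have "(\<lambda>n. exp (- lam\<^sup>2 / 2) * (\<integral>g. ?f n g \<partial>std_normal_distribution)) \<longlonglongrightarrow> exp (- lam\<^sup>2 / 2) * (exp ((s\<^sup>2 + t\<^sup>2) / 2) * (1 / sqrt (1 - lam\<^sup>2)))"
    by (rule tendsto_mult[OF tendsto_const])
  moreover have "\<forall>\<^sub>F n in sequentially. exp (- lam\<^sup>2 / 2) * (\<integral>g. ?f n g \<partial>std_normal_distribution) =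
      (\<integral>x. zfield lam s n x * zfield lam t n x \<partial>gauss_space (idx n))"
    using eventually_ge_at_top[of 1] by eventually_elim (simp add: zfield_second_moment)
  ultimately have "(\<lambda>n. \<integral>x. zfield lam s n x * zfield lam t n x \<partial>gauss_space (idx n)) \<longlonglongrightarrow> exp (- lam\<^sup>2 / 2) * (exp ((s\<^sup>2 + t\<^sup>2) / 2) * (1 / sqrt (1 - lam\<^sup>2)))"
    by (rule Lim_transform_eventually)
  then show ?thesis by (simp add: overlap_limit_def mult_ac)
qed

text \<open>The limiting second moments C exp(s^2/2) exp(t^2/2) form a kernel of rank one, so the
  three terms of the expanded square of the difference cancel in the limit.\<close>

lemma zfield_field_tendsto:
  assumes lam: "0 \<le> lam" "lam < 1"
  shows "(\<lambda>n. \<integral>x. \<bar>zfield lam s n x - exp (s\<^sup>2 / 2) * zfield lam 0 n x\<bar> \<partial>gauss_space (idx n)) \<longlonglongrightarrow> 0"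
proof -
  let ?E = "\<lambda>s t n. \<integral>x. zfield lam s n x * zfield lam t n x \<partial>gauss_space (idx n)"
  let ?a = "exp (s\<^sup>2 / 2)"
  have "(\<lambda>n. ?E s s n - 2 * ?a * ?E s 0 n + ?a\<^sup>2 * ?E 0 0 n) \<longlonglongrightarrow>
     overlap_limit lam * exp ((s\<^sup>2 + s\<^sup>2) / 2) - 2 * ?a * (overlap_limit lam * exp ((s\<^sup>2 + 0\<^sup>2) / 2)) + ?a\<^sup>2 * (overlap_limit lam * exp ((0\<^sup>2 + 0\<^sup>2) / 2))"
    by (intro tendsto_intros zfield_second_moment_tendsto lam)
  also have "overlap_limit lam * exp ((s\<^sup>2 + s\<^sup>2) / 2) - 2 * ?a * (overlap_limit lam * exp ((s\<^sup>2 + 0\<^sup>2) / 2)) + ?a\<^sup>2 * (overlap_limit lam * exp ((0\<^sup>2 + 0\<^sup>2) / 2)) = 0"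
    by (simp add: power2_eq_square exp_add[symmetric])
  finally have lim: "(\<lambda>n. sqrt (?E s s n - 2 * ?a * ?E s 0 n + ?a\<^sup>2 * ?E 0 0 n)) \<longlonglongrightarrow> 0"
    using tendsto_real_sqrt by fastforce
  show ?thesis
  proof (rule tendsto_sandwich[OF _ _ tendsto_const lim])
    show "\<forall>\<^sub>F n in sequentially. (\<integral>x. \<bar>zfield lam s n x - ?a * zfield lam 0 n x\<bar> \<partial>gauss_space (idx n)) \<le> sqrt (?E s s n - 2 * ?a * ?E s 0 n + ?a\<^sup>2 * ?E 0 0 n)"
      using eventually_ge_at_top[of 1]
    proof eventually_elim
      case (elim n)
      interpret prob_space "gauss_space (idx n)" by (rule prob_space_gauss_space)
      note i = zfield_pair_integrable[OF elim]
      have sq: "(zfield lam s n x - ?a * zfield lam 0 n x)\<^sup>2 = zfield lam s n x * zfield lam s n x - 2 * ?a * (zfield lam s n x * zfield lam 0 n x) + ?a\<^sup>2 * (zfield lam 0 n x * zfield lam 0 n x)" for x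
        by (simp add: power2_eq_square algebra_simps)
      have "integrable (gauss_space (idx n)) (\<lambda>x. (zfield lam s n x - ?a * zfield lam 0 n x)\<^sup>2)"
        unfolding sq by (intro Bochner_Integration.integrable_add Bochner_Integration.integrable_diff integrable_mult_right i)
      then have "expectation (\<lambda>x. \<bar>zfield lam s n x - ?a * zfield lam 0 n x\<bar>) \<le> sqrt (expectation (\<lambda>x. (zfield lam s n x - ?a * zfield lam 0 n x)\<^sup>2))"
        by (rule expectation_abs_le_sqrt(2)) (intro borel_measurable_diff borel_measurable_times borel_measurable_const zfield_measurable)
      also have "expectation (\<lambda>x. (zfield lam s n x - ?a * zfield lam 0 n x)\<^sup>2) = ?E s s n - 2 * ?a * ?E s 0 n + ?a\<^sup>2 * ?E 0 0 n"
        unfolding sq using i[of lam s s] i[of lam s 0] i[of lam 0 0] by simp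
      finally show ?case .
    qed
  qed simp
qed

section \<open>Approximation by signed cycles\<close>

text \<open>\<open>Z\<close> with the Curie--Weiss factor included; the model has b = 2 beta J,
  since beta multiplies the quadratic form J S^2/n.\<close>

definition zcw :: "real \<Rightarrow> real \<Rightarrow> nat \<Rightarrow> (nat \<times> nat \<Rightarrow> real) \<Rightarrow> real" where
  "zcw lam b n x = 1 / 2 ^ n * (\<Sum>\<sigma>\<in>spins n. exp (b * (\<Sum>i=1..n. \<sigma> i)\<^sup>2 / (2 * n)) * spin_weight lam n \<sigma> x)"

lemma zcw_measurable: "zcw lam b n \<in> borel_measurable (gauss_space (idx n))"
  unfolding zcw_def[abs_def]
  by (intro borel_measurable_times borel_measurable_sum borel_measurable_const spin_weight_measurable)

lemma zcw_pos: "zcw lam b n x > 0"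
proof -
  have "spins n \<noteq> {}" using card_spins[of n] by auto
  then show ?thesis unfolding zcw_def
    by (intro mult_pos_pos sum_pos spin_weight_pos) auto
qed

lemma zcw_integrable: "n \<ge> 1 \<Longrightarrow> integrable (gauss_space (idx n)) (zcw lam b n)"
  unfolding zcw_def[abs_def]
  by (intro integrable_mult_right Bochner_Integration.integrable_sum integrable_spin_weight)

lemma
  assumes n: "n \<ge> 1" and b: "b \<ge> 0"
  shows zfield_mixture_integrable: "integrable std_normal_distribution (\<lambda>g. zfield lam (sqrt b * g) n x)"
    and zcw_mixture: "(\<integral>g. zfield lam (sqrt b * g) n x \<partial>std_normal_distribution) = zcw lam b n x"
proof -
  let ?S = "\<lambda>\<sigma>::nat \<Rightarrow> real. \<Sum>i=1..n. \<sigma> i"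
  have eq: "zfield lam (sqrt b * g) n x = 1 / 2 ^ n * (\<Sum>\<sigma>\<in>spins n. spin_weight lam n \<sigma> x * exp ((sqrt b / sqrt n * ?S \<sigma>) * g))" for g
    unfolding zfield_eq by (simp add: mult_ac)
  show "integrable std_normal_distribution (\<lambda>g. zfield lam (sqrt b * g) n x)"
    unfolding eq by (intro integrable_mult_right Bochner_Integration.integrable_sum integrable_exp_std_normal)
  have "(\<integral>g. zfield lam (sqrt b * g) n x \<partial>std_normal_distribution) =
     1 / 2 ^ n * (\<Sum>\<sigma>\<in>spins n. spin_weight lam n \<sigma> x * exp ((sqrt b / sqrt n * ?S \<sigma>)\<^sup>2 / 2))"
    unfolding eq
    by (simp only: Bochner_Integration.integral_sum integrable_exp_std_normal integrable_mult_right
        integral_mult_right_zero integral_exp_std_normal cong: sum.cong)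
  moreover have "(sqrt b / sqrt n * ?S \<sigma>)\<^sup>2 / 2 = b * (?S \<sigma>)\<^sup>2 / (2 * n)" for \<sigma>
    using b by (simp add: power_mult_distrib power_divide)
  ultimately show "(\<integral>g. zfield lam (sqrt b * g) n x \<partial>std_normal_distribution) = zcw lam b n x"
    by (simp add: zcw_def mult_ac)
qed

text \<open>Averaging the external field over a Gaussian (Hubbard--Stratonovich) linearises the
  Curie--Weiss term; the first-moment comparison avoids the second moment of \<open>zcw\<close>, which
  is not bounded in the whole parameter range.\<close>

lemma zcw_tendsto:
  assumes lam: "0 \<le> lam" "lam < 1" and b: "0 \<le> b" "b < 1"
  shows "(\<lambda>n. \<integral>x. \<bar>zcw lam b n x - zfield lam 0 n x / sqrt (1 - b)\<bar> \<partial>gauss_space (idx n)) \<longlonglongrightarrow> 0"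
proof -
  let ?N = std_normal_distribution
  \<comment> \<open>For a fixed value \<open>g\<close> of the mixing variable, this is the
    difference controlled by \<open>zfield_field_tendsto\<close>; \<open>h\<close> is its L^1
    norm.\<close>
  define f where "f = (\<lambda>n g x. zfield lam (sqrt b * g) n x - exp ((sqrt b * g)\<^sup>2 / 2) * zfield lam 0 n x)"
  define h where "h = (\<lambda>n g. \<integral>x. \<bar>f n g x\<bar> \<partial>gauss_space (idx n))"
  have e2: "exp ((sqrt b * g)\<^sup>2 / 2) = exp (b * g\<^sup>2 / 2)" for g
    using b by (simp add: power_mult_distrib)
  have fm: "(\<lambda>(g, x). f n g x) \<in> borel_measurable (?N \<Otimes>\<^sub>M gauss_space (idx n))" for n
  proof -
    have [measurable]: "spin_weight lam n \<sigma> \<in> borel_measurable (gauss_space (idx n))" for \<sigma>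
      by (rule spin_weight_measurable)
    show ?thesis unfolding f_def zfield_eq by measurable
  qed
  have fi: "integrable (gauss_space (idx n)) (f n g)" if "n \<ge> 1" for n g
    unfolding f_def[abs_def] by (intro Bochner_Integration.integrable_diff integrable_mult_right zfield_integrable that)
  \<comment> \<open>Only first moments are used here, and the bound is integrable in
    \<open>g\<close> because \<open>b < 1\<close>.\<close>
  have hle: "h n g \<le> 2 * exp (b * g\<^sup>2 / 2)" if n: "n \<ge> 1" for n g
  proof -
    have "h n g \<le> (\<integral>x. zfield lam (sqrt b * g) n x + exp ((sqrt b * g)\<^sup>2 / 2) * zfield lam 0 n x \<partial>gauss_space (idx n))"
      unfolding h_def
    proof (rule integral_mono)
      fix x
      show "\<bar>f n g x\<bar> \<le> zfield lam (sqrt b * g) n x + exp ((sqrt b * g)\<^sup>2 / 2) * zfield lam 0 n x"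
        unfolding f_def using zfield_pos[of lam "sqrt b * g" n x] zfield_pos[of lam 0 n x]
        by (intro order_trans[OF abs_triangle_ineq4]) (simp add: abs_mult)
    qed (intro integrable_abs fi n Bochner_Integration.integrable_add integrable_mult_right zfield_integrable)+
    also have "\<dots> = (\<integral>x. zfield lam (sqrt b * g) n x \<partial>gauss_space (idx n)) + exp ((sqrt b * g)\<^sup>2 / 2) * (\<integral>x. zfield lam 0 n x \<partial>gauss_space (idx n))"
      by (simp add: zfield_integrable[OF n])
    also have "\<dots> \<le> exp ((sqrt b * g)\<^sup>2 / 2) + exp ((sqrt b * g)\<^sup>2 / 2) * exp (0\<^sup>2 / 2)"
      by (intro add_mono mult_left_mono zfield_expectation_le n) auto
    finally show ?thesis unfolding e2 by simp
  qed
  have hm: "h n \<in> borel_measurable ?N" for n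
  proof -
    interpret sigma_finite_measure "gauss_space (idx n)"
      using prob_space_gauss_space prob_space_imp_sigma_finite by blast
    show ?thesis unfolding h_def[abs_def]
      by (rule borel_measurable_lebesgue_integral) (use fm[of n] in \<open>simp add: case_prod_unfold\<close>)
  qed
  have hi: "integrable ?N (\<lambda>g. 2 * exp (b * g\<^sup>2 / 2))"
    by (intro integrable_mult_right integrable_exp_square_std_normal b)
  have hn: "0 \<le> h n g" for n g by (simp add: h_def)
  have hint: "integrable ?N (h n)" if n: "n \<ge> 1" for n
    by (rule Bochner_Integration.integrable_bound[OF hi hm]) (use hle[OF n] hn in \<open>auto intro!: order_trans[OF hle[OF n]]\<close>)
  have lim: "(\<lambda>n. \<integral>g. h (Suc n) g \<partial>?N) \<longlonglongrightarrow> (\<integral>g. 0 \<partial>?N)"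
  proof (rule integral_dominated_convergence[OF _ _ hi])
    show "AE g in ?N. (\<lambda>n. h (Suc n) g) \<longlonglongrightarrow> 0"
      unfolding h_def f_def by (intro always_eventually allI LIMSEQ_Suc zfield_field_tendsto lam)
    fix n
    show "AE g in ?N. norm (h (Suc n) g) \<le> 2 * exp (b * g\<^sup>2 / 2)"
      using hle[of "Suc n"] hn by (intro always_eventually allI) simp
    show "h (Suc n) \<in> borel_measurable ?N" by (rule hm)
  qed simp
  then have lim: "(\<lambda>n. \<integral>g. h n g \<partial>?N) \<longlonglongrightarrow> 0"
    using LIMSEQ_imp_Suc[of "\<lambda>n. \<integral>g. h n g \<partial>?N" 0] by simp
  show ?thesis
  proof (rule tendsto_sandwich[OF _ _ tendsto_const lim])
    show "\<forall>\<^sub>F n in sequentially. (\<integral>x. \<bar>zcw lam b n x - zfield lam 0 n x / sqrt (1 - b)\<bar> \<partial>gauss_space (idx n)) \<le> (\<integral>g. h n g \<partial>?N)"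
      using eventually_ge_at_top[of 1]
    proof eventually_elim
      case n: (elim n)
      let ?M = "gauss_space (idx n)"
      interpret N: prob_space ?N by (rule prob_space_std_normal)
      interpret M: prob_space ?M by (rule prob_space_gauss_space)
      interpret P: pair_sigma_finite ?N ?M ..
      \<comment> \<open>Integrating exp(b g^2/2) over \<open>g\<close> produces the factor 1/sqrt(1
        - b), so the error for \<open>zcw\<close> is the \<open>g\<close>-average of the errors at
        fixed field.\<close>
      have mix: "zcw lam b n x - zfield lam 0 n x / sqrt (1 - b) = (\<integral>g. f n g x \<partial>?N)" for x
        unfolding f_def e2
        using zfield_mixture_integrable[OF n b(1), of lam x] zcw_mixture[OF n b(1), of lam x]
          integrable_exp_square_std_normal[OF b(2)] integral_exp_square_std_normal[OF b(2)]
        by (simp_all)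
      have pint: "integrable (?N \<Otimes>\<^sub>M ?M) (\<lambda>(g, x). \<bar>f n g x\<bar>)"
      proof (rule P.Fubini_integrable)
        show "(\<lambda>(g, x). \<bar>f n g x\<bar>) \<in> borel_measurable (?N \<Otimes>\<^sub>M ?M)"
          using borel_measurable_abs[OF fm[of n]] by (simp add: case_prod_unfold)
        show "integrable ?N (\<lambda>g. \<integral>x. norm (case (g, x) of (g, x) \<Rightarrow> \<bar>f n g x\<bar>) \<partial>?M)"
          using hint[OF n] by (simp add: h_def)
        show "AE g in ?N. integrable ?M (\<lambda>x. case (g, x) of (g, x) \<Rightarrow> \<bar>f n g x\<bar>)"
          using fi[OF n] by simp
      qed
      have "(\<integral>x. \<bar>zcw lam b n x - zfield lam 0 n x / sqrt (1 - b)\<bar> \<partial>?M) \<le> (\<integral>x. (\<integral>g. \<bar>f n g x\<bar> \<partial>?N) \<partial>?M)"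
      proof (rule integral_mono)
        show "integrable ?M (\<lambda>x. \<bar>zcw lam b n x - zfield lam 0 n x / sqrt (1 - b)\<bar>)"
          by (intro integrable_abs Bochner_Integration.integrable_diff integrable_divide zcw_integrable zfield_integrable n)
        show "integrable ?M (\<lambda>x. \<integral>g. \<bar>f n g x\<bar> \<partial>?N)" by (rule P.integrable_snd[OF pint])
        show "\<bar>zcw lam b n x - zfield lam 0 n x / sqrt (1 - b)\<bar> \<le> (\<integral>g. \<bar>f n g x\<bar> \<partial>?N)" for x
          unfolding mix by (rule integral_abs_bound)
      qed
      also have "\<dots> = (\<integral>g. h n g \<partial>?N)"
        unfolding h_def by (rule P.Fubini_integral[OF pint])
      finally show ?case .
    qed
  qed simp
qed

text \<open>The Gaussian law weighted by \<open>Z\<close> is an average of shifted laws, and by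
  \<open>lin_shift_tendsto\<close> every shift moves the cycle sum by the same constant up to a
  uniform L^1 error. The Lipschitz bound passes this error on to \<open>\<phi>\<close>; boundedness
  makes the weighted integrals finite.\<close>

lemma zfield_weighted_lipschitz:
  assumes lam: "0 \<le> lam" "lam \<le> 1" and a1: "a 1 = 0"
    and \<phi>: "\<And>u w. \<bar>\<phi> u - \<phi> w\<bar> \<le> K * \<bar>u - w\<bar>" "\<And>u. \<bar>\<phi> u\<bar> \<le> B"
  shows "(\<lambda>n. (\<integral>x. zfield lam 0 n x * \<phi> (lin a M n x) \<partial>gauss_space (idx n))
    - (\<integral>x. \<phi> (lin a M n x + (\<Sum>k=1..M. a k * lam ^ k)) \<partial>gauss_space (idx n))) \<longlonglongrightarrow> 0"
proof -
  let ?v = "\<Sum>k=1..M. a k * lam ^ k"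
  obtain \<epsilon> where \<epsilon>: "\<epsilon> \<longlonglongrightarrow> 0" and sh: "\<And>n s. n \<ge> 1 \<Longrightarrow> \<forall>i\<in>{1..n}. \<bar>s i\<bar> = 1 \<Longrightarrow>
    integrable (gauss_space (idx n)) (\<lambda>x. lin a M n (\<lambda>e\<in>idx n. x e + spin_shift (lam / sqrt n) s e)) \<and>
    (\<integral>x. \<bar>lin a M n (\<lambda>e\<in>idx n. x e + spin_shift (lam / sqrt n) s e) - lin a M n x - ?v\<bar> \<partial>gauss_space (idx n)) \<le> \<epsilon> n"
    using lin_shift_tendsto[of lam a M, OF lam a1] by blast
  have K0: "0 \<le> K" using \<phi>(1)[of 0 1] by (smt (verit) abs_ge_zero mult_cancel_left2)
  have cont: "continuous_on UNIV \<phi>"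
    by (rule lipschitz_on_continuous_on[of K]) (use \<phi>(1) K0 in \<open>auto simp: lipschitz_on_def dist_real_def\<close>)
  have \<phi>m[measurable]: "\<phi> \<in> borel_measurable borel" by (rule borel_measurable_continuous_onI[OF cont])
  have lim: "(\<lambda>n. K * \<epsilon> n) \<longlonglongrightarrow> 0" using tendsto_mult[OF tendsto_const[of K] \<epsilon>] by simp
  show ?thesis
  proof (rule Lim_null_comparison[OF _ lim])
    show "\<forall>\<^sub>F n in sequentially. norm ((\<integral>x. zfield lam 0 n x * \<phi> (lin a M n x) \<partial>gauss_space (idx n))
      - (\<integral>x. \<phi> (lin a M n x + ?v) \<partial>gauss_space (idx n))) \<le> K * \<epsilon> n"
      using eventually_ge_at_top[of 1]
    proof eventually_elim
      case n: (elim n)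
      let ?G = "gauss_space (idx n)"
      interpret prob_space ?G by (rule prob_space_gauss_space)
      let ?L = "lin a M n"
      have [measurable]: "?L \<in> borel_measurable ?G" by (rule gpoly_measurable[OF gpoly_lin])
      have Li: "integrable ?G ?L" by (rule gpoly_integrable[OF finite_idx gpoly_lin])
      let ?s = "\<lambda>\<sigma> x. \<lambda>e\<in>idx n. x e + spin_shift (lam / sqrt n) \<sigma> e"
      have gm: "(\<lambda>x. \<phi> (?L x)) \<in> borel_measurable ?G" by measurable
      have sw: "(\<integral>x. spin_weight lam n \<sigma> x * \<phi> (?L x) \<partial>?G) = (\<integral>x. \<phi> (?L (?s \<sigma> x)) \<partial>?G)" if s: "\<sigma> \<in> spins n" for \<sigma>
        using cameron_martin[OF finite_idx gm, of "spin_shift (lam / sqrt n) \<sigma>"] spin_shift_sum_square[OF n s, of lam]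
        by (simp add: spin_weight_def spin_field_def)
      have bi: "integrable ?G (\<lambda>x. spin_weight lam n \<sigma> x * \<phi> (?L x))" if s: "\<sigma> \<in> spins n" for \<sigma>
      proof (rule Bochner_Integration.integrable_bound)
        show "integrable ?G (\<lambda>x. B * spin_weight lam n \<sigma> x)" by (intro integrable_mult_right integrable_spin_weight n s)
        have [measurable]: "spin_weight lam n \<sigma> \<in> borel_measurable ?G" by (rule spin_weight_measurable)
        show "(\<lambda>x. spin_weight lam n \<sigma> x * \<phi> (?L x)) \<in> borel_measurable ?G" by measurable
        have "norm (spin_weight lam n \<sigma> x * \<phi> (?L x)) \<le> norm (B * spin_weight lam n \<sigma> x)" for x
        proof -
          have "\<bar>spin_weight lam n \<sigma> x\<bar> * \<bar>\<phi> (?L x)\<bar> \<le> \<bar>spin_weight lam n \<sigma> x\<bar> * B"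
            by (intro mult_left_mono \<phi>) auto
          also have "\<dots> \<le> \<bar>B * spin_weight lam n \<sigma> x\<bar>" by (simp add: abs_mult mult.commute mult_right_mono)
          finally show ?thesis by (simp add: abs_mult)
        qed
        then show "AE x in ?G. norm (spin_weight lam n \<sigma> x * \<phi> (?L x)) \<le> norm (B * spin_weight lam n \<sigma> x)" by simp
      qed
      let ?I = "\<integral>x. \<phi> (?L x + ?v) \<partial>?G"
      have d: "\<bar>(\<integral>x. \<phi> (?L (?s \<sigma> x)) \<partial>?G) - ?I\<bar> \<le> K * \<epsilon> n" if s: "\<sigma> \<in> spins n" for \<sigma>
      proof -
        have sp: "\<forall>i\<in>{1..n}. \<bar>\<sigma> i\<bar> = 1" using spins_abs[OF s] by blast
        note shs = sh[OF n sp]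
        have i0: "integrable ?G (\<lambda>x. ?L (?s \<sigma> x))" using shs by blast
        then have [measurable]: "(\<lambda>x. ?L (?s \<sigma> x)) \<in> borel_measurable ?G" by (rule borel_measurable_integrable)
        have i1: "integrable ?G (\<lambda>x. \<phi> (?L (?s \<sigma> x)))" "integrable ?G (\<lambda>x. \<phi> (?L x + ?v))"
          by (rule integrable_const_bound[of _ B]; use \<phi>(2) in simp)+
        have i2: "integrable ?G (\<lambda>x. K * \<bar>?L (?s \<sigma> x) - ?L x - ?v\<bar>)"
          by (intro integrable_mult_right integrable_abs Bochner_Integration.integrable_diff i0 Li) simp
        have "\<bar>(\<integral>x. \<phi> (?L (?s \<sigma> x)) \<partial>?G) - ?I\<bar> = \<bar>\<integral>x. \<phi> (?L (?s \<sigma> x)) - \<phi> (?L x + ?v) \<partial>?G\<bar>"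
          using i1 by simp
        also have "\<dots> \<le> (\<integral>x. \<bar>\<phi> (?L (?s \<sigma> x)) - \<phi> (?L x + ?v)\<bar> \<partial>?G)" by (rule integral_abs_bound)
        also have "\<dots> \<le> (\<integral>x. K * \<bar>?L (?s \<sigma> x) - ?L x - ?v\<bar> \<partial>?G)"
        proof (rule integral_mono)
          show "integrable ?G (\<lambda>x. \<bar>\<phi> (?L (?s \<sigma> x)) - \<phi> (?L x + ?v)\<bar>)"
            by (intro integrable_abs Bochner_Integration.integrable_diff i1)
          show "\<bar>\<phi> (?L (?s \<sigma> x)) - \<phi> (?L x + ?v)\<bar> \<le> K * \<bar>?L (?s \<sigma> x) - ?L x - ?v\<bar>" for x
            using \<phi>(1)[of "?L (?s \<sigma> x)" "?L x + ?v"] by (simp add: algebra_simps)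
        qed (rule i2)
        also have "\<dots> = K * (\<integral>x. \<bar>?L (?s \<sigma> x) - ?L x - ?v\<bar> \<partial>?G)" by simp
        also have "\<dots> \<le> K * \<epsilon> n" using shs K0 by (intro mult_left_mono) auto
        finally show ?thesis .
      qed
      have "(\<integral>x. zfield lam 0 n x * \<phi> (?L x) \<partial>?G) = (\<integral>x. 1 / 2 ^ n * (\<Sum>\<sigma>\<in>spins n. spin_weight lam n \<sigma> x * \<phi> (?L x)) \<partial>?G)"
        by (simp add: zfield_eq sum_distrib_right)
      also have "\<dots> = 1 / 2 ^ n * (\<Sum>\<sigma>\<in>spins n. (\<integral>x. \<phi> (?L (?s \<sigma> x)) \<partial>?G))"
        unfolding integral_mult_right_zero using bi by (subst Bochner_Integration.integral_sum) (auto simp: sw cong: sum.cong)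
      finally have e: "(\<integral>x. zfield lam 0 n x * \<phi> (?L x) \<partial>?G) - ?I = 1 / 2 ^ n * (\<Sum>\<sigma>\<in>spins n. (\<integral>x. \<phi> (?L (?s \<sigma> x)) \<partial>?G) - ?I)"
        by (simp add: sum_subtractf card_spins right_diff_distrib)
      have "\<bar>\<Sum>\<sigma>\<in>spins n. (\<integral>x. \<phi> (?L (?s \<sigma> x)) \<partial>?G) - ?I\<bar> \<le> (\<Sum>\<sigma>\<in>spins n. K * \<epsilon> n)"
        by (rule order_trans[OF sum_abs]) (rule sum_mono[OF d])
      also have "\<dots> = 2 ^ n * (K * \<epsilon> n)" by (simp add: card_spins)
      finally show ?case unfolding e by (simp add: abs_mult field_simps)
    qed
  qed
qed

text \<open>A pushforward rather than a density, so that the degenerate case \<open>v = 0\<close> is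
  covered; it occurs for cycle sums with \<open>M < 2\<close>.\<close>

definition gauss_law :: "real \<Rightarrow> real measure" where
  "gauss_law v = distr std_normal_distribution borel (\<lambda>z. sqrt v * z)"

lemma real_distribution_gauss_law: "real_distribution (gauss_law v)"
proof -
  interpret prob_space std_normal_distribution by (rule prob_space_std_normal)
  show ?thesis unfolding gauss_law_def by (rule real_distribution_distr) simp
qed

lemma char_gauss_law: "v \<ge> 0 \<Longrightarrow> char (gauss_law v) t = of_real (exp (- v * t\<^sup>2 / 2))"
proof -
  assume v: "v \<ge> 0"
  have "char (gauss_law v) t = char std_normal_distribution (t * sqrt v)"
    unfolding gauss_law_def char_def by (subst integral_distr) (auto simp: mult.assoc)
  also have "\<dots> = of_real (exp (- v * t\<^sup>2 / 2))"
    unfolding char_std_normal_distribution using v by (simp add: power_mult_distrib mult.commute)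
  finally show ?thesis .
qed

lemma lin_weak_convergence:
  fixes \<phi> :: "real \<Rightarrow> real"
  assumes "\<And>u. isCont \<phi> u" "\<And>u. \<bar>\<phi> u\<bar> \<le> B"
  shows "(\<lambda>n. \<integral>x. \<phi> (lin a M n x) \<partial>gauss_space (idx n)) \<longlonglongrightarrow> (\<integral>z. \<phi> (sqrt (lin_variance a M) * z) \<partial>std_normal_distribution)"
proof -
  have v: "lin_variance a M \<ge> 0" by (simp add: lin_variance_def limit_variance_def sum_nonneg)
  let ?D = "\<lambda>n. distr (gauss_space (idx n)) borel (lin a M n)"
  have m: "lin a M n \<in> borel_measurable (gauss_space (idx n))" for n by (rule gpoly_measurable[OF gpoly_lin])
  have rd: "real_distribution (?D n)" for n
  proof -
    interpret prob_space "gauss_space (idx n)" by (rule prob_space_gauss_space)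
    show ?thesis by (rule real_distribution_distr) (rule m)
  qed
  have \<phi>m: "\<phi> \<in> borel_measurable borel"
    using assms(1) by (intro borel_measurable_continuous_onI continuous_at_imp_continuous_on) auto
  have "weak_conv_m ?D (gauss_law (lin_variance a M))"
  proof (rule levy_continuity[OF rd real_distribution_gauss_law])
    fix t
    have "char (?D n) t = (\<integral>x. iexp (t * lin a M n x) \<partial>gauss_space (idx n))" for n
      unfolding char_def by (rule integral_distr[OF m]) simp
    then show "(\<lambda>n. char (?D n) t) \<longlonglongrightarrow> char (gauss_law (lin_variance a M)) t"
      using lin_char_tendsto[of t a M] v by (simp add: char_gauss_law)
  qed
  from weak_conv_imp_integral_bdd_continuous_conv[OF rd real_distribution_gauss_law this assms(1), of B]
  have "(\<lambda>n. integral\<^sup>L (?D n) \<phi>) \<longlonglongrightarrow> integral\<^sup>L (gauss_law (lin_variance a M)) \<phi>" using assms(2) by simp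
  moreover have "integral\<^sup>L (?D n) \<phi> = (\<integral>x. \<phi> (lin a M n x) \<partial>gauss_space (idx n))" for n
    by (rule integral_distr[OF m \<phi>m])
  moreover have "integral\<^sup>L (gauss_law (lin_variance a M)) \<phi> = (\<integral>z. \<phi> (sqrt (lin_variance a M) * z) \<partial>std_normal_distribution)"
    unfolding gauss_law_def by (rule integral_distr[OF _ \<phi>m]) simp
  ultimately show ?thesis by simp
qed

section \<open>The truncated cycle exponential and its distance to the partition function\<close>

definition cycle_coeff :: "real \<Rightarrow> nat \<Rightarrow> real" where
  "cycle_coeff lam k = (if k \<ge> 2 then lam ^ k / (2 * real k) else 0)"

definition cycle_variance :: "real \<Rightarrow> nat \<Rightarrow> real" where
  "cycle_variance lam M = (\<Sum>k=2..M. lam ^ (2 * k) / (2 * real k))"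

text \<open>The variance 2k a_k^2 and the drift a_k lam^k of a k-cycle term agree for a_k =
  lam^k/(2k). This is the relation for a Gaussian \<open>L\<close> of variance \<open>v\<close>,
  whose mean moves by \<open>v\<close> under the tilt exp(L - v/2).\<close>

lemma cycle_variance_eq:
  "lin_variance (cycle_coeff lam) M = cycle_variance lam M"
  "(\<Sum>k=1..M. cycle_coeff lam k * lam ^ k) = cycle_variance lam M"
proof -
  have "(\<Sum>k=1..M. f k) = (\<Sum>k=2..M. f k)" if "f 1 = 0" for f :: "nat \<Rightarrow> real"
  proof (rule sum.mono_neutral_right)
    show "\<forall>i\<in>{1..M} - {2..M}. f i = 0"
    proof
      fix i assume "i \<in> {1..M} - {2..M}"
      then have "i = 1" by auto
      then show "f i = 0" using that by simp
    qed
  qed auto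
  then have *: "(\<Sum>k=1..M. f k) = (\<Sum>k=2..M. g k)" if "f 1 = 0" "\<And>k. k \<ge> 2 \<Longrightarrow> f k = g k" for f g :: "nat \<Rightarrow> real"
  proof -
    have "(\<Sum>k=2..M. f k) = (\<Sum>k=2..M. g k)" by (rule sum.cong) (use that in auto)
    then show ?thesis using \<open>\<And>f. f 1 = 0 \<Longrightarrow> (\<Sum>k=1..M. f k) = (\<Sum>k=2..M. f k)\<close> that(1) by metis
  qed
  show "lin_variance (cycle_coeff lam) M = cycle_variance lam M"
    unfolding lin_variance_def cycle_variance_def
    by (rule *) (simp_all add: cycle_coeff_def limit_variance_def power_divide power_mult power2_eq_square power_mult_distrib field_simps)
  show "(\<Sum>k=1..M. cycle_coeff lam k * lam ^ k) = cycle_variance lam M"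
    unfolding cycle_variance_def
    by (rule *) (simp_all add: cycle_coeff_def power_add[symmetric] mult_2[symmetric])
qed

lemma cycle_variance_nonneg: "cycle_variance lam M \<ge> 0"
  unfolding cycle_variance_def by (intro sum_nonneg) (simp add: power_mult)

text \<open>The power series of -ln(1 - lam^2)/2 without its first term lam^2/2.\<close>

lemma cycle_variance_tendsto:
  assumes lam: "0 \<le> lam" "lam < 1"
  shows "(\<lambda>M. cycle_variance lam M) \<longlonglongrightarrow> - ln (1 - lam\<^sup>2) / 2 - lam\<^sup>2 / 2"
proof -
  have l1: "lam\<^sup>2 < 1" using lam by (simp add: power_less_one_iff)
  have "(\<lambda>n. - ((- (- lam\<^sup>2)) ^ n) / real n) sums ln (1 + (- lam\<^sup>2))"
    by (rule ln_series') (use l1 in simp)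
  then have "(\<lambda>M. \<Sum>n\<le>M. - ((lam\<^sup>2) ^ n) / real n) \<longlonglongrightarrow> ln (1 - lam\<^sup>2)"
    by (simp add: sums_def_le)
  then have "(\<lambda>M. - (\<Sum>n\<le>M. - ((lam\<^sup>2) ^ n) / real n) / 2 - lam\<^sup>2 / 2) \<longlonglongrightarrow> - ln (1 - lam\<^sup>2) / 2 - lam\<^sup>2 / 2"
    by (intro tendsto_intros) auto
  moreover have "\<forall>\<^sub>F M in sequentially. - (\<Sum>n\<le>M. - ((lam\<^sup>2) ^ n) / real n) / 2 - lam\<^sup>2 / 2 = cycle_variance lam M"
    using eventually_ge_at_top[of 1]
  proof eventually_elim
    case (elim M)
    have "{..M} = insert 0 (insert 1 {2..M})" using elim by auto
    then have a: "(\<Sum>n\<le>M. - ((lam\<^sup>2) ^ n) / real n) = - lam\<^sup>2 + (\<Sum>n=2..M. - ((lam\<^sup>2) ^ n) / real n)"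
      by simp
    have b: "(\<Sum>n=2..M. - ((lam\<^sup>2) ^ n) / real n) = - (\<Sum>n=2..M. (lam\<^sup>2) ^ n / real n)"
      by (simp add: sum_negf)
    have c: "cycle_variance lam M = (\<Sum>n=2..M. (lam\<^sup>2) ^ n / real n) / 2"
      unfolding cycle_variance_def sum_divide_distrib by (rule sum.cong[OF refl]) (simp add: power_mult)
    have "- (- p + - q) / 2 - p / 2 = q / 2" for p q :: real by (simp add: field_simps)
    then show ?case unfolding a b c .
  qed
  ultimately show ?thesis by (rule Lim_transform_eventually)
qed

text \<open>The exponent is the limit found in \<open>cycle_variance_tendsto\<close>, so the cycles
  exhaust the limiting second moment of \<open>Z\<close>.\<close>

lemma overlap_limit_eq:
  assumes lam: "0 \<le> lam" "lam < 1"
  shows "overlap_limit lam = exp (- ln (1 - lam\<^sup>2) / 2 - lam\<^sup>2 / 2)"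
proof -
  have l1: "lam\<^sup>2 < 1" using lam by (simp add: power_less_one_iff)
  then have y: "0 < 1 - lam\<^sup>2" by simp
  have "exp (ln (1 - lam\<^sup>2) / 2) = exp (ln (sqrt (1 - lam\<^sup>2)))" using y by (simp only: ln_sqrt)
  also have "\<dots> = sqrt (1 - lam\<^sup>2)" using y by simp
  finally have e: "exp (ln (1 - lam\<^sup>2) / 2) = sqrt (1 - lam\<^sup>2)" .
  have "exp (- ln (1 - lam\<^sup>2) / 2) = inverse (exp (ln (1 - lam\<^sup>2) / 2))"
    unfolding exp_minus[symmetric] by simp
  then have "1 / sqrt (1 - lam\<^sup>2) = exp (- ln (1 - lam\<^sup>2) / 2)"
    unfolding e by (simp only: divide_inverse mult_1_left)
  then have "overlap_limit lam = exp (- lam\<^sup>2 / 2) * exp (- ln (1 - lam\<^sup>2) / 2)"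
    unfolding overlap_limit_def by (metis (no_types) times_divide_eq_right mult.right_neutral)
  also have "\<dots> = exp (- lam\<^sup>2 / 2 + - ln (1 - lam\<^sup>2) / 2)" by (rule exp_add[symmetric])
  also have "- lam\<^sup>2 / 2 + - ln (1 - lam\<^sup>2) / 2 = - ln (1 - lam\<^sup>2) / 2 - lam\<^sup>2 / 2" by simp
  finally show ?thesis .
qed

lemma exp_min_lipschitz: "\<bar>exp (min (u - c) \<tau>) - exp (min (w - c) \<tau>)\<bar> \<le> exp \<tau> * \<bar>u - w\<bar>" for u w c \<tau> :: real
proof -
  have *: "\<bar>exp (min (u - c) \<tau>) - exp (min (w - c) \<tau>)\<bar> \<le> exp \<tau> * \<bar>u - w\<bar>" if "u \<le> w" for u w :: real
  proof -
    let ?p = "min (w - c) \<tau>" and ?q = "min (u - c) \<tau>"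
    have "1 + (?q - ?p) \<le> exp (?q - ?p)" by (rule exp_ge_add_one_self)
    then have "exp ?p * (1 + (?q - ?p)) \<le> exp ?p * exp (?q - ?p)" by (rule mult_left_mono) simp
    then have "exp ?p - exp ?q \<le> exp ?p * (?p - ?q)" by (simp add: exp_add[symmetric] algebra_simps)
    also have "\<dots> \<le> exp \<tau> * (w - u)" using that by (intro mult_mono) auto
    finally show ?thesis using that by simp
  qed
  show ?thesis using *[of u w] *[of w u] by (cases "u \<le> w") (auto simp: abs_minus_commute)
qed

text \<open>Both truncated integrands are dominated by their untruncated versions, which integrate
  to exp v. The first is the mixed term, with the drift \<open>v\<close> added, and the second is
  the square.\<close>

lemma exp_min_gaussian_limits:
  assumes v: "v \<ge> 0"
  shows "(\<lambda>m. \<integral>z. exp (min (sqrt v * z + v - v / 2) (real m)) \<partial>std_normal_distribution) \<longlonglongrightarrow> exp v"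
    and "(\<lambda>m. \<integral>z. (exp (min (sqrt v * z - v / 2) (real m)))\<^sup>2 \<partial>std_normal_distribution) \<longlonglongrightarrow> exp v"
proof -
  have ev: "(\<lambda>m. exp (min y (real m))) \<longlonglongrightarrow> exp y" for y :: real
  proof (rule tendsto_eventually)
    show "\<forall>\<^sub>F m in sequentially. exp (min y (real m)) = exp y"
      using eventually_ge_at_top[of "nat \<lceil>y\<rceil>"] by eventually_elim (simp add: nat_ceiling_le_eq min_absorb1)
  qed
  have "(\<lambda>m. \<integral>z. exp (min (sqrt v * z + v - v / 2) (real m)) \<partial>std_normal_distribution) \<longlonglongrightarrow>
     (\<integral>z. exp (sqrt v * z + v - v / 2) \<partial>std_normal_distribution)"
  proof (rule integral_dominated_convergence[where w = "\<lambda>z. exp (v / 2) * exp (sqrt v * z)"])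
    show "integrable std_normal_distribution (\<lambda>z. exp (v / 2) * exp (sqrt v * z))"
      by (intro integrable_mult_right integrable_exp_std_normal)
    show "AE z in std_normal_distribution. (\<lambda>m. exp (min (sqrt v * z + v - v / 2) (real m))) \<longlonglongrightarrow> exp (sqrt v * z + v - v / 2)"
      by (intro always_eventually allI ev)
  qed (auto simp: exp_add[symmetric])
  also have "(\<integral>z. exp (sqrt v * z + v - v / 2) \<partial>std_normal_distribution) = (\<integral>z. exp (v / 2) * exp (sqrt v * z) \<partial>std_normal_distribution)"
    by (rule Bochner_Integration.integral_cong) (auto simp: exp_add[symmetric])
  also have "\<dots> = exp v" unfolding integral_mult_right_zero integral_exp_std_normal using v by (simp add: exp_add[symmetric])
  finally show "(\<lambda>m. \<integral>z. exp (min (sqrt v * z + v - v / 2) (real m)) \<partial>std_normal_distribution) \<longlonglongrightarrow> exp v" .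
  have "(\<lambda>m. \<integral>z. (exp (min (sqrt v * z - v / 2) (real m)))\<^sup>2 \<partial>std_normal_distribution) \<longlonglongrightarrow>
     (\<integral>z. (exp (sqrt v * z - v / 2))\<^sup>2 \<partial>std_normal_distribution)"
  proof (rule integral_dominated_convergence[where w = "\<lambda>z. exp (- v) * exp (2 * sqrt v * z)"])
    show "integrable std_normal_distribution (\<lambda>z. exp (- v) * exp (2 * sqrt v * z))"
      by (intro integrable_mult_right integrable_exp_std_normal)
    show "AE z in std_normal_distribution. (\<lambda>m. (exp (min (sqrt v * z - v / 2) (real m)))\<^sup>2) \<longlonglongrightarrow> (exp (sqrt v * z - v / 2))\<^sup>2"
      by (intro always_eventually allI tendsto_power ev)
    fix m
    show "AE z in std_normal_distribution. norm ((exp (min (sqrt v * z - v / 2) (real m)))\<^sup>2) \<le> exp (- v) * exp (2 * sqrt v * z)"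
    proof (intro always_eventually allI)
      fix z
      have "2 * min (sqrt v * z - v / 2) (real m) \<le> - v + 2 * sqrt v * z"
      proof -
        have "2 * min (sqrt v * z - v / 2) (real m) \<le> 2 * (sqrt v * z - v / 2)"
          by (rule mult_left_mono) auto
        then show ?thesis by (simp add: algebra_simps)
      qed
      then show "norm ((exp (min (sqrt v * z - v / 2) (real m)))\<^sup>2) \<le> exp (- v) * exp (2 * sqrt v * z)"
        by (simp add: exp_add[symmetric] power2_eq_square)
    qed
  qed auto
  also have "(\<integral>z. (exp (sqrt v * z - v / 2))\<^sup>2 \<partial>std_normal_distribution) = (\<integral>z. exp (- v) * exp (2 * sqrt v * z) \<partial>std_normal_distribution)"
    by (rule Bochner_Integration.integral_cong) (auto simp: exp_add[symmetric] power2_eq_square)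
  also have "\<dots> = exp v" unfolding integral_mult_right_zero integral_exp_std_normal using v by (simp add: exp_add[symmetric] power_mult_distrib)
  finally show "(\<lambda>m. \<integral>z. (exp (min (sqrt v * z - v / 2) (real m)))\<^sup>2 \<partial>std_normal_distribution) \<longlonglongrightarrow> exp v" .
qed

text \<open>The truncation at \<open>\<tau>\<close> is essential: the exponential of a cubic Gaussian polynomial is
  not integrable.\<close>

definition cycle_exp :: "real \<Rightarrow> nat \<Rightarrow> real \<Rightarrow> nat \<Rightarrow> (nat \<times> nat \<Rightarrow> real) \<Rightarrow> real" where
  "cycle_exp lam M \<tau> n x = exp (min (lin (cycle_coeff lam) M n x - cycle_variance lam M / 2) \<tau>)"

lemma cycle_exp_measurable: "cycle_exp lam M \<tau> n \<in> borel_measurable (gauss_space (idx n))"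
proof -
  have [measurable]: "lin (cycle_coeff lam) M n \<in> borel_measurable (gauss_space (idx n))" by (rule gpoly_measurable[OF gpoly_lin])
  show ?thesis unfolding cycle_exp_def[abs_def] by measurable
qed

text \<open>The three limits come from expanding the square: the second moment of \<open>Z\<close>,
  the mixed term in which the tilt by \<open>Z\<close> moves the cycle sum by its own variance, and
  plain weak convergence for the last term.\<close>

lemma zfield_cycle_exp_L2:
  assumes lam: "0 \<le> lam" "lam < 1"
  shows "(\<lambda>n. \<integral>x. (zfield lam 0 n x - cycle_exp lam M \<tau> n x)\<^sup>2 \<partial>gauss_space (idx n)) \<longlonglongrightarrow>
    overlap_limit lam
      - 2 * (\<integral>z. exp (min (sqrt (cycle_variance lam M) * z + cycle_variance lam M - cycle_variance lam M / 2) \<tau>) \<partial>std_normal_distribution)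
      + (\<integral>z. (exp (min (sqrt (cycle_variance lam M) * z - cycle_variance lam M / 2) \<tau>))\<^sup>2 \<partial>std_normal_distribution)"
proof -
  let ?v = "cycle_variance lam M"
  let ?\<psi> = "\<lambda>u. exp (min (u - ?v / 2) \<tau>)"
  let ?L = "\<lambda>n. lin (cycle_coeff lam) M n"
  have \<psi>b: "\<bar>?\<psi> u\<bar> \<le> exp \<tau>" for u by simp
  have \<psi>c: "isCont ?\<psi> u" for u by (intro continuous_intros)
  have 1: "(\<lambda>n. \<integral>x. zfield lam 0 n x * zfield lam 0 n x \<partial>gauss_space (idx n)) \<longlonglongrightarrow> overlap_limit lam"
    using zfield_second_moment_tendsto[OF lam, of 0 0] by simp
  have "(\<lambda>n. (\<integral>x. zfield lam 0 n x * ?\<psi> (?L n x) \<partial>gauss_space (idx n)) - (\<integral>x. ?\<psi> (?L n x + ?v) \<partial>gauss_space (idx n))) \<longlonglongrightarrow> 0"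
    using zfield_weighted_lipschitz[of lam "cycle_coeff lam" ?\<psi> "exp \<tau>" "exp \<tau>" M] exp_min_lipschitz \<psi>b lam
    unfolding cycle_variance_eq by (simp add: cycle_coeff_def)
  moreover have "(\<lambda>n. \<integral>x. ?\<psi> (?L n x + ?v) \<partial>gauss_space (idx n)) \<longlonglongrightarrow> (\<integral>z. ?\<psi> (sqrt ?v * z + ?v) \<partial>std_normal_distribution)"
    using lin_weak_convergence[of "\<lambda>u. ?\<psi> (u + ?v)" "exp \<tau>" "cycle_coeff lam" M] unfolding cycle_variance_eq
    by (simp add: continuous_intros)
  ultimately have 2: "(\<lambda>n. \<integral>x. zfield lam 0 n x * ?\<psi> (?L n x) \<partial>gauss_space (idx n)) \<longlonglongrightarrow> (\<integral>z. ?\<psi> (sqrt ?v * z + ?v) \<partial>std_normal_distribution)"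
    using tendsto_add by fastforce
  have "\<bar>(?\<psi> u)\<^sup>2\<bar> \<le> (exp \<tau>)\<^sup>2" for u
    using power_mono[of "?\<psi> u" "exp \<tau>" 2] by simp
  then have 3: "(\<lambda>n. \<integral>x. (?\<psi> (?L n x))\<^sup>2 \<partial>gauss_space (idx n)) \<longlonglongrightarrow> (\<integral>z. (?\<psi> (sqrt ?v * z))\<^sup>2 \<partial>std_normal_distribution)"
    using lin_weak_convergence[of "\<lambda>u. (?\<psi> u)\<^sup>2" "(exp \<tau>)\<^sup>2" "cycle_coeff lam" M] unfolding cycle_variance_eq
    by (simp add: continuous_intros)
  have lim: "(\<lambda>n. (\<integral>x. zfield lam 0 n x * zfield lam 0 n x \<partial>gauss_space (idx n))
      - 2 * (\<integral>x. zfield lam 0 n x * ?\<psi> (?L n x) \<partial>gauss_space (idx n))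
      + (\<integral>x. (?\<psi> (?L n x))\<^sup>2 \<partial>gauss_space (idx n))) \<longlonglongrightarrow>
    overlap_limit lam - 2 * (\<integral>z. ?\<psi> (sqrt ?v * z + ?v) \<partial>std_normal_distribution)
      + (\<integral>z. (?\<psi> (sqrt ?v * z))\<^sup>2 \<partial>std_normal_distribution)"
    by (intro tendsto_intros 1 2 3)
  show ?thesis
  proof (rule Lim_transform_eventually[OF lim])
    show "\<forall>\<^sub>F n in sequentially. (\<integral>x. zfield lam 0 n x * zfield lam 0 n x \<partial>gauss_space (idx n))
      - 2 * (\<integral>x. zfield lam 0 n x * ?\<psi> (?L n x) \<partial>gauss_space (idx n))
      + (\<integral>x. (?\<psi> (?L n x))\<^sup>2 \<partial>gauss_space (idx n)) = (\<integral>x. (zfield lam 0 n x - cycle_exp lam M \<tau> n x)\<^sup>2 \<partial>gauss_space (idx n))"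
      using eventually_ge_at_top[of 1]
    proof eventually_elim
      case n: (elim n)
      interpret prob_space "gauss_space (idx n)" by (rule prob_space_gauss_space)
      note [measurable] = cycle_exp_measurable[of lam M \<tau> n] zfield_measurable[of lam 0 n]
      have c: "\<bar>cycle_exp lam M \<tau> n x\<bar> \<le> exp \<tau>" for x by (simp add: cycle_exp_def)
      have i1: "integrable (gauss_space (idx n)) (\<lambda>x. zfield lam 0 n x * zfield lam 0 n x)" by (rule zfield_pair_integrable[OF n])
      have i2: "integrable (gauss_space (idx n)) (\<lambda>x. zfield lam 0 n x * cycle_exp lam M \<tau> n x)"
      proof (rule Bochner_Integration.integrable_bound)
        show "integrable (gauss_space (idx n)) (\<lambda>x. zfield lam 0 n x * exp \<tau>)" by (intro integrable_mult_left zfield_integrable n)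
        show "AE x in gauss_space (idx n). norm (zfield lam 0 n x * cycle_exp lam M \<tau> n x) \<le> norm (zfield lam 0 n x * exp \<tau>)"
          using c by (intro always_eventually allI) (auto simp: abs_mult intro!: mult_left_mono)
      qed measurable
      have i3: "integrable (gauss_space (idx n)) (\<lambda>x. (cycle_exp lam M \<tau> n x)\<^sup>2)"
      proof (rule integrable_const_bound[of _ "(exp \<tau>)\<^sup>2"])
        show "AE x in gauss_space (idx n). norm ((cycle_exp lam M \<tau> n x)\<^sup>2) \<le> (exp \<tau>)\<^sup>2"
          using c by (intro always_eventually allI) (simp add: abs_le_square_iff[symmetric])
      qed measurable
      have "(\<integral>x. (zfield lam 0 n x - cycle_exp lam M \<tau> n x)\<^sup>2 \<partial>gauss_space (idx n)) =
        (\<integral>x. zfield lam 0 n x * zfield lam 0 n x - 2 * (zfield lam 0 n x * cycle_exp lam M \<tau> n x) + (cycle_exp lam M \<tau> n x)\<^sup>2 \<partial>gauss_space (idx n))"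
        by (rule Bochner_Integration.integral_cong) (auto simp: power2_eq_square algebra_simps)
      also have "\<dots> = (\<integral>x. zfield lam 0 n x * zfield lam 0 n x \<partial>gauss_space (idx n)) - 2 * (\<integral>x. zfield lam 0 n x * cycle_exp lam M \<tau> n x \<partial>gauss_space (idx n)) + (\<integral>x. (cycle_exp lam M \<tau> n x)\<^sup>2 \<partial>gauss_space (idx n))"
        using i1 i2 i3 by simp
      finally show ?case by (simp add: cycle_exp_def)
    qed
  qed
qed

text \<open>The factor removes the constant (1 - b)^(-1/2) contributed by the Curie--Weiss term,
  which makes the result comparable with \<open>zfield\<close> in zero field.\<close>

definition zcw_normalized :: "real \<Rightarrow> real \<Rightarrow> nat \<Rightarrow> (nat \<times> nat \<Rightarrow> real) \<Rightarrow> real" where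
  "zcw_normalized lam b n x = zcw lam b n x * sqrt (1 - b)"

definition cycle_log :: "real \<Rightarrow> nat \<Rightarrow> nat \<Rightarrow> (nat \<times> nat \<Rightarrow> real) \<Rightarrow> real" where
  "cycle_log lam M n x = lin (cycle_coeff lam) M n x - cycle_variance lam M / 2"

lemma zcw_normalized_measurable: "zcw_normalized lam b n \<in> borel_measurable (gauss_space (idx n))"
  unfolding zcw_normalized_def[abs_def] by (intro borel_measurable_times zcw_measurable borel_measurable_const)

lemma cycle_log_measurable: "cycle_log lam M n \<in> borel_measurable (gauss_space (idx n))"
  unfolding cycle_log_def[abs_def] by (intro borel_measurable_diff gpoly_measurable[OF gpoly_lin] borel_measurable_const)

lemma zcw_normalized_pos: "b < 1 \<Longrightarrow> zcw_normalized lam b n x > 0"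
  unfolding zcw_normalized_def by (intro mult_pos_pos zcw_pos) simp

lemma cycle_exp_eq: "cycle_exp lam M \<tau> n x = exp (min (cycle_log lam M n x) \<tau>)"
  by (simp add: cycle_exp_def cycle_log_def)

lemma cycle_exp_integrable: "integrable (gauss_space (idx n)) (cycle_exp lam M \<tau> n)"
proof -
  interpret prob_space "gauss_space (idx n)" by (rule prob_space_gauss_space)
  have "AE x in gauss_space (idx n). norm (cycle_exp lam M \<tau> n x) \<le> exp \<tau>" by (simp add: cycle_exp_def)
  then show ?thesis by (rule integrable_const_bound) (rule cycle_exp_measurable)
qed

lemma zfield_cycle_exp_square_integrable:
  assumes n: "n \<ge> 1"
  shows "integrable (gauss_space (idx n)) (\<lambda>x. (zfield lam 0 n x - cycle_exp lam M \<tau> n x)\<^sup>2)"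
proof -
  interpret prob_space "gauss_space (idx n)" by (rule prob_space_gauss_space)
  note [measurable] = cycle_exp_measurable[of lam M \<tau> n] zfield_measurable[of lam 0 n]
  show ?thesis
  proof (rule Bochner_Integration.integrable_bound)
    show "integrable (gauss_space (idx n)) (\<lambda>x. 2 * (zfield lam 0 n x * zfield lam 0 n x) + 2 * (exp \<tau>)\<^sup>2)"
      using zfield_pair_integrable[OF n, of lam 0 0] by simp
    show "AE x in gauss_space (idx n). norm ((zfield lam 0 n x - cycle_exp lam M \<tau> n x)\<^sup>2) \<le> norm (2 * (zfield lam 0 n x * zfield lam 0 n x) + 2 * (exp \<tau>)\<^sup>2)"
    proof (intro always_eventually allI)
      fix x
      have g: "(p - q)\<^sup>2 \<le> 2 * (p * p) + 2 * q\<^sup>2" for p q :: real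
        using zero_le_power2[of "p + q"] by (simp add: power2_eq_square algebra_simps)
      have "(cycle_exp lam M \<tau> n x)\<^sup>2 \<le> (exp \<tau>)\<^sup>2" by (rule power_mono) (auto simp: cycle_exp_def)
      then show "norm ((zfield lam 0 n x - cycle_exp lam M \<tau> n x)\<^sup>2) \<le> norm (2 * (zfield lam 0 n x * zfield lam 0 n x) + 2 * (exp \<tau>)\<^sup>2)"
        using g[of "zfield lam 0 n x" "cycle_exp lam M \<tau> n x"] by simp
    qed
  qed measurable
qed

text \<open>The order of the choices matters: first \<open>M\<close>, to exhaust the second moment
  of \<open>Z\<close>, then a truncation level above the prescribed \<open>B\<close>, and only then
  \<open>n\<close>.\<close>

lemma zcw_normalized_approx:
  assumes lam: "0 \<le> lam" "lam < 1" and b: "0 \<le> b" "b < 1" and th: "\<theta> > 0"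
  shows "\<exists>M0. \<forall>M\<ge>M0. \<exists>\<tau>\<ge>B. \<forall>\<^sub>F n in sequentially.
    (\<integral>x. \<bar>zcw_normalized lam b n x - cycle_exp lam M \<tau> n x\<bar> \<partial>gauss_space (idx n)) < \<theta>"
proof -
  \<comment> \<open>Half of \<open>\<theta>\<close> pays for the Curie--Weiss comparison; the other
    half, squared, bounds the mean square distance to the cycle exponential.\<close>
  let ?q = "(\<theta> / 2)\<^sup>2"
  have q: "?q > 0" using th by simp
  have "(\<lambda>M. overlap_limit lam - exp (cycle_variance lam M)) \<longlonglongrightarrow> overlap_limit lam - overlap_limit lam"
    unfolding overlap_limit_eq[OF lam] by (intro tendsto_intros cycle_variance_tendsto lam)
  then have "\<forall>\<^sub>F M in sequentially. overlap_limit lam - exp (cycle_variance lam M) < ?q"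
    by (intro order_tendstoD(2)[OF _ q]) simp
  then obtain M0 where M0: "\<And>M. M \<ge> M0 \<Longrightarrow> overlap_limit lam - exp (cycle_variance lam M) < ?q"
    unfolding eventually_sequentially by blast
  have "\<exists>\<tau>\<ge>B. \<forall>\<^sub>F n in sequentially. (\<integral>x. \<bar>zcw_normalized lam b n x - cycle_exp lam M \<tau> n x\<bar> \<partial>gauss_space (idx n)) < \<theta>"
    if M: "M \<ge> M0" for M
  proof -
    let ?v = "cycle_variance lam M"
    let ?f = "\<lambda>\<tau>. overlap_limit lam
      - 2 * (\<integral>z. exp (min (sqrt ?v * z + ?v - ?v / 2) \<tau>) \<partial>std_normal_distribution)
      + (\<integral>z. (exp (min (sqrt ?v * z - ?v / 2) \<tau>))\<^sup>2 \<partial>std_normal_distribution)"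
    \<comment> \<open>As the truncation is lifted, the limiting squared distance becomes
      \<open>overlap_limit lam\<close> - 2 exp v + exp v, that is, \<open>overlap_limit lam\<close>
      - exp v.\<close>
    have "(\<lambda>m. ?f (real m)) \<longlonglongrightarrow> overlap_limit lam - 2 * exp ?v + exp ?v"
      by (intro tendsto_intros exp_min_gaussian_limits cycle_variance_nonneg)
    then have "\<forall>\<^sub>F m in sequentially. ?f (real m) < ?q"
      by (rule order_tendstoD(2)) (use M0[OF M] in simp)
    moreover have "\<forall>\<^sub>F m in sequentially. B \<le> real m"
      using eventually_ge_at_top[of "nat \<lceil>B\<rceil>"] by eventually_elim (simp add: nat_ceiling_le_eq)
    ultimately have "\<forall>\<^sub>F m in sequentially. ?f (real m) < ?q \<and> B \<le> real m" by (rule eventually_conj)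
    from eventually_happens[OF this] obtain m where m: "?f (real m) < ?q" "B \<le> real m" by auto
    define \<tau> where "\<tau> = real m"
    have E1: "\<forall>\<^sub>F n in sequentially. (\<integral>x. (zfield lam 0 n x - cycle_exp lam M \<tau> n x)\<^sup>2 \<partial>gauss_space (idx n)) < ?q"
      by (rule order_tendstoD(2)[OF zfield_cycle_exp_L2[OF lam, of M \<tau>]]) (use m in \<open>simp add: \<tau>_def\<close>)
    have "(\<lambda>n. sqrt (1 - b) * (\<integral>x. \<bar>zcw lam b n x - zfield lam 0 n x / sqrt (1 - b)\<bar> \<partial>gauss_space (idx n))) \<longlonglongrightarrow> sqrt (1 - b) * 0"
      by (intro tendsto_mult tendsto_const zcw_tendsto lam b)
    then have E2: "\<forall>\<^sub>F n in sequentially. sqrt (1 - b) * (\<integral>x. \<bar>zcw lam b n x - zfield lam 0 n x / sqrt (1 - b)\<bar> \<partial>gauss_space (idx n)) < \<theta> / 2"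
      by (rule order_tendstoD(2)) (use th in simp)
    have "\<forall>\<^sub>F n in sequentially. (\<integral>x. \<bar>zcw_normalized lam b n x - cycle_exp lam M \<tau> n x\<bar> \<partial>gauss_space (idx n)) < \<theta>"
      using E1 E2 eventually_ge_at_top[of 1]
    proof eventually_elim
      case (elim n)
      then have n: "n \<ge> 1" by simp
      interpret prob_space "gauss_space (idx n)" by (rule prob_space_gauss_space)
      let ?s = "sqrt (1 - b)"
      have i1: "integrable (gauss_space (idx n)) (\<lambda>x. \<bar>zcw lam b n x - zfield lam 0 n x / ?s\<bar>)"
        by (intro integrable_abs Bochner_Integration.integrable_diff integrable_divide zcw_integrable zfield_integrable n)
      have i2: "integrable (gauss_space (idx n)) (\<lambda>x. \<bar>zfield lam 0 n x - cycle_exp lam M \<tau> n x\<bar>)"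
        by (intro integrable_abs Bochner_Integration.integrable_diff zfield_integrable n cycle_exp_integrable)
      have i3: "integrable (gauss_space (idx n)) (\<lambda>x. \<bar>zcw_normalized lam b n x - cycle_exp lam M \<tau> n x\<bar>)"
        unfolding zcw_normalized_def
        by (intro integrable_abs Bochner_Integration.integrable_diff integrable_mult_left zcw_integrable n cycle_exp_integrable)
      have "expectation (\<lambda>x. \<bar>zcw_normalized lam b n x - cycle_exp lam M \<tau> n x\<bar>) \<le>
         expectation (\<lambda>x. ?s * \<bar>zcw lam b n x - zfield lam 0 n x / ?s\<bar> + \<bar>zfield lam 0 n x - cycle_exp lam M \<tau> n x\<bar>)"
      proof (rule integral_mono[OF i3])
        show "integrable (gauss_space (idx n)) (\<lambda>x. ?s * \<bar>zcw lam b n x - zfield lam 0 n x / ?s\<bar> + \<bar>zfield lam 0 n x - cycle_exp lam M \<tau> n x\<bar>)"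
          by (intro Bochner_Integration.integrable_add integrable_mult_right i1 i2)
        fix x
        have "?s * \<bar>zcw lam b n x - zfield lam 0 n x / ?s\<bar> = \<bar>?s * (zcw lam b n x - zfield lam 0 n x / ?s)\<bar>"
          using b by (simp add: abs_mult)
        also have "?s * (zcw lam b n x - zfield lam 0 n x / ?s) = zcw_normalized lam b n x - zfield lam 0 n x"
          using b by (simp add: zcw_normalized_def right_diff_distrib)
        finally show "\<bar>zcw_normalized lam b n x - cycle_exp lam M \<tau> n x\<bar> \<le> ?s * \<bar>zcw lam b n x - zfield lam 0 n x / ?s\<bar> + \<bar>zfield lam 0 n x - cycle_exp lam M \<tau> n x\<bar>"
          by linarith
      qed
      also have "\<dots> = ?s * expectation (\<lambda>x. \<bar>zcw lam b n x - zfield lam 0 n x / ?s\<bar>) + expectation (\<lambda>x. \<bar>zfield lam 0 n x - cycle_exp lam M \<tau> n x\<bar>)"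
        using i1 i2 by simp
      also have "expectation (\<lambda>x. \<bar>zfield lam 0 n x - cycle_exp lam M \<tau> n x\<bar>) \<le> sqrt (expectation (\<lambda>x. (zfield lam 0 n x - cycle_exp lam M \<tau> n x)\<^sup>2))"
        by (rule expectation_abs_le_sqrt(2)[OF zfield_cycle_exp_square_integrable[OF n]])
          (intro borel_measurable_diff zfield_measurable cycle_exp_measurable)
      also have "\<dots> \<le> sqrt ?q" by (intro real_sqrt_le_mono less_imp_le elim(1))
      also have "sqrt ?q = \<theta> / 2" using th by simp
      finally show ?case using elim(2) by simp
    qed
    then show ?thesis using m(2) unfolding \<tau>_def by blast
  qed
  then show ?thesis by blast
qed

section \<open>From closeness in mean to closeness of logarithms\<close>

lemma ln_close:
  fixes w d \<delta> :: real
  assumes "w > 0" "0 < \<delta>" "\<delta> \<le> 1/2" "\<bar>w - exp d\<bar> \<le> \<delta> * exp d"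
  shows "\<bar>ln w - d\<bar> \<le> 2 * \<delta>"
proof -
  have u: "w \<le> exp d * (1 + \<delta>)" and l: "exp d * (1 - \<delta>) \<le> w"
    using assms(4) by (auto simp: algebra_simps abs_le_iff)
  have "ln w \<le> ln (exp d * (1 + \<delta>))" using u assms(1,2) by (subst ln_le_cancel_iff) auto
  also have "\<dots> = d + ln (1 + \<delta>)" using assms(2) by (subst ln_mult) auto
  also have "\<dots> \<le> d + \<delta>" using ln_add_one_self_le_self[of \<delta>] assms(2) by simp
  finally have 1: "ln w - d \<le> 2 * \<delta>" using assms(2) by simp
  \<comment> \<open>With \<open>\<delta> \<le> 1/2\<close> the quadratic term in the lower bound for
    ln(1 - \<open>\<delta>\<close>) is absorbed into a second \<open>\<delta>\<close>.\<close>
  have "2 * \<delta>\<^sup>2 \<le> \<delta>" using assms(2,3) mult_left_mono[of "2 * \<delta>" 1 \<delta>] by (simp add: power2_eq_square)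
  then have "- 2 * \<delta> \<le> - \<delta> - 2 * \<delta>\<^sup>2" by simp
  also have "\<dots> \<le> ln (1 - \<delta>)" using ln_one_minus_pos_lower_bound[of \<delta>] assms(2,3) by simp
  finally have "d - 2 * \<delta> \<le> d + ln (1 - \<delta>)" by simp
  also have "\<dots> = ln (exp d * (1 - \<delta>))" using assms(3) by (subst ln_mult) auto
  also have "\<dots> \<le> ln w" using l assms by (subst ln_le_cancel_iff) auto
  finally show ?thesis using 1 by simp
qed

lemma (in prob_space) markov_abs:
  fixes X :: "'a \<Rightarrow> real"
  assumes "integrable M X" "c > 0"
  shows "prob {x \<in> space M. \<bar>X x\<bar> \<ge> c} \<le> expectation (\<lambda>x. \<bar>X x\<bar>) / c"
  by (rule integral_Markov_inequality_measure[OF _ sets.empty_sets]) (use assms in auto)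

lemma geometric_tail:
  fixes lam :: real
  assumes "0 \<le> lam" "lam < 1"
  shows "(\<Sum>k=p..q. lam ^ k) \<le> lam ^ p / (1 - lam)"
proof (cases "p \<le> q")
  case True
  have "(1 - lam) * (\<Sum>k=p..q. lam ^ k) = lam ^ p - lam ^ Suc q" by (rule sum_gp_multiplied[OF True])
  also have "\<dots> \<le> lam ^ p" using assms by simp
  finally show ?thesis using assms by (simp add: le_divide_eq mult.commute)
qed (use assms in simp)

text \<open>The mean absolute value of the centred k-cycle is at most sqrt(2k) <= 2k, which cancels
  the denominator of the coefficient. What remains is a geometric tail, uniform in \<open>n\<close>
  and in the upper limit \<open>q\<close>.\<close>

lemma cycle_sum_bound:
  assumes lam: "0 \<le> lam" "lam < 1" and n: "n \<ge> 1" and p: "p \<ge> 1"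
  shows "(\<integral>x. \<bar>\<Sum>k=p..q. cycle_coeff lam k * cyc0 n k x\<bar> \<partial>gauss_space (idx n)) \<le> lam ^ p / (1 - lam)"
proof -
  interpret prob_space "gauss_space (idx n)" by (rule prob_space_gauss_space)
  note gi = gpoly_integrable[OF finite_idx]
  have i: "integrable (gauss_space (idx n)) (\<lambda>x. \<bar>cyc0 n k x\<bar>)" if "k \<in> {p..q}" for k
    using that p by (intro integrable_abs gi gpoly_cyc0) auto
  have "expectation (\<lambda>x. \<bar>\<Sum>k=p..q. cycle_coeff lam k * cyc0 n k x\<bar>) \<le> expectation (\<lambda>x. \<Sum>k=p..q. \<bar>cycle_coeff lam k\<bar> * \<bar>cyc0 n k x\<bar>)"
  proof (rule integral_mono)
    show "integrable (gauss_space (idx n)) (\<lambda>x. \<bar>\<Sum>k=p..q. cycle_coeff lam k * cyc0 n k x\<bar>)"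
      using p by (intro integrable_abs gi gpoly_sum gpoly_cmult gpoly_cyc0) auto
    show "integrable (gauss_space (idx n)) (\<lambda>x. \<Sum>k=p..q. \<bar>cycle_coeff lam k\<bar> * \<bar>cyc0 n k x\<bar>)"
      by (intro Bochner_Integration.integrable_sum integrable_mult_right i)
    show "\<bar>\<Sum>k=p..q. cycle_coeff lam k * cyc0 n k x\<bar> \<le> (\<Sum>k=p..q. \<bar>cycle_coeff lam k\<bar> * \<bar>cyc0 n k x\<bar>)" for x
      unfolding abs_mult[symmetric] by (rule sum_abs)
  qed
  also have "\<dots> = (\<Sum>k=p..q. \<bar>cycle_coeff lam k\<bar> * expectation (\<lambda>x. \<bar>cyc0 n k x\<bar>))"
    using i by (subst Bochner_Integration.integral_sum) auto
  also have "\<dots> \<le> (\<Sum>k=p..q. lam ^ k)"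
  proof (rule sum_mono)
    fix k assume k: "k \<in> {p..q}"
    show "\<bar>cycle_coeff lam k\<bar> * expectation (\<lambda>x. \<bar>cyc0 n k x\<bar>) \<le> lam ^ k"
    proof (cases "k \<ge> 2")
      case True
      have k1: "k \<ge> 1" using True by simp
      have "expectation (\<lambda>x. \<bar>cyc0 n k x\<bar>) \<le> sqrt (expectation (\<lambda>x. (cyc0 n k x)\<^sup>2))"
        by (rule expectation_abs_le_sqrt(2)) (auto intro!: gi gpoly_power gpoly_cyc0 gpoly_measurable k1)
      also have "\<dots> \<le> sqrt (limit_variance k)" by (intro real_sqrt_le_mono cyc0_second_moment n k1)
      also have "\<dots> \<le> 2 * real k"
      proof (rule real_le_lsqrt)
        show "limit_variance k \<le> (2 * real k)\<^sup>2"
          using True by (simp add: limit_variance_def power2_eq_square)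
      qed simp
      finally have "\<bar>cycle_coeff lam k\<bar> * expectation (\<lambda>x. \<bar>cyc0 n k x\<bar>) \<le> \<bar>cycle_coeff lam k\<bar> * (2 * real k)"
        by (rule mult_left_mono) simp
      also have "\<dots> = lam ^ k" using True lam by (simp add: cycle_coeff_def)
      finally show ?thesis .
    qed (use lam in \<open>simp add: cycle_coeff_def\<close>)
  qed
  also have "\<dots> \<le> lam ^ p / (1 - lam)" by (rule geometric_tail[OF lam])
  finally show ?thesis .
qed

lemma cycle_variance_tail:
  assumes lam: "0 \<le> lam" "lam < 1"
  shows "(\<Sum>k=p..q. lam ^ (2 * k) / (2 * real k)) / 2 \<le> lam ^ p / (1 - lam)"
proof -
  have "(\<Sum>k=p..q. lam ^ (2 * k) / (2 * real k)) / 2 \<le> (\<Sum>k=p..q. lam ^ k)"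
    unfolding sum_divide_distrib
  proof (rule sum_mono)
    fix k
    show "lam ^ (2 * k) / (2 * real k) / 2 \<le> lam ^ k"
    proof (cases "k = 0")
      case False
      have "lam ^ (2 * k) / (4 * real k) \<le> lam ^ (2 * k) / 1"
        using False lam by (intro divide_left_mono) auto
      also have "\<dots> \<le> lam ^ k" using lam by (simp add: power_decreasing)
      finally show ?thesis by simp
    qed simp
  qed
  then show ?thesis using geometric_tail[OF lam, of p q] by linarith
qed

text \<open>The bound depends on neither \<open>n\<close> nor \<open>M\<close>; it provides the
  tightness that keeps the cycle exponential away from 0.\<close>

lemma cycle_log_bound:
  assumes lam: "0 \<le> lam" "lam < 1" and n: "n \<ge> 1"
  shows "integrable (gauss_space (idx n)) (cycle_log lam M n)"
    "(\<integral>x. \<bar>cycle_log lam M n x\<bar> \<partial>gauss_space (idx n)) \<le> 2 / (1 - lam)"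
proof -
  interpret prob_space "gauss_space (idx n)" by (rule prob_space_gauss_space)
  have il: "integrable (gauss_space (idx n)) (lin (cycle_coeff lam) M n)" by (rule gpoly_integrable[OF finite_idx gpoly_lin])
  then show i: "integrable (gauss_space (idx n)) (cycle_log lam M n)" unfolding cycle_log_def[abs_def] by simp
  have "expectation (\<lambda>x. \<bar>cycle_log lam M n x\<bar>) \<le> expectation (\<lambda>x. \<bar>lin (cycle_coeff lam) M n x\<bar> + cycle_variance lam M / 2)"
    using i il cycle_variance_nonneg[of lam M] by (intro integral_mono) (auto simp: cycle_log_def)
  also have "\<dots> = expectation (\<lambda>x. \<bar>lin (cycle_coeff lam) M n x\<bar>) + cycle_variance lam M / 2"
    using il by (simp add: prob_space)
  also have "\<dots> \<le> lam ^ 1 / (1 - lam) + lam ^ 2 / (1 - lam)"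
    unfolding lin_def cycle_variance_def by (intro add_mono cycle_sum_bound cycle_variance_tail lam n) simp
  also have "\<dots> \<le> 1 / (1 - lam) + 1 / (1 - lam)"
    using lam by (intro add_mono divide_right_mono power_le_one) auto
  finally show "expectation (\<lambda>x. \<bar>cycle_log lam M n x\<bar>) \<le> 2 / (1 - lam)" by simp
qed

text \<open>Off an event of small probability the cycle sum lies between -B and B. There the
  truncation at \<open>\<tau> \<ge> B\<close> is inactive and the exponential is at least exp(-B),
  so the absolute error \<open>\<theta>\<close> is a relative error \<open>\<delta>\<close>, which
  \<open>ln_close\<close> turns into an error of the logarithm.\<close>

lemma ln_zcw_cycle_log:
  assumes lam: "0 \<le> lam" "lam < 1" and b: "0 \<le> b" "b < 1" and pos: "\<epsilon> > 0" "\<eta> > 0"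
  shows "\<exists>M0. \<forall>M\<ge>M0. \<forall>\<^sub>F n in sequentially.
    measure (gauss_space (idx n)) {x \<in> space (gauss_space (idx n)). \<bar>ln (zcw_normalized lam b n x) - cycle_log lam M n x\<bar> > \<epsilon>} \<le> \<eta>"
proof -
  define \<delta> where "\<delta> = min (\<epsilon> / 2) (1 / 2)"
  have \<delta>: "0 < \<delta>" "\<delta> \<le> 1/2" "2 * \<delta> \<le> \<epsilon>" using pos by (auto simp: \<delta>_def)
  \<comment> \<open>Chosen so that Markov's inequality with the mean bound 2/(1 - lam) yields the
    probability \<open>\<eta> / 2\<close>.\<close>
  define B where "B = 4 / ((1 - lam) * \<eta>)"
  have B: "B > 0" using lam pos by (simp add: B_def)
  define \<theta> where "\<theta> = \<delta> * exp (- B)"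
  have \<theta>: "\<theta> > 0" using \<delta> by (simp add: \<theta>_def)
  obtain M0 where M0: "\<And>M. M \<ge> M0 \<Longrightarrow> \<exists>\<tau>\<ge>B. \<forall>\<^sub>F n in sequentially.
    (\<integral>x. \<bar>zcw_normalized lam b n x - cycle_exp lam M \<tau> n x\<bar> \<partial>gauss_space (idx n)) < \<theta> * (\<eta> / 2)"
    using zcw_normalized_approx[OF lam b, of "\<theta> * (\<eta> / 2)" B] \<theta> pos by auto
  have "\<forall>\<^sub>F n in sequentially.
    measure (gauss_space (idx n)) {x \<in> space (gauss_space (idx n)). \<bar>ln (zcw_normalized lam b n x) - cycle_log lam M n x\<bar> > \<epsilon>} \<le> \<eta>"
    if M: "M \<ge> M0" for M
  proof -
    obtain \<tau> where \<tau>: "\<tau> \<ge> B" and ev: "\<forall>\<^sub>F n in sequentially.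
      (\<integral>x. \<bar>zcw_normalized lam b n x - cycle_exp lam M \<tau> n x\<bar> \<partial>gauss_space (idx n)) < \<theta> * (\<eta> / 2)"
      using M0[OF M] by blast
    show ?thesis using ev eventually_ge_at_top[of 1]
    proof eventually_elim
      case (elim n)
      then have n: "n \<ge> 1" by simp
      let ?G = "gauss_space (idx n)"
      interpret prob_space ?G by (rule prob_space_gauss_space)
      let ?Z = "zcw_normalized lam b n" and ?l = "cycle_log lam M n" and ?\<psi> = "cycle_exp lam M \<tau> n"
      note [measurable] = zcw_normalized_measurable[of lam b n] cycle_log_measurable[of lam M n] cycle_exp_measurable[of lam M \<tau> n]
      let ?E1 = "{x \<in> space ?G. \<bar>?l x\<bar> \<ge> B}" and ?E2 = "{x \<in> space ?G. \<bar>?Z x - ?\<psi> x\<bar> \<ge> \<theta>}"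
      have iZ: "integrable ?G (\<lambda>x. ?Z x - ?\<psi> x)"
        unfolding zcw_normalized_def by (intro Bochner_Integration.integrable_diff integrable_mult_left zcw_integrable n cycle_exp_integrable)
      have sub: "{x \<in> space ?G. \<bar>ln (?Z x) - ?l x\<bar> > \<epsilon>} \<subseteq> ?E1 \<union> ?E2"
      proof (rule subsetI, rule ccontr)
        fix x assume x: "x \<in> {x \<in> space ?G. \<bar>ln (?Z x) - ?l x\<bar> > \<epsilon>}" and "x \<notin> ?E1 \<union> ?E2"
        then have 1: "\<bar>?l x\<bar> < B" and 2: "\<bar>?Z x - ?\<psi> x\<bar> < \<theta>" by auto
        have \<psi>: "?\<psi> x = exp (?l x)" using 1 \<tau> by (simp add: cycle_exp_eq min_absorb1)
        have "\<theta> \<le> \<delta> * exp (?l x)" using 1 \<delta> unfolding \<theta>_def by (intro mult_left_mono) auto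
        then have "\<bar>?Z x - exp (?l x)\<bar> \<le> \<delta> * exp (?l x)" using 2 \<psi> by simp
        then have "\<bar>ln (?Z x) - ?l x\<bar> \<le> 2 * \<delta>" by (intro ln_close zcw_normalized_pos b \<delta>)
        then show False using x \<delta>(3) by simp
      qed
      have "prob {x \<in> space ?G. \<bar>ln (?Z x) - ?l x\<bar> > \<epsilon>} \<le> prob (?E1 \<union> ?E2)"
        by (rule finite_measure_mono[OF sub]) measurable
      also have "\<dots> \<le> prob ?E1 + prob ?E2" by (rule measure_Un_le) measurable
      also have "prob ?E1 \<le> expectation (\<lambda>x. \<bar>?l x\<bar>) / B" by (rule markov_abs[OF cycle_log_bound(1)[OF lam n] B])
      also have "\<dots> \<le> (2 / (1 - lam)) / B" using cycle_log_bound(2)[OF lam n] B by (intro divide_right_mono) auto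
      also have "\<dots> = \<eta> / 2" using lam pos by (simp add: B_def)
      also have "prob ?E2 \<le> expectation (\<lambda>x. \<bar>?Z x - ?\<psi> x\<bar>) / \<theta>" by (rule markov_abs[OF iZ \<theta>])
      also have "\<dots> \<le> \<theta> * (\<eta> / 2) / \<theta>" using elim(1) \<theta> by (intro divide_right_mono) auto
      also have "\<dots> = \<eta> / 2" using \<theta> by simp
      finally show ?case by simp
    qed
  qed
  then show ?thesis by blast
qed

text \<open>A fixed cutoff \<open>M\<close> is inserted: \<open>ln_zcw_cycle_log\<close> compares
  the logarithm with the sum up to \<open>M\<close>, and the terms from M + 1 to \<open>m n\<close>
  have a geometric tail in mean, uniformly in \<open>n\<close>.\<close>

lemma ln_zcw_converges_in_probability:
  assumes lam: "0 \<le> lam" "lam < 1" and b: "0 \<le> b" "b < 1" and m: "filterlim m at_top sequentially" and \<epsilon>: "\<epsilon> > 0"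
  shows "(\<lambda>n. measure (gauss_space (idx n)) {x \<in> space (gauss_space (idx n)). \<bar>ln (zcw_normalized lam b n x) - cycle_log lam (m n) n x\<bar> > \<epsilon>}) \<longlonglongrightarrow> 0"
proof (rule tendstoI)
  fix \<eta> :: real assume \<eta>: "\<eta> > 0"
  obtain M0 where M0: "\<And>M. M \<ge> M0 \<Longrightarrow> \<forall>\<^sub>F n in sequentially.
    measure (gauss_space (idx n)) {x \<in> space (gauss_space (idx n)). \<bar>ln (zcw_normalized lam b n x) - cycle_log lam M n x\<bar> > \<epsilon> / 2} \<le> \<eta> / 4"
    using ln_zcw_cycle_log[OF lam b, of "\<epsilon> / 2" "\<eta> / 4"] \<epsilon> \<eta> by auto
  have "(\<lambda>M. (2 * lam ^ Suc M / (1 - lam)) / (\<epsilon> / 2)) \<longlonglongrightarrow> (2 * 0 / (1 - lam)) / (\<epsilon> / 2)"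
    by (intro tendsto_intros LIMSEQ_Suc LIMSEQ_power_zero) (use lam \<epsilon> in auto)
  then have "\<forall>\<^sub>F M in sequentially. (2 * lam ^ Suc M / (1 - lam)) / (\<epsilon> / 2) < \<eta> / 4"
    by (rule order_tendstoD(2)) (use \<eta> in simp)
  from eventually_conj[OF this eventually_ge_at_top[of "max M0 1"]]
  obtain M where M: "(2 * lam ^ Suc M / (1 - lam)) / (\<epsilon> / 2) < \<eta> / 4" "M \<ge> M0" "M \<ge> 1"
    unfolding eventually_sequentially by (metis max.bounded_iff order_refl)
  have "\<forall>\<^sub>F n in sequentially. M \<le> m n" using m by (simp add: filterlim_at_top)
  then show "\<forall>\<^sub>F n in sequentially. dist (measure (gauss_space (idx n)) {x \<in> space (gauss_space (idx n)). \<bar>ln (zcw_normalized lam b n x) - cycle_log lam (m n) n x\<bar> > \<epsilon>}) 0 < \<eta>"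
    using M0[OF M(2)] eventually_ge_at_top[of 1]
  proof eventually_elim
    case (elim n)
    let ?G = "gauss_space (idx n)"
    interpret prob_space ?G by (rule prob_space_gauss_space)
    let ?Z = "zcw_normalized lam b n" and ?l = "cycle_log lam M n" and ?l' = "cycle_log lam (m n) n"
    note [measurable] = zcw_normalized_measurable[of lam b n] cycle_log_measurable[of lam M n] cycle_log_measurable[of lam "m n" n]
    let ?D = "\<lambda>x. ?l' x - ?l x"
    let ?S = "\<lambda>x. \<Sum>k=Suc M..m n. cycle_coeff lam k * cyc0 n k x"
    let ?V = "(\<Sum>k=Suc M..m n. lam ^ (2 * k) / (2 * real k)) / 2"
    have D: "?D x = ?S x - ?V" for x
    proof -
      have sp: "sum f {p..m n} = sum f {p..M} + sum f {Suc M..m n}" if "p \<le> Suc M" for f :: "nat \<Rightarrow> real" and p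
      proof -
        have "{p..m n} = {p..M} \<union> {Suc M..m n}" using that elim(1) by auto
        moreover have "{p..M} \<inter> {Suc M..m n} = {}" by auto
        ultimately show ?thesis by (simp add: sum.union_disjoint)
      qed
      show ?thesis unfolding cycle_log_def lin_def cycle_variance_def
        using sp[of 1 "\<lambda>k. cycle_coeff lam k * cyc0 n k x"] sp[of 2 "\<lambda>k. lam ^ (2 * k) / (2 * real k)"] M(3)
        by (simp add: add_divide_distrib)
    qed
    have n: "n \<ge> 1" using elim by simp
    have iS: "integrable ?G ?S" by (intro gpoly_integrable[OF finite_idx] gpoly_sum gpoly_cmult gpoly_cyc0) simp
    have iD: "integrable ?G ?D" unfolding D using iS by simp
    have V0: "?V \<ge> 0" by (intro divide_nonneg_nonneg sum_nonneg) (auto simp: power_mult)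
    have "expectation (\<lambda>x. \<bar>?D x\<bar>) \<le> expectation (\<lambda>x. \<bar>?S x\<bar> + ?V)"
    proof (rule integral_mono)
      show "integrable ?G (\<lambda>x. \<bar>?D x\<bar>)" by (rule integrable_abs[OF iD])
      show "integrable ?G (\<lambda>x. \<bar>?S x\<bar> + ?V)" using iS by simp
      show "\<bar>?D x\<bar> \<le> \<bar>?S x\<bar> + ?V" for x unfolding D using V0 by linarith
    qed
    also have "\<dots> = expectation (\<lambda>x. \<bar>?S x\<bar>) + ?V" using iS by (simp add: prob_space)
    also have "\<dots> \<le> lam ^ Suc M / (1 - lam) + lam ^ Suc M / (1 - lam)"
      by (intro add_mono cycle_sum_bound cycle_variance_tail lam n) simp
    finally have ED: "expectation (\<lambda>x. \<bar>?D x\<bar>) \<le> 2 * lam ^ Suc M / (1 - lam)" by simp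
    let ?E1 = "{x \<in> space ?G. \<bar>ln (?Z x) - ?l x\<bar> > \<epsilon> / 2}" and ?E2 = "{x \<in> space ?G. \<bar>?D x\<bar> \<ge> \<epsilon> / 2}"
    have "prob {x \<in> space ?G. \<bar>ln (?Z x) - ?l' x\<bar> > \<epsilon>} \<le> prob (?E1 \<union> ?E2)"
    proof (rule finite_measure_mono)
      show "{x \<in> space ?G. \<bar>ln (?Z x) - ?l' x\<bar> > \<epsilon>} \<subseteq> ?E1 \<union> ?E2"
      proof (rule subsetI, rule ccontr)
        fix x assume "x \<in> {x \<in> space ?G. \<bar>ln (?Z x) - ?l' x\<bar> > \<epsilon>}" "x \<notin> ?E1 \<union> ?E2"
        then have "\<bar>ln (?Z x) - ?l' x\<bar> > \<epsilon>" "\<bar>ln (?Z x) - ?l x\<bar> \<le> \<epsilon> / 2" "\<bar>?D x\<bar> < \<epsilon> / 2" by auto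
        then show False by linarith
      qed
    qed measurable
    also have "\<dots> \<le> prob ?E1 + prob ?E2" by (rule measure_Un_le) measurable
    also have "prob ?E1 \<le> \<eta> / 4" by (rule elim(2))
    also have "prob ?E2 \<le> expectation (\<lambda>x. \<bar>?D x\<bar>) / (\<epsilon> / 2)" by (rule markov_abs[OF iD]) (use \<epsilon> in simp)
    also have "\<dots> \<le> (2 * lam ^ Suc M / (1 - lam)) / (\<epsilon> / 2)" using \<epsilon> ED by (intro divide_right_mono) auto
    also have "\<dots> \<le> \<eta> / 4" using M(1) by simp
    finally show ?case using \<eta> by simp
  qed
qed

section \<open>Limit laws\<close>

lemma iexp_diff_bound: "norm (iexp (t * u) - iexp (t * w)) \<le> \<bar>t\<bar> * \<bar>u - w\<bar>" "norm (iexp (t * u) - iexp (t * w)) \<le> 2"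
proof -
  have "iexp (t * u) - iexp (t * w) = iexp (t * w) * (iexp (t * (u - w)) - 1)"
    by (simp add: algebra_simps exp_add[symmetric])
  then have "norm (iexp (t * u) - iexp (t * w)) = norm (iexp (t * (u - w)) - 1)"
    by (simp add: norm_mult)
  also have "\<dots> \<le> \<bar>t * (u - w)\<bar>" using iexp_approx1[of "t * (u - w)" 0] by simp
  finally show "norm (iexp (t * u) - iexp (t * w)) \<le> \<bar>t\<bar> * \<bar>u - w\<bar>" by (simp add: abs_mult)
  have "norm (iexp (t * u) - iexp (t * w)) \<le> norm (iexp (t * u)) + norm (iexp (t * w))" by (rule norm_triangle_ineq4)
  then show "norm (iexp (t * u) - iexp (t * w)) \<le> 2" by simp
qed

text \<open>Where the variables are close the exponentials differ by at most |t| epsilon; elsewhere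
  they differ by at most 2.\<close>

lemma (in prob_space) char_close:
  fixes U W :: "'a \<Rightarrow> real"
  assumes [measurable]: "U \<in> borel_measurable M" "W \<in> borel_measurable M" and \<epsilon>: "\<epsilon> \<ge> 0"
  shows "norm (expectation (\<lambda>x. iexp (t * U x)) - expectation (\<lambda>x. iexp (t * W x)))
    \<le> \<bar>t\<bar> * \<epsilon> + 2 * prob {x \<in> space M. \<bar>U x - W x\<bar> > \<epsilon>}"
proof -
  let ?A = "{x \<in> space M. \<bar>U x - W x\<bar> > \<epsilon>}"
  have A: "?A \<in> sets M" by measurable
  have i: "integrable M (\<lambda>x. iexp (t * V x))" if [measurable]: "V \<in> borel_measurable M" for V
    by (rule integrable_const_bound[of _ 1]) auto
  have "norm (expectation (\<lambda>x. iexp (t * U x)) - expectation (\<lambda>x. iexp (t * W x))) = norm (expectation (\<lambda>x. iexp (t * U x) - iexp (t * W x)))"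
    using i[of U] i[of W] by simp
  also have "\<dots> \<le> expectation (\<lambda>x. norm (iexp (t * U x) - iexp (t * W x)))" by (rule integral_norm_bound)
  also have "\<dots> \<le> expectation (\<lambda>x. \<bar>t\<bar> * \<epsilon> + 2 * indicator ?A x)"
  proof (rule integral_mono)
    show "integrable M (\<lambda>x. norm (iexp (t * U x) - iexp (t * W x)))"
      using i[of U] i[of W] by (intro integrable_norm Bochner_Integration.integrable_diff) auto
    show "integrable M (\<lambda>x. \<bar>t\<bar> * \<epsilon> + 2 * indicator ?A x)"
      using A by (intro Bochner_Integration.integrable_add integrable_const integrable_mult_right integrable_real_indicator)
        (auto simp: less_top[symmetric])
    fix x assume x: "x \<in> space M"
    show "norm (iexp (t * U x) - iexp (t * W x)) \<le> \<bar>t\<bar> * \<epsilon> + 2 * indicator ?A x"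
    proof (cases "x \<in> ?A")
      case True
      then have ind: "indicator ?A x = (1::real)" by (rule indicator_simps(1))
      show ?thesis unfolding ind using iexp_diff_bound(2)[of t "U x" "W x"] \<epsilon> by (intro order_trans[OF iexp_diff_bound(2)]) simp
    next
      case False
      then have ind: "indicator ?A x = (0::real)" by (rule indicator_simps(2))
      have "\<bar>U x - W x\<bar> \<le> \<epsilon>" using False x by simp
      then have "\<bar>t\<bar> * \<bar>U x - W x\<bar> \<le> \<bar>t\<bar> * \<epsilon>" by (rule mult_left_mono) simp
      then show ?thesis unfolding ind using iexp_diff_bound(1)[of t "U x" "W x"] by linarith
    qed
  qed
  also have "\<dots> = \<bar>t\<bar> * \<epsilon> + 2 * prob ?A"
  proof -
    have "integrable M (indicator ?A :: 'a \<Rightarrow> real)"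
      using A by (intro integrable_real_indicator) (auto simp: less_top[symmetric])
    then show ?thesis using A by (simp add: prob_space)
  qed
  finally show ?thesis .
qed

text \<open>\<open>M\<close> is fixed first, large enough for the logarithm to be close to
  \<open>cycle_log\<close> and for the Gaussian with the variance of the first \<open>M\<close>
  cycles to be close to the final one; then \<open>n\<close> grows with a finite cycle sum.\<close>

lemma ln_zcw_char_tendsto:
  assumes lam: "0 \<le> lam" "lam < 1" and b: "0 \<le> b" "b < 1"
  defines "v \<equiv> - ln (1 - lam\<^sup>2) / 2 - lam\<^sup>2 / 2"
  shows "(\<lambda>n. \<integral>x. iexp (t * (lam / 2 * cyc n 1 x + ln (zcw_normalized lam b n x))) \<partial>gauss_space (idx n)) \<longlonglongrightarrow>
    iexp (t * (- v / 2)) * of_real (exp (- (lam\<^sup>2 / 4 + v) * t\<^sup>2 / 2))"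
proof (rule tendstoI)
  fix \<eta> :: real assume \<eta>: "\<eta> > 0"
  let ?c = "\<lambda>u s. iexp (t * (- u / 2)) * complex_of_real (exp (- s * t\<^sup>2 / 2))"
  define \<epsilon> where "\<epsilon> = \<eta> / (8 * (\<bar>t\<bar> + 1))"
  have \<epsilon>: "\<epsilon> > 0" "\<bar>t\<bar> * \<epsilon> \<le> \<eta> / 8"
  proof -
    show "\<epsilon> > 0" using \<eta> by (simp add: \<epsilon>_def)
    have "\<bar>t\<bar> * \<epsilon> \<le> (\<bar>t\<bar> + 1) * \<epsilon>" using \<open>\<epsilon> > 0\<close> by (intro mult_right_mono) auto
    also have "\<dots> = \<eta> / 8" by (simp add: \<epsilon>_def field_simps)
    finally show "\<bar>t\<bar> * \<epsilon> \<le> \<eta> / 8" .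
  qed
  obtain M0 where M0: "\<And>M. M \<ge> M0 \<Longrightarrow> \<forall>\<^sub>F n in sequentially.
    measure (gauss_space (idx n)) {x \<in> space (gauss_space (idx n)). \<bar>ln (zcw_normalized lam b n x) - cycle_log lam M n x\<bar> > \<epsilon>} \<le> \<eta> / 16"
    using ln_zcw_cycle_log[OF lam b, of \<epsilon> "\<eta> / 16"] \<epsilon> \<eta> by auto
  have "(\<lambda>M. ?c (cycle_variance lam M) (lam\<^sup>2 / 4 + cycle_variance lam M)) \<longlonglongrightarrow> ?c v (lam\<^sup>2 / 4 + v)"
    unfolding v_def by (intro tendsto_intros cycle_variance_tendsto lam) auto
  then have "\<forall>\<^sub>F M in sequentially. dist (?c (cycle_variance lam M) (lam\<^sup>2 / 4 + cycle_variance lam M)) (?c v (lam\<^sup>2 / 4 + v)) < \<eta> / 4"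
    by (rule tendstoD) (use \<eta> in simp)
  from eventually_happens[OF eventually_conj[OF this eventually_ge_at_top[of "max M0 1"]]]
  obtain M where M: "dist (?c (cycle_variance lam M) (lam\<^sup>2 / 4 + cycle_variance lam M)) (?c v (lam\<^sup>2 / 4 + v)) < \<eta> / 4"
    "M \<ge> M0" "M \<ge> 1" by auto
  let ?v = "cycle_variance lam M"
  \<comment> \<open>The diagonal enters as the cycle of length 1 with coefficient lam/2, which is
    beta in the model. One central limit theorem thus gives the joint law, and the diagonal adds
    lam^2/4 to the variance.\<close>
  define a where "a = (\<lambda>k. if k = 1 then lam / 2 else cycle_coeff lam k)"
  have sp: "{1..M} = insert 1 {2..M}" using M(3) by auto
  have lina: "lin a M n x = lam / 2 * cyc n 1 x + lin (cycle_coeff lam) M n x" for n x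
    unfolding lin_def sp by (simp add: a_def cyc0_def cycle_coeff_def)
  have va: "lin_variance a M = lam\<^sup>2 / 4 + ?v"
    unfolding cycle_variance_eq(1)[symmetric] lin_variance_def sp
    by (simp add: a_def limit_variance_def cycle_coeff_def power_divide)
  have "(\<lambda>n. iexp (t * (- ?v / 2)) * (\<integral>x. iexp (t * lin a M n x) \<partial>gauss_space (idx n))) \<longlonglongrightarrow> ?c ?v (lam\<^sup>2 / 4 + ?v)"
    using tendsto_mult[OF tendsto_const lin_char_tendsto[of t a M]] unfolding va .
  then have "\<forall>\<^sub>F n in sequentially. dist (iexp (t * (- ?v / 2)) * (\<integral>x. iexp (t * lin a M n x) \<partial>gauss_space (idx n))) (?c ?v (lam\<^sup>2 / 4 + ?v)) < \<eta> / 4"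
    by (rule tendstoD) (use \<eta> in simp)
  then show "\<forall>\<^sub>F n in sequentially. dist (\<integral>x. iexp (t * (lam / 2 * cyc n 1 x + ln (zcw_normalized lam b n x))) \<partial>gauss_space (idx n)) (?c v (lam\<^sup>2 / 4 + v)) < \<eta>"
    using M0[OF M(2)]
  proof eventually_elim
    case (elim n)
    let ?G = "gauss_space (idx n)"
    interpret prob_space ?G by (rule prob_space_gauss_space)
    let ?Z = "zcw_normalized lam b n" and ?l = "cycle_log lam M n"
    note [measurable] = zcw_normalized_measurable[of lam b n] cycle_log_measurable[of lam M n]
    have [measurable]: "cyc n 1 \<in> borel_measurable ?G" by (rule gpoly_measurable[OF gpoly_cyc]) simp
    let ?U = "\<lambda>x. lam / 2 * cyc n 1 x + ln (?Z x)" and ?W = "\<lambda>x. lam / 2 * cyc n 1 x + ?l x"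
    have "norm (expectation (\<lambda>x. iexp (t * ?U x)) - expectation (\<lambda>x. iexp (t * ?W x))) \<le> \<bar>t\<bar> * \<epsilon> + 2 * prob {x \<in> space ?G. \<bar>?U x - ?W x\<bar> > \<epsilon>}"
      by (rule char_close) (measurable, use \<epsilon> in simp)
    also have "\<dots> \<le> \<eta> / 8 + 2 * (\<eta> / 16)" using \<epsilon>(2) elim(2) by (intro add_mono mult_left_mono) auto
    finally have 1: "dist (expectation (\<lambda>x. iexp (t * ?U x))) (expectation (\<lambda>x. iexp (t * ?W x))) \<le> \<eta> / 4" by (simp add: dist_norm)
    have W: "?W x = lin a M n x + (- ?v / 2)" for x by (simp add: lina cycle_log_def)
    have "expectation (\<lambda>x. iexp (t * ?W x)) = expectation (\<lambda>x. iexp (t * (- ?v / 2)) * iexp (t * lin a M n x))"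
      unfolding W by (rule Bochner_Integration.integral_cong) (auto simp: exp_add[symmetric] algebra_simps)
    then have "expectation (\<lambda>x. iexp (t * ?W x)) = iexp (t * (- ?v / 2)) * expectation (\<lambda>x. iexp (t * lin a M n x))"
      by (simp only: integral_mult_right_zero)
    with elim(1) have 2: "dist (expectation (\<lambda>x. iexp (t * ?W x))) (?c ?v (lam\<^sup>2 / 4 + ?v)) < \<eta> / 4" by (simp only:)
    show ?case
      using 1 2 M(1) dist_triangle[of "expectation (\<lambda>x. iexp (t * ?U x))" "?c v (lam\<^sup>2 / 4 + v)" "expectation (\<lambda>x. iexp (t * ?W x))"]
        dist_triangle[of "expectation (\<lambda>x. iexp (t * ?W x))" "?c v (lam\<^sup>2 / 4 + v)" "?c ?v (lam\<^sup>2 / 4 + ?v)"] \<eta>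
      by linarith
  qed
qed

section \<open>From the matrix model to the Gaussian product space\<close>

lemma partition_function_eq:
  assumes n: "n \<ge> 1"
  shows "partition_function J J' \<beta> n (\<lambda>i j. x (edge i j)) =
    exp (\<beta> * cyc n 1 x + \<beta> * (J' - J) + (real n - 1) * \<beta>\<^sup>2) * zcw (2 * \<beta>) (2 * \<beta> * J) n x"
proof -
  have t1: "tuples n 1 = (\<lambda>i. [i]) ` {1..n}" by (auto simp: tuples_def length_Suc_conv)
  have c1: "cyc n 1 x = (\<Sum>i=1..n. x (i, i)) / sqrt n"
    unfolding cyc_def t1 by (simp add: sum.reindex inj_on_def cycle_edges_def closing_edge_def edge_def)
  \<comment> \<open>The summand (n - 1) beta^2 restores the constant lam^2 (n - 1)/4 that
    \<open>spin_weight\<close> subtracts, with lam = 2 beta.\<close>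
  have "exp (\<beta> * hamiltonian J J' n (\<lambda>i j. x (edge i j)) \<sigma>) =
     exp (\<beta> * cyc n 1 x + \<beta> * (J' - J) + (real n - 1) * \<beta>\<^sup>2) *
     (exp (2 * \<beta> * J * (\<Sum>i=1..n. \<sigma> i)\<^sup>2 / (2 * n)) * spin_weight (2 * \<beta>) n \<sigma> x)"
    if \<sigma>: "\<sigma> \<in> spins n" for \<sigma>
  proof -
    let ?f = "\<lambda>i j. x (edge i j) * (\<sigma> i * \<sigma> j)"
    let ?P = "\<Sum>e\<in>idx n. if fst e < snd e then ?f (fst e) (snd e) else 0"
    have f1: "(\<Sum>i=1..n. \<Sum>j=1..n. ?f i j) = (\<Sum>i=1..n. ?f i i) + 2 * ?P"
      by (rule sum_symmetric_pairs) (simp add: edge_commute mult.commute)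
    have f2: "(\<Sum>i=1..n. ?f i i) = (\<Sum>i=1..n. x (i, i))"
      by (rule sum.cong[OF refl]) (use spins_square[OF \<sigma>] in \<open>simp add: edge_def power2_eq_square\<close>)
    have f3: "spin_field (2 * \<beta>) n \<sigma> x = 2 * \<beta> / sqrt n * ?P"
      unfolding spin_field_def sum_distrib_left
      by (rule sum.cong[OF refl]) (auto simp: spin_shift_def edge_def min_def max_def)
    \<comment> \<open>The coupling \<open>J\<close> is extended to the diagonal in order to obtain a
      full square; the correction by \<open>J' - J\<close> there does not depend on the
      spins.\<close>
    have f4: "(\<Sum>i=1..n. \<Sum>j=1..n. (if i = j then (J' - J) else 0) * (\<sigma> i * \<sigma> j)) = (J' - J) * n"
    proof -
      have "(\<Sum>i=1..n. \<Sum>j=1..n. (if i = j then (J' - J) else 0) * (\<sigma> i * \<sigma> j)) = (\<Sum>i=1..n. (J' - J))"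
      proof (rule sum.cong[OF refl])
        fix i assume i: "i \<in> {1..n}"
        have "(\<Sum>j=1..n. (if i = j then (J' - J) else 0) * (\<sigma> i * \<sigma> j)) = (\<Sum>j=1..n. if i = j then (J' - J) * (\<sigma> i * \<sigma> j) else 0)"
          by (rule sum.cong) auto
        also have "\<dots> = (J' - J) * (\<sigma> i * \<sigma> i)" using i by (simp add: sum.delta)
        also have "\<dots> = J' - J" using spins_square[OF \<sigma> i] by (simp add: power2_eq_square)
        finally show "(\<Sum>j=1..n. (if i = j then (J' - J) else 0) * (\<sigma> i * \<sigma> j)) = J' - J" .
      qed
      then show ?thesis by simp
    qed
    have "hamiltonian J J' n (\<lambda>i j. x (edge i j)) \<sigma> = (\<Sum>i=1..n. \<Sum>j=1..n. ?f i j / sqrt n + J / n * (\<sigma> i * \<sigma> j) + (1 / n) * ((if i = j then (J' - J) else 0) * (\<sigma> i * \<sigma> j)))"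
      unfolding hamiltonian_def interaction_def sum_distrib_left
      by (intro sum.cong refl) (simp add: field_simps)
    also have "\<dots> = (\<Sum>i=1..n. \<Sum>j=1..n. ?f i j) / sqrt n + J / n * (\<Sum>i=1..n. \<sigma> i)\<^sup>2 + (1 / n) * ((J' - J) * n)"
      unfolding f4[symmetric] power2_eq_square sum_product
      by (simp only: sum.distrib sum_distrib_left sum_divide_distrib)
    finally have H: "hamiltonian J J' n (\<lambda>i j. x (edge i j)) \<sigma> = cyc n 1 x + 2 * ?P / sqrt n + J / n * (\<Sum>i=1..n. \<sigma> i)\<^sup>2 + (J' - J)"
      unfolding f1 f2 c1 using n by (simp add: add_divide_distrib)
    show ?thesis
      unfolding spin_weight_def exp_add[symmetric] f3 H using n
      by (simp add: field_simps power2_eq_square)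
  qed
  then show ?thesis
    unfolding partition_function_def zcw_def spins_def[symmetric]
    by (simp add: sum_distrib_left mult_ac)
qed

text \<open>Independence identifies the joint law of the upper triangle with the product measure,
  and symmetry recovers the entries below the diagonal. So every statistic of \<open>A\<close> is a
  function of \<open>T\<close>.\<close>

lemma gaussian_matrix_law:
  fixes A :: "'a \<Rightarrow> nat \<Rightarrow> nat \<Rightarrow> real"
  assumes n: "n \<ge> 1" and A: "gaussian_symmetric_matrix \<Omega> n A"
  defines "T \<equiv> \<lambda>\<omega>. \<lambda>e\<in>idx n. A \<omega> (fst e) (snd e)"
  shows "T \<in> measurable \<Omega> (gauss_space (idx n))"
    and "distr \<Omega> (gauss_space (idx n)) T = gauss_space (idx n)"
    and "\<And>\<omega> i j. \<omega> \<in> space \<Omega> \<Longrightarrow> i \<in> {1..n} \<Longrightarrow> j \<in> {1..n} \<Longrightarrow> A \<omega> i j = T \<omega> (edge i j)"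
proof -
  interpret prob_space \<Omega> using A by (simp add: gaussian_symmetric_matrix_def)
  let ?X = "\<lambda>e \<omega>. A \<omega> (fst e) (snd e)"
  have d: "distributed \<Omega> lborel (?X e) std_normal_density" if "e \<in> idx n" for e
    using A that unfolding gaussian_symmetric_matrix_def idx_def by auto
  have rv: "random_variable borel (?X e)" if "e \<in> idx n" for e
    using distributed_measurable[OF d[OF that]] by simp
  have de: "distr \<Omega> borel (?X e) = std_normal_distribution" if "e \<in> idx n" for e
  proof -
    have "distr \<Omega> borel (?X e) = distr \<Omega> lborel (?X e)" by (rule distr_cong) auto
    then show ?thesis using distributed_distr_eq_density[OF d[OF that]] by simp
  qed
  have ind: "indep_vars (\<lambda>_. borel) ?X (idx n)"
  proof -
    have "(\<lambda>(i, j) \<omega>. A \<omega> i j) = ?X" by (simp add: fun_eq_iff case_prod_unfold)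
    then show ?thesis using A unfolding gaussian_symmetric_matrix_def idx_def by metis
  qed
  have ne: "idx n \<noteq> {}" using n by (auto simp: idx_def intro!: exI[of _ 1])
  have "distr \<Omega> (PiM (idx n) (\<lambda>_. borel)) (\<lambda>\<omega>. \<lambda>e\<in>idx n. ?X e \<omega>) = PiM (idx n) (\<lambda>e. distr \<Omega> borel (?X e))"
    using ind indep_vars_iff_distr_eq_PiM'[where X = ?X and M' = "\<lambda>_. borel" and I = "idx n", OF ne rv] by blast
  also have "\<dots> = gauss_space (idx n)"
    unfolding gauss_space_def by (rule PiM_cong) (auto simp: de)
  also have "distr \<Omega> (PiM (idx n) (\<lambda>_. borel)) (\<lambda>\<omega>. \<lambda>e\<in>idx n. ?X e \<omega>) = distr \<Omega> (gauss_space (idx n)) T"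
    unfolding T_def by (rule distr_cong) (auto simp: sets_gauss_space)
  finally show "distr \<Omega> (gauss_space (idx n)) T = gauss_space (idx n)" .
  show "T \<in> measurable \<Omega> (gauss_space (idx n))"
    unfolding T_def measurable_cong_sets[OF refl sets_gauss_space]
    by (rule measurable_restrict) (rule rv)
  fix \<omega> i j assume w: "\<omega> \<in> space \<Omega>" "i \<in> {1..n}" "j \<in> {1..n}"
  have "A \<omega> i j = A \<omega> j i" using A w unfolding gaussian_symmetric_matrix_def by blast
  moreover have "edge i j \<in> idx n" using w by (intro edge_in_idx)
  ultimately show "A \<omega> i j = T \<omega> (edge i j)"
    by (cases "i \<le> j") (simp_all add: T_def edge_def min_def max_def)
qed

lemma partition_function_cong:
  assumes "\<And>i j. i \<in> {1..n} \<Longrightarrow> j \<in> {1..n} \<Longrightarrow> A i j = B i j"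
  shows "partition_function J J' \<beta> n A = partition_function J J' \<beta> n B"
proof -
  have "hamiltonian J J' n A \<sigma> = hamiltonian J J' n B \<sigma>" for \<sigma>
    unfolding hamiltonian_def interaction_def
    by (intro sum.cong refl arg_cong2[of _ _ _ _ "(*)"]) (simp add: assms)
  then show ?thesis by (simp add: partition_function_def)
qed

lemma signed_cycle_cong:
  assumes "\<And>i j. i \<in> {1..n} \<Longrightarrow> j \<in> {1..n} \<Longrightarrow> A i j = B i j" and k: "k \<ge> 1"
  shows "signed_cycle n k A = signed_cycle n k B"
proof -
  have "(\<Prod>l<k. A (is ! l) (is ! ((l + 1) mod k))) = (\<Prod>l<k. B (is ! l) (is ! ((l + 1) mod k)))"
    if "is \<in> tuples n k" for "is"
  proof (rule prod.cong[OF refl])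
    fix l assume l: "l \<in> {..<k}"
    have "length is = k" "set is \<subseteq> {1..n}" using that by (auto simp: tuples_def)
    moreover have "(l + 1) mod k < k" using k by simp
    ultimately have "is ! l \<in> {1..n}" "is ! ((l + 1) mod k) \<in> {1..n}"
      using l nth_mem by (metis lessThan_iff subsetD)+
    then show "A (is ! l) (is ! ((l + 1) mod k)) = B (is ! l) (is ! ((l + 1) mod k))" by (rule assms(1))
  qed
  then have "(\<Sum>is\<in>tuples n k. \<Prod>l<k. A (is ! l) (is ! ((l + 1) mod k))) = (\<Sum>is\<in>tuples n k. \<Prod>l<k. B (is ! l) (is ! ((l + 1) mod k)))"
    by (rule sum.cong[OF refl])
  then show ?thesis unfolding signed_cycle_def tuples_def[symmetric] by (simp add: assms(1))
qed

lemma log_partition_function: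
  assumes n: "n \<ge> 1" and bJ: "\<beta> * J < 1/2"
    and eq: "\<And>i j. i \<in> {1..n} \<Longrightarrow> j \<in> {1..n} \<Longrightarrow> A i j = x (edge i j)"
  shows "ln (partition_function J J' \<beta> n A) = \<beta> * cyc n 1 x + \<beta> * (J' - J) + (real n - 1) * \<beta>\<^sup>2
    + ln (zcw_normalized (2 * \<beta>) (2 * \<beta> * J) n x) - (1/2) * ln (1 - 2 * \<beta> * J)"
proof -
  have b: "1 - 2 * \<beta> * J > 0" using bJ by simp
  have "partition_function J J' \<beta> n A = exp (\<beta> * cyc n 1 x + \<beta> * (J' - J) + (real n - 1) * \<beta>\<^sup>2) * zcw (2 * \<beta>) (2 * \<beta> * J) n x"
    unfolding partition_function_eq[OF n, symmetric] by (rule partition_function_cong[OF eq])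
  then have "ln (partition_function J J' \<beta> n A) = \<beta> * cyc n 1 x + \<beta> * (J' - J) + (real n - 1) * \<beta>\<^sup>2 + ln (zcw (2 * \<beta>) (2 * \<beta> * J) n x)"
    using zcw_pos[of "2 * \<beta>" "2 * \<beta> * J" n x] by (simp add: ln_mult)
  moreover have "ln (zcw_normalized (2 * \<beta>) (2 * \<beta> * J) n x) = ln (zcw (2 * \<beta>) (2 * \<beta> * J) n x) + (1/2) * ln (1 - 2 * \<beta> * J)"
    unfolding zcw_normalized_def using zcw_pos[of "2 * \<beta>" "2 * \<beta> * J" n x] b by (simp add: ln_mult ln_sqrt)
  ultimately show ?thesis by simp
qed

text \<open>As an affine image of the standard normal law, \<open>normal_law\<close> inherits its
  characteristic function; the density form requires a positive variance.\<close>

lemma normal_law_eq: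
  assumes "s > 0"
  shows "normal_law c s = distr std_normal_distribution borel (\<lambda>z. c + sqrt s * z)"
proof -
  interpret prob_space std_normal_distribution by (rule prob_space_std_normal)
  have "distributed std_normal_distribution lborel (\<lambda>x. x) std_normal_density"
    by (simp add: distributed_def distr_id2)
  from normal_density_affine[OF this, of "sqrt s" c] assms
  have "distributed std_normal_distribution lborel (\<lambda>x. c + sqrt s * x) (normal_density c (sqrt s))" by simp
  then have "distr std_normal_distribution lborel (\<lambda>x. c + sqrt s * x) = normal_law c s"
    unfolding normal_law_def by (rule distributed_distr_eq_density)
  moreover have "distr std_normal_distribution lborel (\<lambda>x. c + sqrt s * x) = distr std_normal_distribution borel (\<lambda>x. c + sqrt s * x)"
    by (rule distr_cong) auto
  ultimately show ?thesis by simp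
qed

lemma real_distribution_normal_law: "s > 0 \<Longrightarrow> real_distribution (normal_law c s)"
proof -
  interpret prob_space std_normal_distribution by (rule prob_space_std_normal)
  assume s: "s > 0"
  show ?thesis unfolding normal_law_eq[OF s] by (intro real_distribution_distr) simp
qed

lemma char_normal_law: "s > 0 \<Longrightarrow> char (normal_law c s) t = iexp (t * c) * of_real (exp (- s * t\<^sup>2 / 2))"
proof -
  assume s: "s > 0"
  have "char (normal_law c s) t = (\<integral>z. iexp (t * (c + sqrt s * z)) \<partial>std_normal_distribution)"
    unfolding normal_law_eq[OF s] char_def by (rule integral_distr) auto
  also have "\<dots> = (\<integral>z. iexp (t * c) * iexp ((t * sqrt s) * z) \<partial>std_normal_distribution)"
    by (rule Bochner_Integration.integral_cong) (auto simp: exp_add[symmetric] algebra_simps)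
  also have "\<dots> = iexp (t * c) * char std_normal_distribution (t * sqrt s)"
    unfolding char_def by (rule integral_mult_right_zero)
  also have "\<dots> = iexp (t * c) * of_real (exp (- s * t\<^sup>2 / 2))"
    unfolding char_std_normal_distribution using s by (simp add: power_mult_distrib mult.commute)
  finally show ?thesis .
qed

text \<open>The limit statement depends only on the law of the n-th variable, so each
  \<open>\<Omega> n\<close> may be replaced by \<open>G n\<close>. The case n = 0, about which
  nothing is assumed, is left out by comparing the sequences eventually.\<close>

lemma converges_in_probability_transfer:
  assumes T: "\<And>n. n \<ge> 1 \<Longrightarrow> T n \<in> measurable (\<Omega> n) (G n)" "\<And>n. n \<ge> 1 \<Longrightarrow> distr (\<Omega> n) (G n) (T n) = G n"
    and F: "\<And>n. n \<ge> 1 \<Longrightarrow> F n \<in> borel_measurable (G n)"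
    and X: "\<And>n \<omega>. n \<ge> 1 \<Longrightarrow> \<omega> \<in> space (\<Omega> n) \<Longrightarrow> X n \<omega> = F n (T n \<omega>)"
    and lim: "\<And>\<epsilon>. \<epsilon> > 0 \<Longrightarrow> (\<lambda>n. measure (G n) {x \<in> space (G n). \<bar>F n x\<bar> > \<epsilon>}) \<longlonglongrightarrow> 0"
  shows "converges_in_probability \<Omega> X 0"
  unfolding converges_in_probability_def
proof (intro conjI allI impI)
  fix n :: nat assume n: "n \<ge> 1"
  show "X n \<in> borel_measurable (\<Omega> n)"
    using measurable_compose[OF T(1)[OF n] F[OF n]] X[OF n] by (simp cong: measurable_cong)
next
  fix \<epsilon> :: real assume \<epsilon>: "\<epsilon> > 0"
  have "\<forall>\<^sub>F n in sequentially. measure (G n) {x \<in> space (G n). \<bar>F n x\<bar> > \<epsilon>} = measure (\<Omega> n) {\<omega> \<in> space (\<Omega> n). \<bar>X n \<omega> - 0\<bar> > \<epsilon>}"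
    using eventually_ge_at_top[of 1]
  proof eventually_elim
    case n: (elim n)
    note [measurable] = F[OF n]
    have "measure (G n) {x \<in> space (G n). \<bar>F n x\<bar> > \<epsilon>} = measure (distr (\<Omega> n) (G n) (T n)) {x \<in> space (G n). \<bar>F n x\<bar> > \<epsilon>}"
      unfolding T(2)[OF n] ..
    also have "\<dots> = measure (\<Omega> n) (T n -` {x \<in> space (G n). \<bar>F n x\<bar> > \<epsilon>} \<inter> space (\<Omega> n))"
      by (rule measure_distr[OF T(1)[OF n]]) measurable
    also have "T n -` {x \<in> space (G n). \<bar>F n x\<bar> > \<epsilon>} \<inter> space (\<Omega> n) = {\<omega> \<in> space (\<Omega> n). \<bar>X n \<omega> - 0\<bar> > \<epsilon>}"
      using X[OF n] measurable_space[OF T(1)[OF n]] by auto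
    finally show ?case .
  qed
  with lim[OF \<epsilon>] show "(\<lambda>n. measure (\<Omega> n) {\<omega> \<in> space (\<Omega> n). \<bar>X n \<omega> - 0\<bar> > \<epsilon>}) \<longlonglongrightarrow> 0"
    by (rule Lim_transform_eventually)
qed

lemma converges_in_distribution_transfer:
  assumes T: "\<And>n. n \<ge> 1 \<Longrightarrow> T n \<in> measurable (\<Omega> n) (G n)" "\<And>n. n \<ge> 1 \<Longrightarrow> distr (\<Omega> n) (G n) (T n) = G n"
    and F: "\<And>n. n \<ge> 1 \<Longrightarrow> F n \<in> borel_measurable (G n)"
    and X: "\<And>n \<omega>. n \<ge> 1 \<Longrightarrow> \<omega> \<in> space (\<Omega> n) \<Longrightarrow> X n \<omega> = F n (T n \<omega>)"
    and lim: "weak_conv_m (\<lambda>n. distr (G n) borel (F n)) \<mu>"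
  shows "converges_in_distribution \<Omega> X \<mu>"
  unfolding converges_in_distribution_def
proof (intro conjI allI impI)
  fix n :: nat assume n: "n \<ge> 1"
  show "X n \<in> borel_measurable (\<Omega> n)"
    using measurable_compose[OF T(1)[OF n] F[OF n]] X[OF n] by (simp cong: measurable_cong)
next
  have "\<forall>\<^sub>F n in sequentially. distr (G n) borel (F n) = distr (\<Omega> n) borel (X n)"
    using eventually_ge_at_top[of 1]
  proof eventually_elim
    case n: (elim n)
    have "distr (G n) borel (F n) = distr (distr (\<Omega> n) (G n) (T n)) borel (F n)" unfolding T(2)[OF n] ..
    also have "\<dots> = distr (\<Omega> n) borel (F n \<circ> T n)" by (rule distr_distr[OF F[OF n] T(1)[OF n]])
    also have "\<dots> = distr (\<Omega> n) borel (X n)" by (rule distr_cong) (use X[OF n] in auto)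
    finally show ?case .
  qed
  then have ev: "\<forall>\<^sub>F n in sequentially. cdf (distr (G n) borel (F n)) y = cdf (distr (\<Omega> n) borel (X n)) y" for y
    by eventually_elim simp
  show "weak_conv_m (\<lambda>n. distr (\<Omega> n) borel (X n)) \<mu>"
    using lim unfolding weak_conv_m_def weak_conv_def
    by (auto intro: Lim_transform_eventually[OF _ ev])
qed

theorem theorem2p1:
  fixes J J' \<beta> :: real
    and \<Omega> :: "nat \<Rightarrow> 'a measure"
    and A :: "nat \<Rightarrow> 'a \<Rightarrow> nat \<Rightarrow> nat \<Rightarrow> real"
  defines "f1 \<equiv> - (1/2) * ln (1 - 2 * \<beta> * J) + \<beta> * (J' - J) + (1/4) * ln (1 - 4 * \<beta>\<^sup>2)"
    and "\<alpha>1 \<equiv> - \<beta>\<^sup>2 - (1/2) * ln (1 - 4 * \<beta>\<^sup>2)"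
  assumes "J \<ge> 0" and "J' \<ge> 0"
    and "\<beta> > 0" and "\<beta> < 1/2" and "\<beta> * J < 1/2"
    and "\<And>n. n \<ge> 1 \<Longrightarrow> gaussian_symmetric_matrix (\<Omega> n) n (A n)"
  shows "converges_in_distribution \<Omega>
           (\<lambda>n \<omega>. real n * (free_energy J J' \<beta> n (A n \<omega>) - \<beta>\<^sup>2)) (normal_law f1 \<alpha>1) \<and>
         (\<forall>m :: nat \<Rightarrow> nat.
            (\<forall>n\<ge>1. m n \<ge> 1) \<longrightarrow> filterlim m at_top at_top \<longrightarrow>
            (\<lambda>n. real (m n)) \<in> o(\<lambda>n. sqrt (ln (real n))) \<longrightarrow>
            converges_in_probability \<Omega>
              (\<lambda>n \<omega>. ln (partition_function J J' \<beta> n (A n \<omega>))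
                 + (1/2) * ln (1 - 2 * \<beta> * J) - (real n - 1) * \<beta>\<^sup>2 + \<beta> * (J - J')
                 - \<beta> * signed_cycle n 1 (A n \<omega>)
                 - (\<Sum>k=2..m n.
                      (2 * (2 * \<beta>) ^ k *
                         (signed_cycle n k (A n \<omega>) - (real n - 1) * (if k = 2 then 1 else 0))
                       - (2 * \<beta>) ^ (2 * k)) / (4 * real k))) 0)"
proof (intro conjI allI impI)
  note pos = assms(3-7)
  let ?lam = "2 * \<beta>" and ?b = "2 * \<beta> * J"
  let ?G = "\<lambda>n. gauss_space (idx n)"
  let ?T = "\<lambda>n \<omega>. \<lambda>e\<in>idx n. A n \<omega> (fst e) (snd e)"
  let ?lnZ = "\<lambda>n x. ln (zcw_normalized ?lam ?b n x)"
  have lam: "0 \<le> ?lam" "?lam < 1" and b: "0 \<le> ?b" "?b < 1" using pos by simp_all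
  have T: "?T n \<in> measurable (\<Omega> n) (?G n)" "distr (\<Omega> n) (?G n) (?T n) = ?G n" if "n \<ge> 1" for n
    using gaussian_matrix_law(1,2)[OF that assms(8)[OF that]] by auto
  have entry: "A n \<omega> i j = ?T n \<omega> (edge i j)" if "n \<ge> 1" "\<omega> \<in> space (\<Omega> n)" "i \<in> {1..n}" "j \<in> {1..n}" for n \<omega> i j
    by (rule gaussian_matrix_law(3)[OF that(1) assms(8)[OF that(1)] that(2-4)])
  have log_Z: "ln (partition_function J J' \<beta> n (A n \<omega>)) = \<beta> * cyc n 1 (?T n \<omega>) + \<beta> * (J' - J) + (real n - 1) * \<beta>\<^sup>2
      + ?lnZ n (?T n \<omega>) - (1/2) * ln (1 - 2 * \<beta> * J)" if "n \<ge> 1" "\<omega> \<in> space (\<Omega> n)" for n \<omega>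
    by (rule log_partition_function[where x = "?T n \<omega>" and A = "A n \<omega>", OF that(1) pos(5)]) (rule entry[OF that])
  have cycles: "signed_cycle n k (A n \<omega>) = cyc n k (?T n \<omega>)" if "n \<ge> 1" "\<omega> \<in> space (\<Omega> n)" "k \<ge> 1" for n \<omega> k
  proof -
    have "signed_cycle n k (A n \<omega>) = signed_cycle n k (\<lambda>i j. ?T n \<omega> (edge i j))"
      by (rule signed_cycle_cong[OF _ that(3)]) (rule entry[OF that(1,2)])
    also have "\<dots> = cyc n k (?T n \<omega>)" by (rule signed_cycle_eq_cyc[OF that(3)])
    finally show ?thesis .
  qed
  have lnZ_meas: "?lnZ n \<in> borel_measurable (?G n)" for n
    by (rule measurable_compose[OF zcw_normalized_measurable borel_measurable_ln[OF measurable_ident_sets[OF refl]]])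
  have cyc_meas: "cyc n 1 \<in> borel_measurable (?G n)" for n by (rule gpoly_measurable[OF gpoly_cyc]) simp
  show "converges_in_distribution \<Omega> (\<lambda>n \<omega>. real n * (free_energy J J' \<beta> n (A n \<omega>) - \<beta>\<^sup>2)) (normal_law f1 \<alpha>1)"
  proof (rule converges_in_distribution_transfer[OF T])
    \<comment> \<open>The deterministic part of ln Z_n - n beta^2, apart from the centring of the
      cycle sum; of (n - 1) beta^2 only -beta^2 remains.\<close>
    define c where "c = \<beta> * (J' - J) - \<beta>\<^sup>2 - (1/2) * ln (1 - 2 * \<beta> * J)"
    let ?F = "\<lambda>n x. c + (?lam / 2 * cyc n 1 x + ?lnZ n x)"
    define v where "v = - ln (1 - ?lam\<^sup>2) / 2 - ?lam\<^sup>2 / 2"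
    have f1: "f1 = c - v / 2"
      by (simp add: f1_def c_def v_def power_mult_distrib add_divide_distrib diff_divide_distrib)
    have \<alpha>1: "\<alpha>1 = ?lam\<^sup>2 / 4 + v"
      by (simp add: \<alpha>1_def v_def power_mult_distrib)
    \<comment> \<open>The limit law is given by a density and must be nondegenerate. The inequality
      ln(1 - y) <= -y at y = 4 beta^2 shows that the variance is at least beta^2.\<close>
    have \<alpha>1_pos: "\<alpha>1 > 0"
    proof -
      have "4 * \<beta>\<^sup>2 < 1" using lam power_less_one_iff[of ?lam 2] by (simp add: power_mult_distrib)
      then have "ln (1 - 4 * \<beta>\<^sup>2) \<le> - 4 * \<beta>\<^sup>2" using ln_le_minus_one[of "1 - 4 * \<beta>\<^sup>2"] by simp
      moreover have "\<beta>\<^sup>2 > 0" using pos by simp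
      ultimately show ?thesis unfolding \<alpha>1_def by linarith
    qed
    show F_meas: "?F n \<in> borel_measurable (?G n)" for n
      by (intro borel_measurable_add borel_measurable_times borel_measurable_const lnZ_meas cyc_meas)
    show "real n * (free_energy J J' \<beta> n (A n \<omega>) - \<beta>\<^sup>2) = ?F n (?T n \<omega>)" if "n \<ge> 1" "\<omega> \<in> space (\<Omega> n)" for n \<omega>
      using that(1) by (simp add: free_energy_def log_Z[OF that] c_def algebra_simps)
    show "weak_conv_m (\<lambda>n. distr (?G n) borel (?F n)) (normal_law f1 \<alpha>1)"
    proof (rule levy_continuity)
      show "real_distribution (normal_law f1 \<alpha>1)" by (rule real_distribution_normal_law[OF \<alpha>1_pos])
      show "real_distribution (distr (?G n) borel (?F n))" for n
      proof -
        interpret prob_space "?G n" by (rule prob_space_gauss_space)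
        show ?thesis by (rule real_distribution_distr[OF F_meas])
      qed
      fix t
      let ?W = "\<lambda>n. \<integral>x. iexp (t * (?lam / 2 * cyc n 1 x + ?lnZ n x)) \<partial>?G n"
      have "char (distr (?G n) borel (?F n)) t = iexp (t * c) * ?W n" for n
      proof -
        have "char (distr (?G n) borel (?F n)) t = (\<integral>x. iexp (t * ?F n x) \<partial>?G n)"
          unfolding char_def by (rule integral_distr[OF F_meas]) simp
        also have "\<dots> = (\<integral>x. iexp (t * c) * iexp (t * (?lam / 2 * cyc n 1 x + ?lnZ n x)) \<partial>?G n)"
          by (rule Bochner_Integration.integral_cong) (auto simp: exp_add[symmetric] algebra_simps)
        finally show ?thesis unfolding integral_mult_right_zero .
      qed
      moreover have "(\<lambda>n. iexp (t * c) * ?W n) \<longlonglongrightarrow> iexp (t * c) * (iexp (t * (- v / 2)) * of_real (exp (- (?lam\<^sup>2 / 4 + v) * t\<^sup>2 / 2)))"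
        unfolding v_def by (intro tendsto_mult tendsto_const ln_zcw_char_tendsto lam b)
      moreover have "iexp (t * c) * (iexp (t * (- v / 2)) * of_real (exp (- (?lam\<^sup>2 / 4 + v) * t\<^sup>2 / 2))) = char (normal_law f1 \<alpha>1) t"
      proof -
        have "iexp (t * c) * iexp (t * (- v / 2)) = iexp (t * f1)"
          unfolding f1 by (simp add: exp_add[symmetric] algebra_simps)
        then show ?thesis unfolding char_normal_law[OF \<alpha>1_pos] unfolding \<alpha>1 by (simp only: mult.assoc[symmetric])
      qed
      ultimately show "(\<lambda>n. char (distr (?G n) borel (?F n)) t) \<longlonglongrightarrow> char (normal_law f1 \<alpha>1) t" by (simp only:)
    qed
  qed
  fix m :: "nat \<Rightarrow> nat" assume m: "filterlim m at_top at_top"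
  let ?F = "\<lambda>n x. ?lnZ n x - cycle_log ?lam (m n) n x"
  show "converges_in_probability \<Omega>
              (\<lambda>n \<omega>. ln (partition_function J J' \<beta> n (A n \<omega>))
                 + (1/2) * ln (1 - 2 * \<beta> * J) - (real n - 1) * \<beta>\<^sup>2 + \<beta> * (J - J')
                 - \<beta> * signed_cycle n 1 (A n \<omega>)
                 - (\<Sum>k=2..m n.
                      (2 * (2 * \<beta>) ^ k *
                         (signed_cycle n k (A n \<omega>) - (real n - 1) * (if k = 2 then 1 else 0))
                       - (2 * \<beta>) ^ (2 * k)) / (4 * real k))) 0"
  proof (rule converges_in_probability_transfer[OF T])
    show "?F n \<in> borel_measurable (?G n)" for n
      by (intro borel_measurable_diff lnZ_meas cycle_log_measurable)
    show "(\<lambda>n. measure (?G n) {x \<in> space (?G n). \<bar>?F n x\<bar> > \<epsilon>}) \<longlonglongrightarrow> 0" if "\<epsilon> > 0" for \<epsilon>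
      by (rule ln_zcw_converges_in_probability[OF lam b m that])
    fix n \<omega> assume n: "n \<ge> 1" and \<omega>: "\<omega> \<in> space (\<Omega> n)"
    have "(\<Sum>k=2..m n. (2 * ?lam ^ k * (signed_cycle n k (A n \<omega>) - (real n - 1) * (if k = 2 then 1 else 0)) - ?lam ^ (2 * k)) / (4 * real k))
       = (\<Sum>k=2..m n. cycle_coeff ?lam k * cyc0 n k (?T n \<omega>) - ?lam ^ (2 * k) / (2 * real k) / 2)"
    proof (rule sum.cong[OF refl])
      fix k assume k: "k \<in> {2..m n}"
      then have s: "signed_cycle n k (A n \<omega>) = cyc n k (?T n \<omega>)" by (intro cycles n \<omega>) simp
      \<comment> \<open>Splits a summand of the theorem into the coefficient lam^k/(2k) times the
        centred cycle and half a term of \<open>cycle_variance\<close>.\<close>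
      have "(2 * p * q - r) / (4 * d) = p / (2 * d) * q - r / (2 * d) / 2" if "d > 0" for p q r d :: real
        using that by (simp add: field_simps)
      from this[of "real k"] k show "(2 * ?lam ^ k * (signed_cycle n k (A n \<omega>) - (real n - 1) * (if k = 2 then 1 else 0)) - ?lam ^ (2 * k)) / (4 * real k)
         = cycle_coeff ?lam k * cyc0 n k (?T n \<omega>) - ?lam ^ (2 * k) / (2 * real k) / 2"
        unfolding s by (simp add: cycle_coeff_def cyc0_def)
    qed
    also have "\<dots> = cycle_log ?lam (m n) n (?T n \<omega>)"
    proof -
      have "(\<Sum>k=2..m n. cycle_coeff ?lam k * cyc0 n k (?T n \<omega>)) = lin (cycle_coeff ?lam) (m n) n (?T n \<omega>)"
        unfolding lin_def
      proof (rule sum.mono_neutral_left)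
        show "\<forall>k\<in>{1..m n} - {2..m n}. cycle_coeff ?lam k * cyc0 n k (?T n \<omega>) = 0"
          by (auto simp: cycle_coeff_def)
      qed auto
      then show ?thesis by (simp add: sum_subtractf cycle_log_def cycle_variance_def sum_divide_distrib)
    qed
    finally show "ln (partition_function J J' \<beta> n (A n \<omega>))
                 + (1/2) * ln (1 - 2 * \<beta> * J) - (real n - 1) * \<beta>\<^sup>2 + \<beta> * (J - J')
                 - \<beta> * signed_cycle n 1 (A n \<omega>)
                 - (\<Sum>k=2..m n.
                      (2 * (2 * \<beta>) ^ k *
                         (signed_cycle n k (A n \<omega>) - (real n - 1) * (if k = 2 then 1 else 0))
                       - (2 * \<beta>) ^ (2 * k)) / (4 * real k)) = ?F n (?T n \<omega>)"
      using log_Z[OF n \<omega>] cycles[OF n \<omega>, of 1] by (simp add: algebra_simps)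
  qed
qed

end
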